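(* Let $M=p_i^{n_i}p_j^{2}p_k^{2}$ with $p_i,p_j,p_k$ distinct primes and $n_i\ge1$. Let $A,B\subset\mathbb{Z}_M$ with $A\oplus B=\mathbb{Z}_M$, $|A|=p_ip_jp_k$ and $\Phi_M\mid A$, and suppose $A$ contains a $p_i$ extended corner on a $D(M)$-grid $\Lambda$: there exist $a,a_i\in A\cap\Lambda$ with $(a-a_i,M)=M/p_i$ such that $A\cap(a*F_j*F_k)$ is $M$-fibered in the $p_j$ direction but not in the $p_k$ direction, and $A\cap(a_i*F_j*F_k)$ is $M$-fibered in the $p_k$ direction but not in the $p_j$ direction. Then the tiling $A\oplus B=\mathbb{Z}_M$ is T2-equivalent to $\Lambda\oplus B=\mathbb{Z}_M$ via fiber shifts, and both $A$ and $B$ satisfy (T2).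
   Context: $A\oplus B=\mathbb{Z}_M$: unique representation $a+b$. Masks $A(X)=\sum_{a\in A}X^a$ mod $X^M-1$; $\Phi_s$ cyclotomic. (T2) for $A$: with $S_A$ the set of prime powers $s\mid M$ with $\Phi_s\mid A$, whenever $s_1,\dots,s_r\in S_A$ are powers of distinct primes, $\Phi_{s_1\cdots s_r}\mid A$. $(x,M)$ is the gcd. $D(M)=p_i^{n_i-1}p_jp_k$; a $D(M)$-grid is $x+D(M)\mathbb{Z}_M$. $F_\nu=\{0,M/p_\nu,\dots,(p_\nu-1)M/p_\nu\}$, $x*F_\nu=x+F_\nu$, $x*F_j*F_k=x+F_j+F_k$; a set $S$ is $M$-fibered in the $p_\nu$ direction if $S=S'+F_\nu$ for some $S'\subset S$. T2-equivalent: $A$ satisfies (T2) iff $\Lambda$ does, both tiling with $B$. "Via fiber shifts": the new set is obtained by finitely many steps each replacing an $M$-fiber $x*F_\nu$ ($\nu\in\{j,k\}$) in the current set by $x'*F_\nu$ with $(x-x',M)=M/p_\nu^2$, each intermediate set tiling with $B$. *)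

theory Defs
  imports
    Complex_Main
    "HOL-Computational_Algebra.Polynomial"
    "HOL-Number_Theory.Totient"
    "HOL-Number_Theory.Prime_Powers"
begin

text \<open>The cyclic group of order \<open>M\<close> is represented by the integers \<open>{0..<M}\<close> with addition
  modulo \<open>M\<close>.\<close>

definition zmod :: "nat \<Rightarrow> int set" where
  "zmod M = {0..<int M}"

definition sumset :: "nat \<Rightarrow> int set \<Rightarrow> int set \<Rightarrow> int set" where
  "sumset M S T = (\<lambda>(s, t). (s + t) mod int M) ` (S \<times> T)"

definition tiling :: "nat \<Rightarrow> int set \<Rightarrow> int set \<Rightarrow> bool" where
  "tiling M A B \<longleftrightarrow> A \<subseteq> zmod M \<and> B \<subseteq> zmod M \<and>
     bij_betw (\<lambda>(a, b). (a + b) mod int M) (A \<times> B) (zmod M)"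

text \<open>The mask polynomial is formed with the representatives in \<open>{0..<M}\<close>. The choice does not
  matter for divisibility by the cyclotomic polynomial of order \<open>s\<close> with \<open>s\<close> dividing \<open>M\<close>, as
  that divides \<open>X ^ M - 1\<close>. Cyclotomic polynomials are monic with integer coefficients, so
  divisibility over the complex numbers agrees with divisibility over the integers.\<close>

definition mask_poly :: "int set \<Rightarrow> complex poly" where
  "mask_poly A = (\<Sum>a\<in>A. Polynomial.monom 1 (nat a))"

definition cyclotomic :: "nat \<Rightarrow> complex poly" where
  "cyclotomic s = (\<Prod>k\<in>totatives s. [:- cis (2 * pi * real k / real s), 1:])"

definition prime_power_divs :: "nat \<Rightarrow> int set \<Rightarrow> nat set" where
  "prime_power_divs M A = {s. primepow s \<and> s dvd M \<and> cyclotomic s dvd mask_poly A}"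

text \<open>For a prime power \<open>s\<close>, \<open>aprimedivisor s\<close> is the prime of which \<open>s\<close> is a power, so the
  injectivity condition says that the elements of \<open>T\<close> are powers of distinct primes.\<close>

definition T2 :: "nat \<Rightarrow> int set \<Rightarrow> bool" where
  "T2 M A \<longleftrightarrow> (\<forall>T. T \<subseteq> prime_power_divs M A \<and> finite T \<and> T \<noteq> {} \<and> inj_on aprimedivisor T \<longrightarrow>
     cyclotomic (\<Prod>T) dvd mask_poly A)"

definition grid :: "nat \<Rightarrow> nat \<Rightarrow> int \<Rightarrow> int set" where
  "grid M d x = range (\<lambda>k. (x + int d * k) mod int M)"

definition fiber :: "nat \<Rightarrow> nat \<Rightarrow> int set" where
  "fiber M p = (\<lambda>k. int (k * (M div p))) ` {..<p}"

definition fibered :: "nat \<Rightarrow> nat \<Rightarrow> int set \<Rightarrow> bool" where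
  "fibered M p S \<longleftrightarrow> (\<exists>S'\<subseteq>S. S = sumset M S' (fiber M p))"

definition fiber_at :: "nat \<Rightarrow> nat \<Rightarrow> int \<Rightarrow> int set" where
  "fiber_at M p x = sumset M {x} (fiber M p)"

definition plane_at :: "nat \<Rightarrow> nat \<Rightarrow> nat \<Rightarrow> int \<Rightarrow> int set" where
  "plane_at M p q x = sumset M (fiber_at M p x) (fiber M q)"

definition extended_corner ::
  "nat \<Rightarrow> nat \<Rightarrow> nat \<Rightarrow> nat \<Rightarrow> int set \<Rightarrow> int set \<Rightarrow> bool" where
  "extended_corner M p\<^sub>i p\<^sub>j p\<^sub>k A \<Lambda> \<longleftrightarrow>
     (\<exists>a\<in>A \<inter> \<Lambda>. \<exists>a\<^sub>i\<in>A \<inter> \<Lambda>. gcd (a - a\<^sub>i) (int M) = int (M div p\<^sub>i) \<and>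
        fibered M p\<^sub>j (A \<inter> plane_at M p\<^sub>j p\<^sub>k a) \<and>
        \<not> fibered M p\<^sub>k (A \<inter> plane_at M p\<^sub>j p\<^sub>k a) \<and>
        fibered M p\<^sub>k (A \<inter> plane_at M p\<^sub>j p\<^sub>k a\<^sub>i) \<and>
        \<not> fibered M p\<^sub>j (A \<inter> plane_at M p\<^sub>j p\<^sub>k a\<^sub>i))"

definition T2_equivalent :: "nat \<Rightarrow> int set \<Rightarrow> int set \<Rightarrow> int set \<Rightarrow> bool" where
  "T2_equivalent M A \<Lambda> B \<longleftrightarrow> tiling M A B \<and> tiling M \<Lambda> B \<and> (T2 M A \<longleftrightarrow> T2 M \<Lambda>)"

text \<open>One fiber shift, in a direction from \<open>P\<close>, leading from \<open>S\<close> to \<open>S'\<close>. If \<open>S\<close> tiles with \<open>B\<close>,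
  the requirement that \<open>S'\<close> tiles with \<open>B\<close> forces \<open>S\<close> and \<open>S'\<close> to have equal size, so the shifted
  fiber is disjoint from the rest of \<open>S\<close>.\<close>

definition fiber_shift :: "nat \<Rightarrow> nat set \<Rightarrow> int set \<Rightarrow> int set \<Rightarrow> int set \<Rightarrow> bool" where
  "fiber_shift M P B S S' \<longleftrightarrow>
     (\<exists>p\<in>P. \<exists>x\<in>zmod M. \<exists>x'\<in>zmod M.
        fiber_at M p x \<subseteq> S \<and> gcd (x - x') (int M) = int (M div p\<^sup>2) \<and>
        S' = (S - fiber_at M p x) \<union> fiber_at M p x' \<and> tiling M S' B)"

definition T2_equivalent_via_shifts ::
  "nat \<Rightarrow> nat set \<Rightarrow> int set \<Rightarrow> int set \<Rightarrow> int set \<Rightarrow> bool" where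
  "T2_equivalent_via_shifts M P A \<Lambda> B \<longleftrightarrow>
     T2_equivalent M A \<Lambda> B \<and> (fiber_shift M P B)\<^sup>*\<^sup>* A \<Lambda>"

end

theory Submission
  imports Defs "HOL-Number_Theory.Number_Theory"
begin

text \<open>Write \<open>p = p\<^sub>i\<close>, \<open>q = p\<^sub>j\<close>, \<open>r = p\<^sub>k\<close>, \<open>m = n\<^sub>i - 1\<close> and split \<open>\<int>/M\<close> into its coordinates modulo
  \<open>p ^ (m + 1)\<close>, \<open>q\<^sup>2\<close> and \<open>r\<^sup>2\<close>. By Tijdeman's theorem, \<open>A\<close> tiles with \<open>B\<close> multiplied by any unit
  of \<open>\<int>/M\<close>. So for a grid point \<open>x\<close>, an element \<open>b \<in> B\<close> and a unit \<open>u\<close> there are \<open>z \<in> A\<close> and \<open>b' \<in> B\<close>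
  with \<open>x - z = u (b' - b)\<close>, while no nonzero difference of \<open>A\<close> has the same gcd with \<open>M\<close> as a
  difference of \<open>B\<close>. If \<open>x \<notin> A\<close> lies next to the fibers of the corner in both planes, this leaves only
  a few positions for \<open>z\<close>, and counting the elements of \<open>B\<close> in residue classes excludes all but one:
  \<open>z\<close> lies on the line through \<open>x\<close> in the fiber direction, off the grid. It follows that \<open>B\<close>
  represents every residue modulo \<open>D(M)\<close> exactly once, that the sum of \<open>B\<close> with a fiber in the \<open>q\<close> or
  \<open>r\<close> direction does not change when that fiber is shifted by \<open>M/q\<^sup>2\<close> or \<open>M/r\<^sup>2\<close>, and that the lines missing
  from \<open>A\<close> in the two planes of the corner are present in shifted form. Once these two planes are
  full, the same argument confines \<open>z\<close> to the plane of \<open>x\<close> for every other plane of the grid, and each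
  of them turns out to consist of shifted fibers as well.

  For (T2), a shift in the \<open>q\<close> direction changes the value of the mask polynomial only at roots of unity
  whose order is divisible by \<open>q\<close> exactly once. A product of prime powers from \<open>S\<^sub>A\<close> is never such an
  order, as \<open>S\<^sub>A\<close> consists of the full powers of \<open>p\<close>, \<open>q\<close>, \<open>r\<close> in \<open>M\<close>.\<close>

subsection \<open>Differences modulo prime powers\<close>

text \<open>The dilation is the freedom that the argument exploits: the position of \<open>z\<close>
  dictates the type of \<open>b' - b\<close>, while the unit decides which residue of that type is
  hit. If a coordinate of \<open>z\<close> is the same for all units, then \<open>b'\<close> runs
  through a whole residue class in that coordinate. Each competing far position of \<open>z\<close>
  thereby prescribes how many elements of \<open>B\<close> share their residues modulo
  \<open>p ^ m\<close> and \<open>r\<close>: \<open>q\<close>, \<open>p\<close>, or \<open>r\<close>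
  twice. As the primes differ, only \<open>q\<close> fits a set \<open>B\<close> that is a complete
  residue system modulo D(M). The obstacle is that injectivity modulo D(M) is not known beforehand:
  two elements of \<open>B\<close> may agree modulo D(M) and yet differ modulo both \<open>Q\<close>
  and \<open>R\<close>. Excluding such pairs takes most of the corner argument. It compares class
  sizes for \<open>r < q\<close>, which symmetry permits, and the case \<open>r = 2\<close> needs an
  argument of its own. Three distances per coordinate suffice because the corner keeps first
  coordinates within one class modulo \<open>p ^ m\<close>, where the type still determines the
  gcd.\<close>

lemma gcd_prime_power_cases:
  fixes d k :: int
  assumes "prime k"
  obtains v where "v \<le> N" "gcd d (k ^ N) = k ^ v"
proof -
  have "gcd d (k ^ N) dvd k ^ N" by simp
  then obtain v where "v \<le> N" "normalize (gcd d (k ^ N)) = normalize (k ^ v)"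
    using divides_primepow_weak[OF assms] by metis
  moreover have "k > 0" using assms prime_gt_0_int by blast
  ultimately have "gcd d (k ^ N) = k ^ v" by simp
  with \<open>v \<le> N\<close> show ?thesis by (rule that)
qed

text \<open>Dividing out the common power of \<open>k\<close> leaves cofactors prime to
  \<open>k\<close>, one of which is inverted modulo \<open>k ^ N\<close>. This turns an equality of
  gcds into a dilation factor.\<close>

lemma unit_ratio_prime_power:
  fixes d e k :: int
  assumes k: "prime k" and g: "gcd d (k ^ N) = gcd e (k ^ N)"
  shows "\<exists>\<rho>. coprime \<rho> k \<and> k ^ N dvd d - \<rho> * e"
proof -
  obtain v where v: "v \<le> N" "gcd d (k ^ N) = k ^ v"
    by (rule gcd_prime_power_cases[OF k])
  show ?thesis
  proof (cases "v = N")
    case True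
    then have "k ^ N dvd d" "k ^ N dvd e" using v g by (metis gcd_dvd1)+
    then show ?thesis by (intro exI[of _ 1]) auto
  next
    case False
    then have vN: "v < N" using v by simp
    have kpos: "k > 0" using k prime_gt_0_int by blast
    obtain d' where d': "d = k ^ v * d'" using v by (metis dvdE gcd_dvd1)
    obtain e' where e': "e = k ^ v * e'" using v g by (metis dvdE gcd_dvd1)
    have nd: "\<not> k dvd d'"
    proof
      assume "k dvd d'"
      then have "k ^ Suc v dvd d" using d' by (metis mult_dvd_mono dvd_refl power_Suc2)
      moreover have "k ^ Suc v dvd k ^ N" using vN by (intro le_imp_power_dvd) simp
      ultimately have "k ^ Suc v dvd k ^ v" using v by (metis gcd_greatest)
      then show False using k by (metis dvd_power_iff not_prime_unit not_prime_0 not_less_eq_eq order_refl)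
    qed
    have ne: "\<not> k dvd e'"
    proof
      assume "k dvd e'"
      then have "k ^ Suc v dvd e" using e' by (metis mult_dvd_mono dvd_refl power_Suc2)
      moreover have "k ^ Suc v dvd k ^ N" using vN by (intro le_imp_power_dvd) simp
      ultimately have "k ^ Suc v dvd k ^ v" using v g by (metis gcd_greatest)
      then show False using k by (metis dvd_power_iff not_prime_unit not_prime_0 not_less_eq_eq order_refl)
    qed
    have ce: "coprime e' (k ^ N)" using ne k by (metis coprime_commute coprime_power_left_iff prime_imp_coprime)
    then obtain f where f: "[e' * f = 1] (mod k ^ N)" using cong_solve_coprime_int by blast
    have "coprime f (k ^ N)" using f
      by (metis cong_solve_coprime_int coprime_iff_invertible_int mult.commute)
    then have cf: "coprime f k" using vN by (simp add: coprime_power_right_iff)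
    have cd: "coprime d' k" using nd k by (metis coprime_commute prime_imp_coprime)
    have "k ^ N dvd e' * f - 1" using f by (simp add: cong_iff_dvd_diff)
    then have "k ^ N dvd (e' * f - 1) * (- (k ^ v * d'))" by (rule dvd_mult2)
    also have "(e' * f - 1) * (- (k ^ v * d')) = d - (d' * f) * e"
      by (simp add: d' e' algebra_simps)
    finally show ?thesis using cf cd by (intro exI[of _ "d' * f"]) simp
  qed
qed

lemma gcd_cong_unit:
  fixes d e \<rho> m k :: int
  assumes "coprime \<rho> m" "m dvd d - \<rho> * e"
  shows "gcd d m = gcd e m"
proof -
  have "[d = \<rho> * e] (mod m)" using assms(2) by (simp add: cong_iff_dvd_diff)
  then have "gcd d m = gcd (\<rho> * e) m" using cong_gcd_eq by blast
  also have "\<dots> = gcd e m" using assms(1) by (simp add: coprime_commute gcd_mult_left_left_cancel)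
  finally show ?thesis .
qed

text \<open>A number not divisible by \<open>k ^ Suc m\<close> has the same gcd with
  \<open>k ^ Suc m\<close> as with \<open>k ^ m\<close>, and the latter depends only on the residue
  modulo \<open>k ^ m\<close>.\<close>

lemma gcd_near:
  fixes d e k :: int
  assumes k: "prime k" and de: "k ^ m dvd d - e" and d: "\<not> k ^ Suc m dvd d" and e: "\<not> k ^ Suc m dvd e"
  shows "gcd d (k ^ Suc m) = gcd e (k ^ Suc m)"
proof -
  have step: "gcd x (k ^ Suc m) = gcd x (k ^ m)" if "\<not> k ^ Suc m dvd x" for x
  proof -
    obtain v where v: "v \<le> Suc m" "gcd x (k ^ Suc m) = k ^ v"
      by (rule gcd_prime_power_cases[OF k])
    have "v \<noteq> Suc m" using v that by (metis gcd_dvd1)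
    then have "k ^ v dvd k ^ m" using v by (intro le_imp_power_dvd) simp
    then have "gcd x (k ^ Suc m) dvd gcd x (k ^ m)" using v by (metis gcd_dvd1 gcd_greatest)
    moreover have "gcd x (k ^ m) dvd gcd x (k ^ Suc m)" by (simp add: dvd_mult)
    ultimately show ?thesis by (simp add: zdvd_antisym_nonneg)
  qed
  have "[d = e] (mod k ^ m)" using de by (simp add: cong_iff_dvd_diff)
  then have "gcd d (k ^ m) = gcd e (k ^ m)" using cong_gcd_eq by blast
  then show ?thesis using step[OF d] step[OF e] by simp
qed

text \<open>The type of a difference \<open>d\<close> relative to a prime power \<open>m * k\<close>, where \<open>k\<close> is the prime:
  divisible by \<open>m * k\<close>, divisible by \<open>m\<close> only, or neither. For \<open>m = k\<close> the type determines the gcd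
  of \<open>d\<close> and \<open>m * k\<close>; in general it does so except for \<open>Far\<close>.\<close>

datatype dist_type = Equal | Near | Far

definition dtype :: "int \<Rightarrow> int \<Rightarrow> int \<Rightarrow> dist_type" where
  "dtype m k d = (if m * k dvd d then Equal else if m dvd d then Near else Far)"

lemma dtype_E_iff: "dtype m k d = Equal \<longleftrightarrow> m * k dvd d"
  by (auto simp: dtype_def)

lemma dtype_F_iff: "dtype m k d = Far \<longleftrightarrow> \<not> m dvd d"
  by (auto simp: dtype_def dest: dvd_mult_left)

lemma dtype_N_iff: "dtype m k d = Near \<longleftrightarrow> m dvd d \<and> \<not> m * k dvd d"
  by (auto simp: dtype_def)

lemma dtype_minus: "dtype m k (- d) = dtype m k d"
  by (simp add: dtype_def)

lemma dtype_diff_commute: "dtype m k (a - b) = dtype m k (b - a)"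
  by (metis dtype_minus minus_diff_eq)

lemma dtype_cong: "m * k dvd d - e \<Longrightarrow> dtype m k d = dtype m k e"
  by (smt (verit, ccfv_threshold) dtype_def dvd_add_left_iff dvd_mult_left diff_add_cancel dvd_add_right_iff)

lemma dtype_shift: "m * k dvd a - b \<Longrightarrow> dtype m k (a - c) = dtype m k (b - c)"
  by (rule dtype_cong) simp

lemma dtype_shift': "m * k dvd a - b \<Longrightarrow> dtype m k (c - a) = dtype m k (c - b)"
  by (rule dtype_cong) (simp add: dvd_diff_commute)

lemma card_residues:
  fixes m k :: int
  assumes "m > 0" "k > 0"
  shows "card {w \<in> {0..<m * k}. m dvd w - b} = nat k"
proof -
  have "bij_betw (\<lambda>t. b mod m + m * t) {0..<k} {w \<in> {0..<m * k}. m dvd w - b}"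
  proof (rule bij_betwI')
    fix t assume t: "t \<in> {0..<k}"
    have "0 \<le> b mod m" "b mod m < m" using assms by auto
    moreover have "m * t \<le> m * (k - 1)" using t assms by (intro mult_left_mono) auto
    moreover have "0 \<le> m * t" using t assms by simp
    moreover have "m dvd b mod m - b" by (simp add: mod_eq_dvd_iff[symmetric])
    then have "m dvd b mod m + m * t - b" by (metis add_diff_eq diff_add_eq dvd_add dvd_triv_left)
    ultimately show "b mod m + m * t \<in> {w \<in> {0..<m * k}. m dvd w - b}"
      by (auto simp: algebra_simps)
  next
    fix w assume w: "w \<in> {w \<in> {0..<m * k}. m dvd w - b}"
    then have "w mod m = b mod m" by (simp add: mod_eq_dvd_iff)
    then have "w = b mod m + m * (w div m)" by (metis add.commute mult_div_mod_eq)
    moreover have "0 \<le> w div m" using w assms by (simp add: pos_imp_zdiv_nonneg_iff)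
    moreover have "w div m < k"
    proof -
      have "m * (w div m) \<le> w" using assms by (simp add: mult_div_mod_eq[symmetric] minus_mod_eq_mult_div[symmetric])
      then have "m * (w div m) < m * k" using w by simp
      then show ?thesis using assms by simp
    qed
    ultimately show "\<exists>t\<in>{0..<k}. w = b mod m + m * t" by auto
  qed (use assms in auto)
  then show ?thesis using bij_betw_same_card by fastforce
qed

lemma card_le_residues:
  fixes m k :: int
  assumes "m > 0" "k > 0"
    and inj: "\<And>s s'. s \<in> S \<Longrightarrow> s' \<in> S \<Longrightarrow> m * k dvd s - s' \<Longrightarrow> s = s'"
    and sub: "\<And>s. s \<in> S \<Longrightarrow> m dvd s - b"
  shows "card S \<le> nat k"
proof -
  have "inj_on (\<lambda>s. s mod (m * k)) S"
    by (rule inj_onI) (metis inj mod_eq_dvd_iff)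
  moreover have "(\<lambda>s. s mod (m * k)) ` S \<subseteq> {w \<in> {0..<m * k}. m dvd w - b}"
  proof clarify
    fix s assume "s \<in> S"
    have "m dvd s mod (m * k) - s"
      by (meson dvd_mult_left mod_eq_dvd_iff mod_mod_trivial)
    then have "m dvd s mod (m * k) - b" using sub[OF \<open>s \<in> S\<close>]
      by (metis dvd_add diff_add_cancel add_diff_eq)
    then show "s mod (m * k) \<in> {0..<m * k} \<and> m dvd s mod (m * k) - b"
      using assms by simp
  qed
  moreover have "finite {w \<in> {0..<m * k}. m dvd w - b}" by (rule finite_subset[of _ "{0..<m * k}"]) auto
  ultimately have "card S \<le> card {w \<in> {0..<m * k}. m dvd w - b}"
    by (rule card_inj_on_le)
  then show ?thesis using card_residues[OF assms(1,2)] by simp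
qed

lemma card_eq_residues:
  fixes m k :: int
  assumes "m > 0" "k > 0"
    and inj: "\<And>s s'. s \<in> S \<Longrightarrow> s' \<in> S \<Longrightarrow> m * k dvd s - s' \<Longrightarrow> s = s'"
    and sub: "\<And>s. s \<in> S \<Longrightarrow> m dvd s - b"
    and surj: "\<And>w. m dvd w - b \<Longrightarrow> \<exists>s\<in>S. m * k dvd s - w"
    and fin: "finite S"
  shows "card S = nat k"
proof (rule antisym)
  show "card S \<le> nat k" by (rule card_le_residues[OF assms(1,2) inj sub])
  have "{w \<in> {0..<m * k}. m dvd w - b} \<subseteq> (\<lambda>s. s mod (m * k)) ` S"
  proof clarify
    fix w assume w: "w \<in> {0..<m * k}" "m dvd w - b"
    then obtain s where s: "s \<in> S" "m * k dvd s - w" using surj by blast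
    then have "s mod (m * k) = w mod (m * k)" by (simp add: mod_eq_dvd_iff)
    also have "\<dots> = w" using w by simp
    finally show "w \<in> (\<lambda>s. s mod (m * k)) ` S" using s by force
  qed
  then have "card {w \<in> {0..<m * k}. m dvd w - b} \<le> card S"
    by (meson fin card_image_le card_mono finite_imageI order_trans)
  then show "nat k \<le> card S" using card_residues[OF assms(1,2)] by simp
qed

subsection \<open>Tilings in three coordinates\<close>

text \<open>The assumption \<open>cover\<close> expresses that \<open>A\<close> tiles with every dilate of \<open>B\<close>, the dilation factor
  and the translated point being given by their residues modulo the three prime powers;
  \<open>div_disjoint\<close> is Sands's condition on the divisor sets.\<close>

locale dilation_tiling =
  fixes p q r :: int and m :: nat and A B :: "int set"
  assumes prime_p: "prime p" and prime_q: "prime q" and prime_r: "prime r"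
    and distinct: "p \<noteq> q" "p \<noteq> r" "q \<noteq> r"
    and fin_B: "finite B" and B_nonempty: "B \<noteq> {}"
    and card_B: "card B = nat (p ^ m * q * r)"
    and cover: "\<And>b \<rho>1 \<rho>2 \<rho>3 x1 x2 x3.
      b \<in> B \<Longrightarrow> coprime \<rho>1 p \<Longrightarrow> coprime \<rho>2 q \<Longrightarrow> coprime \<rho>3 r \<Longrightarrow>
      \<exists>z\<in>A. \<exists>b'\<in>B. p ^ m * p dvd x1 - z - \<rho>1 * (b' - b) \<and>
        q * q dvd x2 - z - \<rho>2 * (b' - b) \<and> r * r dvd x3 - z - \<rho>3 * (b' - b)"
    and div_disjoint: "\<And>a a' b b'. a \<in> A \<Longrightarrow> a' \<in> A \<Longrightarrow> b \<in> B \<Longrightarrow> b' \<in> B \<Longrightarrow>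
      gcd (a - a') (p ^ m * p) = gcd (b - b') (p ^ m * p) \<Longrightarrow>
      gcd (a - a') (q * q) = gcd (b - b') (q * q) \<Longrightarrow>
      gcd (a - a') (r * r) = gcd (b - b') (r * r) \<Longrightarrow> a = a' \<and> b = b'"
begin

abbreviation "P \<equiv> p ^ m * p"
abbreviation "Q \<equiv> q * q"
abbreviation "R \<equiv> r * r"
abbreviation "typ \<equiv> dtype (p ^ m) p"
abbreviation "tyq \<equiv> dtype q q"
abbreviation "tyr \<equiv> dtype r r"

lemma swapped: "dilation_tiling p r q m A B"
proof
  show "card B = nat (p ^ m * r * q)" using card_B by (simp add: mult.assoc mult.commute[of r q])
  show "\<exists>z\<in>A. \<exists>b'\<in>B. P dvd x1 - z - \<rho>1 * (b' - b) \<and>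
        R dvd x2 - z - \<rho>2 * (b' - b) \<and> Q dvd x3 - z - \<rho>3 * (b' - b)"
    if "b \<in> B" "coprime \<rho>1 p" "coprime \<rho>2 r" "coprime \<rho>3 q" for b \<rho>1 \<rho>2 \<rho>3 x1 x2 x3
    using cover[of b \<rho>1 \<rho>3 \<rho>2 x1 x3 x2] that by blast
qed (use prime_p prime_q prime_r distinct fin_B B_nonempty div_disjoint in auto)

lemma pos: "p > 0" "q > 0" "r > 0" "p ^ m > 0"
  using prime_p prime_q prime_r prime_gt_0_int by auto

lemma B_eqI: "b \<in> B \<Longrightarrow> b' \<in> B \<Longrightarrow> P dvd b - b' \<Longrightarrow> Q dvd b - b' \<Longrightarrow> R dvd b - b' \<Longrightarrow> b = b'"
proof -
  assume b: "b \<in> B" "b' \<in> B" and d: "P dvd b - b'" "Q dvd b - b'" "R dvd b - b'"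
  obtain z where "z \<in> A" using cover[OF b(1), of 1 1 1 0 0 0] by auto
  then show "b = b'" using div_disjoint[of z z b b'] b d
    by (metis abs_gcd_int cong_0_iff cong_gcd_eq cong_sym diff_self)
qed

lemma gcd_dtype:
  assumes "prime k" "dtype k k d = dtype k k e"
  shows "gcd d (k * k) = gcd e (k * k)"
proof (cases "k * k dvd d")
  case True
  then have "k * k dvd e" using assms(2) by (metis dtype_E_iff)
  with True show ?thesis by (metis gcd.commute gcd_proj1_iff abs_dvd_iff gcd_proj2_if_dvd_int)
next
  case False
  then have ne: "\<not> k * k dvd e" using assms(2) by (metis dtype_E_iff)
  show ?thesis
  proof (cases "k dvd d")
    case True
    then have "k dvd e" using assms(2) by (metis dtype_F_iff)
    then show ?thesis using gcd_near[OF assms(1), of 1 d e] True False ne by simp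
  next
    case Far: False
    then have "\<not> k dvd e" using assms(2) by (metis dtype_F_iff)
    then have "coprime e k" "coprime d k" using Far assms(1) by (metis coprime_commute prime_imp_coprime)+
    then show ?thesis by simp
  qed
qed

lemma gcd_typ:
  assumes "typ d = typ e" "typ e \<noteq> Far"
  shows "gcd d P = gcd e P"
proof (cases "P dvd d")
  case True
  then have "P dvd e" using assms(1) by (metis dtype_E_iff)
  with True show ?thesis by (metis gcd.commute gcd_proj1_iff abs_dvd_iff gcd_proj2_if_dvd_int)
next
  case False
  then have ne: "\<not> P dvd e" using assms(1) by (metis dtype_E_iff)
  have "p ^ m dvd d" "p ^ m dvd e" using assms by (metis dtype_F_iff)+
  then show ?thesis using gcd_near[OF prime_p, of m d e] False ne by (simp add: mult.commute)
qed

lemma no_common_type: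
  assumes "a \<in> A" "a' \<in> A" "b \<in> B" "b' \<in> B"
    and "typ (a - a') = typ (b - b')" "typ (b - b') \<noteq> Far"
    and "tyq (a - a') = tyq (b - b')" "tyr (a - a') = tyr (b - b')"
  shows "b = b'"
  using div_disjoint[OF assms(1-4)] gcd_typ[OF assms(5,6)] gcd_dtype[OF prime_q assms(7)]
    gcd_dtype[OF prime_r assms(8)] by blast

text \<open>If \<open>a'\<close> lies on the \<open>p\<close>-fiber of a point \<open>x\<close> outside \<open>A\<close>, then every \<open>z \<in> A\<close> whose
  difference to \<open>x\<close> occurs in \<open>B - B\<close> has its first coordinate in common with \<open>x\<close> or \<open>a'\<close>;
  otherwise \<open>a' - z\<close> and \<open>x - z\<close> would have the same gcd with \<open>M\<close>.\<close>

lemma served_p: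
  assumes "z \<in> A" "a' \<in> A" "b \<in> B" "b' \<in> B"
    and x: "gcd (x1 - z) P = gcd (b' - b) P"
      "gcd (x2 - z) Q = gcd (b' - b) Q" "gcd (x3 - z) R = gcd (b' - b) R"
    and a': "p ^ m dvd a' - x1" "Q dvd a' - x2" "R dvd a' - x3"
  shows "P dvd z - x1 \<or> P dvd z - a'"
proof (rule ccontr)
  assume n: "\<not> ?thesis"
  have "\<not> P dvd x1 - z" "\<not> P dvd a' - z" using n by (metis dvd_diff_commute)+
  then have 1: "gcd (a' - z) P = gcd (x1 - z) P"
    using gcd_near[OF prime_p, of m "a' - z" "x1 - z"] a'(1) by (simp add: mult.commute)
  have 2: "gcd (a' - z) Q = gcd (x2 - z) Q"
    by (rule gcd_dtype[OF prime_q]) (rule dtype_shift[OF a'(2)])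
  have 3: "gcd (a' - z) R = gcd (x3 - z) R"
    by (rule gcd_dtype[OF prime_r]) (rule dtype_shift[OF a'(3)])
  have "a' = z" using div_disjoint[OF assms(2,1,4,3)] 1 2 3 x by simp
  then show False using n by simp
qed

text \<open>The argument of \<open>served_p\<close> in the third coordinate: here \<open>a'\<close>
  lies on the \<open>r\<close>-fiber of the point with coordinates \<open>x1\<close>,
  \<open>x2\<close>, \<open>x3\<close>.\<close>

lemma served_r:
  assumes "z \<in> A" "a' \<in> A" "b \<in> B" "b' \<in> B"
    and x: "gcd (x1 - z) P = gcd (b' - b) P"
      "gcd (x2 - z) Q = gcd (b' - b) Q" "gcd (x3 - z) R = gcd (b' - b) R"
    and a': "P dvd a' - x1" "Q dvd a' - x2" "r dvd a' - x3"
  shows "R dvd z - x3 \<or> R dvd z - a'"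
proof (rule ccontr)
  assume n: "\<not> ?thesis"
  have "\<not> R dvd x3 - z" "\<not> R dvd a' - z" using n by (metis dvd_diff_commute)+
  then have 3: "gcd (a' - z) R = gcd (x3 - z) R"
    using gcd_near[OF prime_r, of 1 "a' - z" "x3 - z"] a'(3) by simp
  have 2: "gcd (a' - z) Q = gcd (x2 - z) Q"
    by (rule gcd_dtype[OF prime_q]) (rule dtype_shift[OF a'(2)])
  have "[a' - z = x1 - z] (mod P)" using a'(1) by (simp add: cong_iff_dvd_diff)
  then have 1: "gcd (a' - z) P = gcd (x1 - z) P" by (rule cong_gcd_eq)
  have "a' = z" using div_disjoint[OF assms(2,1,4,3)] 1 2 3 x by simp
  then show False using n by simp
qed

lemma cover_gcd:
  assumes "coprime \<rho>1 p" "coprime \<rho>2 q" "coprime \<rho>3 r"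
    and "P dvd x1 - z - \<rho>1 * d" "Q dvd x2 - z - \<rho>2 * d" "R dvd x3 - z - \<rho>3 * d"
  shows "gcd (x1 - z) P = gcd d P"
    "gcd (x2 - z) Q = gcd d Q" "gcd (x3 - z) R = gcd d R"
  using assms by (auto intro!: gcd_cong_unit)

lemma dtype_unit:
  assumes "coprime \<rho> k" "j dvd k ^ n" "j * k dvd d - \<rho> * e"
  shows "dtype j k d = dtype j k e"
proof -
  have cj: "coprime \<rho> j" using assms(1,2)
    by (meson coprime_divisors coprime_power_right_iff dvd_refl)
  then have c: "coprime \<rho> (j * k)" using assms(1) by simp
  have "i dvd d \<longleftrightarrow> i dvd e" if "i dvd j * k" for i
  proof -
    have "i dvd d - \<rho> * e" using assms(3) that by (rule dvd_trans[rotated])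
    moreover have "coprime i \<rho>" using c that by (meson coprime_commute coprime_divisors dvd_refl)
    ultimately show ?thesis
      by (metis coprime_dvd_mult_right_iff diff_add_cancel dvd_add_right_iff)
  qed
  then show ?thesis by (simp add: dtype_def)
qed

lemma cover_types:
  assumes "coprime \<rho>1 p" "coprime \<rho>2 q" "coprime \<rho>3 r"
    and "P dvd x1 - z - \<rho>1 * d" "Q dvd x2 - z - \<rho>2 * d" "R dvd x3 - z - \<rho>3 * d"
  shows "typ (x1 - z) = typ d" "tyq (x2 - z) = tyq d" "tyr (x3 - z) = tyr d"
  using assms dtype_unit[of _ p "p ^ m" m] dtype_unit[of _ q q 1] dtype_unit[of _ r r 1] by auto

text \<open>Differences of equal type are carried to each other by a unit. Used as the dilation in
  \<open>cover\<close>, that unit steers \<open>b'\<close> into a prescribed residue class;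
  \<open>unit_dtype\<close> and \<open>unit_mod\<close> do the same for the other
  coordinates.\<close>

lemma unit_typ:
  assumes "typ d = typ e" "typ e \<noteq> Far"
  shows "\<exists>\<rho>. coprime \<rho> p \<and> P dvd d - \<rho> * e"
  using unit_ratio_prime_power[OF prime_p, of d "Suc m" e] gcd_typ[OF assms] by (simp add: mult.commute)

lemma unit_dtype:
  assumes "prime k" "dtype k k d = dtype k k e"
  shows "\<exists>\<rho>. coprime \<rho> k \<and> k * k dvd d - \<rho> * e"
  using unit_ratio_prime_power[OF assms(1), of d 2 e] gcd_dtype[OF assms] by (simp add: power2_eq_square)

lemma unit_mod:
  assumes "prime k" "\<not> k dvd d" "\<not> k dvd e"
  shows "\<exists>\<rho>. coprime \<rho> k \<and> k dvd d - \<rho> * (e::int)"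
proof -
  have "coprime d k" "coprime e k" using assms by (metis coprime_commute prime_imp_coprime)+
  then show ?thesis using unit_ratio_prime_power[OF assms(1), of d 1 e] by simp
qed

end

lemma dvd_sym: "(d::int) dvd a - b \<Longrightarrow> d dvd b - a"
  by (simp add: dvd_diff_commute)

lemma dvd_tr: "(d::int) dvd a - b \<Longrightarrow> d dvd b - c \<Longrightarrow> d dvd a - c"
  by (metis mod_eq_dvd_iff)

lemmas dvd_rules = dvd_sym dvd_tr dvd_mult_left

section \<open>Types that do not occur among the differences of \<open>B\<close>\<close>

context dilation_tiling
begin

definition avoids :: "dist_type \<Rightarrow> dist_type \<Rightarrow> dist_type \<Rightarrow> bool" where
  "avoids t1 t2 t3 \<longleftrightarrow> (\<forall>b\<in>B. \<forall>b'\<in>B. \<not> (typ (b - b') = t1 \<and> tyq (b - b') = t2 \<and> tyr (b - b') = t3))"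

lemma avoidsD: "avoids t1 t2 t3 \<Longrightarrow> b \<in> B \<Longrightarrow> b' \<in> B \<Longrightarrow> typ (b - b') = t1 \<Longrightarrow> tyq (b - b') = t2 \<Longrightarrow>
    tyr (b - b') = t3 \<Longrightarrow> False"
  unfolding avoids_def by blast

lemma dtype_at: "j * k dvd z - u \<Longrightarrow> j * k dvd z' - v \<Longrightarrow> dtype j k (z - z') = dtype j k (u - v)"
  by (metis dtype_shift dtype_shift')

text \<open>Sands's condition needs a type that fixes the gcd, hence \<open>t1\<close> must not be
  \<open>Far\<close>; the type of \<open>b - b\<close> has to be exempted as well.\<close>

lemma avoidsI:
  assumes "a \<in> A" "a' \<in> A" "typ (a - a') = t1" "tyq (a - a') = t2" "tyr (a - a') = t3"
    and "t1 \<noteq> Far" "(t1, t2, t3) \<noteq> (Equal, Equal, Equal)"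
  shows "avoids t1 t2 t3"
  unfolding avoids_def
proof (intro ballI notI)
  fix b b' assume b: "b \<in> B" "b' \<in> B" and t: "typ (b - b') = t1 \<and> tyq (b - b') = t2 \<and> tyr (b - b') = t3"
  have "b = b'" by (rule no_common_type[OF assms(1,2) b]) (use t assms in auto)
  then show False using t assms(7) by (auto simp: dtype_def)
qed

end

subsection \<open>Extended corners\<close>

text \<open>The point \<open>x0\<close> fixes the grid. In the plane \<open>a0\<close> the set \<open>A\<close> contains the line in the \<open>q\<close>
  direction through \<open>k0\<close> and misses another one, and in the plane \<open>a1\<close> it contains the line in the
  \<open>r\<close> direction through \<open>j0\<close> and misses another one.\<close>

locale corner = dilation_tiling +
  fixes x0 a0 a1 j0 k0 :: int
  assumes a01: "p ^ m dvd a0 - a1" "\<not> P dvd a0 - a1"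
    and j0: "q dvd j0 - x0" and k0: "r dvd k0 - x0"
    and line_q: "\<And>v. q dvd v - x0 \<Longrightarrow> \<exists>z\<in>A. P dvd z - a0 \<and> Q dvd z - v \<and> R dvd z - k0"
    and line_r: "\<And>w. r dvd w - x0 \<Longrightarrow> \<exists>z\<in>A. P dvd z - a1 \<and> Q dvd z - j0 \<and> R dvd z - w"
    and hole_r: "\<exists>k. r dvd k - x0 \<and> (\<forall>z\<in>A. P dvd z - a0 \<longrightarrow> q dvd z - x0 \<longrightarrow> \<not> R dvd z - k)"
    and hole_q: "\<exists>j. q dvd j - x0 \<and> (\<forall>z\<in>A. P dvd z - a1 \<longrightarrow> r dvd z - x0 \<longrightarrow> \<not> Q dvd z - j)"
begin

text \<open>Exchanging \<open>q\<close> and \<open>r\<close> exchanges the two planes too, so each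
  result on \<open>q\<close>-lines in the plane \<open>a0\<close> also yields one on
  \<open>r\<close>-lines in the plane \<open>a1\<close>.\<close>

lemma swapped_corner: "corner p r q m A B x0 a1 a0 k0 j0"
proof -
  interpret sw: dilation_tiling p r q m A B by (rule swapped)
  show ?thesis
  proof
    show "p ^ m dvd a1 - a0" "\<not> P dvd a1 - a0"
      using a01 by (metis dvd_diff_commute)+
  qed (use j0 k0 line_q line_r hole_r hole_q in blast)+
qed

abbreviation "hole k \<equiv> r dvd k - x0 \<and> (\<forall>z\<in>A. P dvd z - a0 \<longrightarrow> q dvd z - x0 \<longrightarrow> \<not> R dvd z - k)"

lemma typ_a01: "typ (a0 - a1) = Near" "typ (a1 - a0) = Near"
  using a01 by (auto simp: dtype_N_iff dvd_diff_commute)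

text \<open>The two lines of the corner realise every such difference inside \<open>A\<close>: the
  point of the \<open>q\<close>-line with second coordinate \<open>j0 + (b - b')\<close> minus the
  point of the \<open>r\<close>-line with third coordinate \<open>k0 - (b - b')\<close> agrees with
  \<open>b - b'\<close> in the last two coordinates.\<close>

lemma avoids_NEE:
  assumes "b \<in> B" "b' \<in> B" "typ (b - b') = Near" "q dvd b - b'" "r dvd b - b'"
  shows False
proof -
  obtain z where z: "z \<in> A" "P dvd z - a0" "Q dvd z - (j0 + (b - b'))" "R dvd z - k0"
    using line_q[of "j0 + (b - b')"] dvd_add[OF j0 assms(4)] by (auto simp: algebra_simps)
  obtain z' where z': "z' \<in> A" "P dvd z' - a1" "Q dvd z' - j0" "R dvd z' - (k0 - (b - b'))"
    using line_r[of "k0 - (b - b')"] dvd_diff[OF k0 assms(5)] by (auto simp: algebra_simps)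
  have "typ (z - z') = typ (b - b')" using dtype_at[OF z(2) z'(2)] typ_a01 assms by simp
  moreover have "tyq (z - z') = tyq (b - b')" using dtype_at[OF z(3) z'(3)] by simp
  moreover have "tyr (z - z') = tyr (b - b')" using dtype_at[OF z(4) z'(4)] by simp
  ultimately have "b = b'" using no_common_type[OF z(1) z'(1) assms(1,2)] assms(3) by simp
  then show False using assms(3) by (auto simp: dtype_def)
qed

lemma avoids_ENE: "avoids Equal Near Equal"
proof -
  obtain z where z: "z \<in> A" "P dvd z - a0" "Q dvd z - (j0 + q)" "R dvd z - k0"
    using line_q[of "j0 + q"] dvd_add[OF j0 dvd_refl] by (auto simp: algebra_simps)
  obtain z' where z': "z' \<in> A" "P dvd z' - a0" "Q dvd z' - j0" "R dvd z' - k0"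
    using line_q[of j0] j0 by blast
  have "\<not> Q dvd q" using prime_q by (metis dvd_mult_cancel1 mult.right_neutral not_prime_0 not_prime_unit dvd_times_left_cancel_iff)
  then have "tyq q = Near" by (simp add: dtype_N_iff)
  then show ?thesis
    using avoidsI[OF z(1) z'(1)] dtype_at[OF z(2) z'(2)] dtype_at[OF z(3) z'(3)] dtype_at[OF z(4) z'(4)]
    by (simp add: dtype_def)
qed

lemma avoids_EEN: "avoids Equal Equal Near"
proof -
  interpret sw: corner p r q m A B x0 a1 a0 k0 j0 by (rule swapped_corner)
  show ?thesis using sw.avoids_ENE unfolding sw.avoids_def avoids_def by blast
qed

text \<open>By \<open>near_cases\<close> this is the only way in which distinct elements of
  \<open>B\<close> can agree modulo \<open>p ^ m * q * r\<close>; the lemmas up to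
  \<open>no_partners\<close> work towards excluding it.\<close>

abbreviation partner :: "int \<Rightarrow> int \<Rightarrow> bool" where
  "partner b b' \<equiv> b \<in> B \<and> b' \<in> B \<and> typ (b - b') = Equal \<and> tyq (b - b') = Near \<and> tyr (b - b') = Near"

lemma near_cases:
  assumes "b \<in> B" "b' \<in> B" "p ^ m dvd b - b'" "q dvd b - b'" "r dvd b - b'"
  shows "b = b' \<or> partner b b'"
proof -
  have "typ (b - b') \<noteq> Far" "tyq (b - b') \<noteq> Far" "tyr (b - b') \<noteq> Far" using assms by (simp_all add: dtype_F_iff)
  moreover have "typ (b - b') \<noteq> Near" using avoids_NEE assms by blast
  ultimately consider "typ (b - b') = Equal" "tyq (b - b') = Equal" "tyr (b - b') = Equal" |
    "typ (b - b') = Equal" "tyq (b - b') = Equal" "tyr (b - b') = Near" |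
    "typ (b - b') = Equal" "tyq (b - b') = Near" "tyr (b - b') = Equal" |
    "typ (b - b') = Equal" "tyq (b - b') = Near" "tyr (b - b') = Near"
    by (metis dist_type.exhaust)
  then show ?thesis
    by cases (use avoidsD[OF avoids_EEN] avoidsD[OF avoids_ENE] assms B_eqI dtype_E_iff in blast)+
qed

definition far :: "int \<Rightarrow> int \<Rightarrow> int \<Rightarrow> bool" where
  "far c1 c3 z \<longleftrightarrow> z \<in> A \<and> \<not> q dvd z - x0 \<and> P dvd z - c1 \<and> R dvd z - c3"

definition has_type :: "int \<Rightarrow> dist_type \<Rightarrow> dist_type \<Rightarrow> dist_type \<Rightarrow> bool" where
  "has_type d t1 t2 t3 \<longleftrightarrow> typ d = t1 \<and> tyq d = t2 \<and> tyr d = t3"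

text \<open>The missing point has coordinates \<open>a0\<close>, \<open>j0\<close>,
  \<open>k\<close>. Its \<open>p\<close>-fiber meets the \<open>r\<close>-line in the plane
  \<open>a1\<close>, and its \<open>r\<close>-fiber meets the \<open>q\<close>-line in the plane
  \<open>a0\<close>; so \<open>served_p\<close> and \<open>served_r\<close> leave \<open>a0\<close>
  or \<open>a1\<close> for the first coordinate of \<open>z\<close>, and \<open>k\<close> or
  \<open>k0\<close> for the third. If \<open>z\<close> is also in the grid class modulo
  \<open>q\<close>, then \<open>avoids_NEE\<close>, the hole and \<open>avoids_EEN\<close> leave
  only the type of partners.\<close>

lemma outcome:
  assumes k: "hole k" and b: "b \<in> B" and c: "coprime \<rho>1 p" "coprime \<rho>2 q" "coprime \<rho>3 r"
  obtains z b' where "z \<in> A" "b' \<in> B" "P dvd a0 - z - \<rho>1 * (b' - b)"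
    "Q dvd j0 - z - \<rho>2 * (b' - b)" "R dvd k - z - \<rho>3 * (b' - b)"
    "R dvd z - k0 \<and> has_type (b' - b) Equal Near Near \<or>
     far a0 k z \<and> has_type (b' - b) Equal Far Equal \<or> far a0 k0 z \<and> has_type (b' - b) Equal Far Near \<or>
     far a1 k z \<and> has_type (b' - b) Near Far Equal \<or> far a1 k0 z \<and> has_type (b' - b) Near Far Near"
proof -
  obtain z b' where z: "z \<in> A" "b' \<in> B" and d1: "P dvd a0 - z - \<rho>1 * (b' - b)"
    and d2: "Q dvd j0 - z - \<rho>2 * (b' - b)" and d3: "R dvd k - z - \<rho>3 * (b' - b)"
    using cover[OF b c] by blast
  note g = cover_gcd[OF c d1 d2 d3]
  note t = cover_types[OF c d1 d2 d3]
  obtain a' where a': "a' \<in> A" "P dvd a' - a1" "Q dvd a' - j0" "R dvd a' - k"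
    using line_r k by blast
  obtain a'' where a'': "a'' \<in> A" "P dvd a'' - a0" "Q dvd a'' - j0" "R dvd a'' - k0"
    using line_q j0 by blast
  have "p ^ m dvd a' - a0"
    using a01(1) a'(2) by (metis dvd_rules)
  then have z1: "P dvd z - a0 \<or> P dvd z - a1"
    using served_p[OF z(1) a'(1) b z(2) g _ a'(3,4)] a'(2) by (metis dvd_rules)
  have "r dvd a'' - k"
    using a''(4) k k0 by (metis dvd_rules)
  then have z3: "R dvd z - k \<or> R dvd z - k0"
    using served_r[OF z(1) a''(1) b z(2) g a''(2,3)] a''(4) by (metis dvd_rules)
  have ne: "\<not> R dvd k - k0"
  proof
    assume "R dvd k - k0"
    then have "R dvd a'' - k" using a''(4) by (metis dvd_rules)
    moreover have "q dvd a'' - x0" using a''(3) j0 by (metis dvd_rules)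
    ultimately show False using k a''(1,2) by blast
  qed
  have "r dvd k - k0" using k k0 by (metis dvd_rules)
  with ne have tk: "tyr (k - k0) = Near" by (simp add: dtype_N_iff)
  have T1: "typ (b' - b) = (if P dvd z - a0 then Equal else Near)"
  proof (cases "P dvd z - a0")
    case True then show ?thesis using t(1) by (metis dtype_E_iff dvd_sym)
  next
    case False
    then have "P dvd z - a1" using z1 by simp
    then have "typ (a0 - z) = typ (a0 - a1)" by (rule dtype_shift')
    then show ?thesis using t(1) typ_a01 False by simp
  qed
  have T3: "tyr (b' - b) = (if r * r dvd z - k then Equal else Near)"
  proof (cases "R dvd z - k")
    case True then show ?thesis using t(3) by (metis dtype_E_iff dvd_sym)
  next
    case False
    then have "R dvd z - k0" using z3 by simp
    then have "tyr (k - z) = tyr (k - k0)" by (rule dtype_shift')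
    then show ?thesis using t(3) tk False by simp
  qed
  have qz: "q dvd j0 - z \<longleftrightarrow> q dvd z - x0"
    using j0 by (metis dvd_rules)
  have final: "R dvd z - k0 \<and> has_type (b' - b) Equal Near Near \<or>
     far a0 k z \<and> has_type (b' - b) Equal Far Equal \<or> far a0 k0 z \<and> has_type (b' - b) Equal Far Near \<or>
     far a1 k z \<and> has_type (b' - b) Near Far Equal \<or> far a1 k0 z \<and> has_type (b' - b) Near Far Near"
  proof (cases "q dvd z - x0")
    case False
    then have "tyq (b' - b) = Far" using qz t(2) by (metis dtype_F_iff)
    then show ?thesis using T1 T3 z1 z3 z(1) False unfolding far_def has_type_def by auto
  next
    case True
    then have q': "tyq (b' - b) \<noteq> Far" using qz t(2) by (metis dtype_F_iff)
    then have q'': "q dvd b' - b" by (simp add: dtype_F_iff)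
    have r'': "r dvd b' - b" using T3 by (metis dtype_F_iff dist_type.distinct(4) dist_type.distinct(6))
    have "typ (b' - b) \<noteq> Near" using avoids_NEE[OF z(2) b _ q'' r''] by blast
    then have P: "P dvd z - a0" and tE: "typ (b' - b) = Equal" using T1 by (auto split: if_splits)
    then have nk: "\<not> R dvd z - k" using k z(1) True by blast
    then have tN: "tyr (b' - b) = Near" using T3 by simp
    have "tyq (b' - b) = Near"
      using avoidsD[OF avoids_EEN z(2) b tE _ tN] q' by (cases "tyq (b' - b)") auto
    then show ?thesis using tE tN nk z3 unfolding has_type_def by blast
  qed
  show ?thesis by (rule that[OF z d1 d2 d3 final])
qed

end

section \<open>Counting by fibres of a map, and cancelling units\<close>

lemma card_eq_sum_fibres:
  assumes "finite S"
  shows "card S = (\<Sum>y\<in>f ` S. card {c \<in> S. f c = y})"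
  using sum.image_gen[OF assms, of "\<lambda>_. 1::nat" f] by simp

lemma dvd_card_fibres:
  assumes "finite S" "\<And>c. c \<in> S \<Longrightarrow> n dvd card {c' \<in> S. f c' = f c}"
  shows "n dvd card S"
  unfolding card_eq_sum_fibres[OF assms(1), of f] using assms(2) by (auto intro!: dvd_sum)

text \<open>Modulo \<open>q\<close>, the size of \<open>S\<close> is \<open>r\<close> times the
  number of fibres of size \<open>r\<close>. So \<open>q\<close> divides this number, which is
  positive but at most \<open>r < q\<close>.\<close>

lemma two_fibre_sizes:
  fixes q r :: nat
  assumes fin: "finite S" and sizes: "\<And>c. c \<in> S \<Longrightarrow> card {c' \<in> S. g c' = g c} \<in> {q, r}"
    and "q dvd card S" "card (g ` S) \<le> r" "r < q" "prime q"
    and b: "b \<in> S" "card {c' \<in> S. g c' = g b} = r"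
  shows False
proof -
  let ?n = "\<lambda>y. card {c \<in> S. g c = y}"
  define Y where "Y = {y \<in> g ` S. ?n y = r}"
  have split: "g ` S = Y \<union> (g ` S - Y)" unfolding Y_def by blast
  have "card S = (\<Sum>y\<in>g ` S. ?n y)" by (rule card_eq_sum_fibres[OF fin])
  also have "\<dots> = (\<Sum>y\<in>g ` S - Y. ?n y) + (\<Sum>y\<in>Y. ?n y)"
    by (rule sum.subset_diff) (use fin Y_def in auto)
  also have "(\<Sum>y\<in>Y. ?n y) = r * card Y" unfolding Y_def by simp
  finally have eq: "card S = (\<Sum>y\<in>g ` S - Y. ?n y) + r * card Y" .
  have "q dvd (\<Sum>y\<in>g ` S - Y. ?n y)"
    using sizes unfolding Y_def by (intro dvd_sum) fastforce
  then have "q dvd r * card Y" using assms(3) unfolding eq by (rule dvd_add_right_iff[THEN iffD1])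
  moreover have "finite {c' \<in> S. g c' = g b}" using fin by simp
  then have "0 < r" using b card_gt_0_iff by blast
  then have "\<not> q dvd r" using \<open>r < q\<close> by (simp add: nat_dvd_not_less)
  ultimately have "q dvd card Y" using \<open>prime q\<close> by (simp add: prime_dvd_mult_iff)
  moreover have "finite Y" "g b \<in> Y" using b fin unfolding Y_def by auto
  then have "0 < card Y" by (auto simp: card_gt_0_iff)
  moreover have "card Y \<le> card (g ` S)" unfolding Y_def using fin by (intro card_mono) auto
  ultimately show False using assms(4,5) by (auto dest: dvd_imp_le)
qed

text \<open>Identifies the element of \<open>B\<close> delivered by \<open>cover\<close>: modulo
  \<open>d\<close> it is the one for which the unit was chosen.\<close>

lemma unit_cancel:
  fixes d :: int
  assumes "coprime \<rho> d" "d dvd x - \<rho> * (u - b)" "d dvd x - \<rho> * (v - b)"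
  shows "d dvd u - v"
proof -
  have "d dvd (x - \<rho> * (v - b)) - (x - \<rho> * (u - b))" using assms(2,3) by (rule dvd_diff[rotated])
  then have "d dvd \<rho> * (u - v)" by (simp add: algebra_simps)
  then show ?thesis using assms(1) by (metis coprime_commute coprime_dvd_mult_right_iff)
qed

lemma dvd_replace: "(d::int) dvd x - z - e \<Longrightarrow> d dvd z - c \<Longrightarrow> d dvd x - c - e"
  using dvd_add[of d "x - z - e" "z - c"] by (simp add: algebra_simps)

section \<open>How a missing line is served, and the class sizes of \<open>B\<close> that this
  forces\<close>

context corner
begin

text \<open>The index names the prime whose residue is fixed along with the residue modulo
  \<open>p ^ m\<close>; for \<open>D\<close> both are fixed.\<close>

abbreviation "class_r b \<equiv> {b' \<in> B. p ^ m dvd b' - b \<and> r dvd b' - b}"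
abbreviation "class_q b \<equiv> {b' \<in> B. p ^ m dvd b' - b \<and> q dvd b' - b}"
abbreviation "class_D b \<equiv> {b' \<in> B. p ^ m dvd b' - b \<and> q dvd b' - b \<and> r dvd b' - b}"

text \<open>The quantification over all units is the point: one description \<open>X\<close> of the
  far position holds for every dilation, so that the units can be varied afterwards. The partner
  outcome stays as an alternative as long as partners are not excluded.\<close>

definition serves :: "int \<Rightarrow> (int \<Rightarrow> int \<Rightarrow> bool) \<Rightarrow> bool" where
  "serves k X \<longleftrightarrow> (\<forall>b\<in>B. \<forall>\<rho>1 \<rho>2 \<rho>3. coprime \<rho>1 p \<longrightarrow> coprime \<rho>2 q \<longrightarrow> coprime \<rho>3 r \<longrightarrow>
     (\<exists>z\<in>A. \<exists>b'\<in>B. P dvd a0 - z - \<rho>1 * (b' - b) \<and> Q dvd j0 - z - \<rho>2 * (b' - b) \<and>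
        R dvd k - z - \<rho>3 * (b' - b) \<and>
        (R dvd z - k0 \<and> has_type (b' - b) Equal Near Near \<or> X z (b' - b))))"

lemma servesE:
  assumes "serves k X" "b \<in> B" "coprime \<rho>1 p" "coprime \<rho>2 q" "coprime \<rho>3 r"
  obtains z b' where "z \<in> A" "b' \<in> B" "P dvd a0 - z - \<rho>1 * (b' - b)"
    "Q dvd j0 - z - \<rho>2 * (b' - b)" "R dvd k - z - \<rho>3 * (b' - b)"
    "R dvd z - k0 \<and> has_type (b' - b) Equal Near Near \<or> X z (b' - b)"
  using assms unfolding serves_def by meson

lemma coprime_sq: "coprime \<rho> (k::int) \<Longrightarrow> coprime \<rho> (k * k)" "coprime \<rho> p \<Longrightarrow> coprime \<rho> P"
  by simp_all

lemma hole_N: assumes "hole k" shows "tyr (k - k0) = Near"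
proof -
  obtain a'' where a'': "a'' \<in> A" "P dvd a'' - a0" "Q dvd a'' - j0" "R dvd a'' - k0"
    using line_q j0 by blast
  have "\<not> R dvd k - k0"
  proof
    assume "R dvd k - k0"
    then have "R dvd a'' - k" using a''(4) by (metis dvd_rules)
    moreover have "q dvd a'' - x0" using a''(3) j0 by (metis dvd_rules)
    ultimately show False using assms a''(1,2) by blast
  qed
  moreover have "r dvd k - k0" using assms k0 by (metis dvd_rules)
  ultimately show ?thesis by (simp add: dtype_N_iff)
qed

lemma far_avoids:
  assumes z: "far c1 c3 z" and a': "a' \<in> A" "P dvd a' - d1" "Q dvd a' - j0" "R dvd a' - d3"
    and t: "typ (c1 - d1) = t1" "t1 \<noteq> Far" "tyr (c3 - d3) = t3"
  shows "avoids t1 Far t3"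
proof (rule avoidsI)
  show "z \<in> A" "a' \<in> A" using z a' unfolding far_def by auto
  show "typ (z - a') = t1" using z a' t unfolding far_def by (metis dtype_at)
  show "tyr (z - a') = t3" using z a' t unfolding far_def by (metis dtype_at)
  have "\<not> q dvd z - a'" using z a'(3) j0 unfolding far_def by (metis dvd_rules)
  then show "tyq (z - a') = Far" by (simp add: dtype_F_iff)
qed (use t in auto)

lemma typ_0 [simp]: "typ 0 = Equal" "tyq 0 = Equal" "tyr 0 = Equal"
  by (simp_all add: dtype_def)

text \<open>The far point is compared with three points of the corner lines, at \<open>a1\<close>,
  \<open>k\<close>, at \<open>a1\<close>, \<open>k0\<close> and at \<open>a0\<close>,
  \<open>k0\<close>. The fourth vertex of this rectangle is the missing point, so the only far type
  left over is that of the far point relative to the missing point.\<close>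

lemma far_avoids_all:
  assumes k: "hole k" and z: "far c1 c3 z" and c: "c1 \<in> {a0, a1}" "c3 \<in> {k, k0}"
  shows "avoids (typ (c1 - a1)) Far (tyr (c3 - k))" "avoids (typ (c1 - a1)) Far (tyr (c3 - k0))"
    "avoids (typ (c1 - a0)) Far (tyr (c3 - k0))"
proof -
  have t: "typ (c1 - a1) \<noteq> Far" "typ (c1 - a0) \<noteq> Far" using c typ_a01 by auto
  have "\<exists>a'\<in>A. P dvd a' - a1 \<and> Q dvd a' - j0 \<and> R dvd a' - k"
    "\<exists>a'\<in>A. P dvd a' - a1 \<and> Q dvd a' - j0 \<and> R dvd a' - k0"
    "\<exists>a'\<in>A. P dvd a' - a0 \<and> Q dvd a' - j0 \<and> R dvd a' - k0"
    using line_r line_q k j0 k0 by blast+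
  then show "avoids (typ (c1 - a1)) Far (tyr (c3 - k))" "avoids (typ (c1 - a1)) Far (tyr (c3 - k0))"
    "avoids (typ (c1 - a0)) Far (tyr (c3 - k0))"
    using far_avoids[OF z] t by blast+
qed

text \<open>A point of \<open>A\<close> in one of the four far positions excludes three of the four far types from
  \<open>B - B\<close>, so that only one far position can be active.\<close>

lemma kinds:
  assumes k: "hole k"
  obtains (none) "serves k (\<lambda>z d. False)"
  | (first) "serves k (\<lambda>z d. far a0 k z \<and> has_type d Equal Far Equal)" "avoids Equal Far Near" "avoids Near Far Equal" "avoids Near Far Near"
  | (second) "serves k (\<lambda>z d. far a0 k0 z \<and> has_type d Equal Far Near)" "avoids Equal Far Equal" "avoids Near Far Equal" "avoids Near Far Near"
  | (third) "serves k (\<lambda>z d. far a1 k z \<and> has_type d Near Far Equal)" "avoids Equal Far Equal" "avoids Equal Far Near" "avoids Near Far Near"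
  | (fourth) "serves k (\<lambda>z d. far a1 k0 z \<and> has_type d Near Far Near)" "avoids Equal Far Equal" "avoids Equal Far Near" "avoids Near Far Equal"
proof -
  have Near: "tyr (k - k0) = Near" "tyr (k0 - k) = Near"
    using hole_N[OF k] by (auto simp: dtype_diff_commute[of r r k0 k])
  have out: "serves k (\<lambda>z d. far a0 k z \<and> has_type d Equal Far Equal \<or> far a0 k0 z \<and> has_type d Equal Far Near \<or>
     far a1 k z \<and> has_type d Near Far Equal \<or> far a1 k0 z \<and> has_type d Near Far Near)"
    unfolding serves_def by (intro ballI allI impI, rule outcome[OF k]) (assumption+, blast)
  have restrict: "serves k Y" if "serves k X" "\<And>z b b'. b \<in> B \<Longrightarrow> b' \<in> B \<Longrightarrow> X z (b' - b) \<Longrightarrow> Y z (b' - b)" for X Y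
    using that unfolding serves_def by meson
  have av: "\<not> has_type (b' - b) t1 t2 t3" if "avoids t1 t2 t3" "b \<in> B" "b' \<in> B" for b b' t1 t2 t3
    using that unfolding has_type_def avoids_def by blast
  consider "\<exists>z. far a0 k z" | "\<exists>z. far a0 k0 z" | "\<exists>z. far a1 k z" | "\<exists>z. far a1 k0 z" |
    "\<nexists>z. far a0 k z" "\<nexists>z. far a0 k0 z" "\<nexists>z. far a1 k z" "\<nexists>z. far a1 k0 z" by blast
  then show thesis
  proof cases
    case 1
    then have a: "avoids Equal Far Near" "avoids Near Far Equal" "avoids Near Far Near"
      using far_avoids_all[OF k, of a0 k] Near typ_a01 by auto
    show thesis by (rule first[OF restrict[OF out] a]) (use av[OF a(1)] av[OF a(2)] av[OF a(3)] in blast)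
  next
    case 2
    then have a: "avoids Equal Far Equal" "avoids Near Far Equal" "avoids Near Far Near"
      using far_avoids_all[OF k, of a0 k0] Near typ_a01 by auto
    show thesis by (rule second[OF restrict[OF out] a]) (use av[OF a(1)] av[OF a(2)] av[OF a(3)] in blast)
  next
    case 3
    then have a: "avoids Equal Far Equal" "avoids Equal Far Near" "avoids Near Far Near"
      using far_avoids_all[OF k, of a1 k] Near typ_a01 by auto
    show thesis by (rule third[OF restrict[OF out] a]) (use av[OF a(1)] av[OF a(2)] av[OF a(3)] in blast)
  next
    case 4
    then have a: "avoids Equal Far Equal" "avoids Equal Far Near" "avoids Near Far Equal"
      using far_avoids_all[OF k, of a1 k0] Near typ_a01 by auto
    show thesis by (rule fourth[OF restrict[OF out] a]) (use av[OF a(1)] av[OF a(2)] av[OF a(3)] in blast)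
  next
    case 5
    show thesis by (rule none[OF restrict[OF out]]) (use 5 in blast)
  qed
qed

text \<open>If \<open>z\<close> always has third coordinate \<open>k0\<close>, the dilated
  difference is \<open>k - k0\<close> modulo \<open>R\<close>; the unit carrying
  \<open>w - b\<close> to \<open>k - k0\<close> then makes \<open>b'\<close> hit
  \<open>w\<close>.\<close>

lemma serves_offset:
  assumes k: "hole k" and b: "b \<in> B" and w: "r dvd w - b"
    and s: "\<And>\<rho>. coprime \<rho> r \<Longrightarrow> \<exists>b'\<in>S. R dvd k - k0 - \<rho> * (b' - b)" and "b \<in> S"
  shows "\<exists>b'\<in>S. R dvd b' - w"
proof (cases "R dvd w - b")
  case True
  then show ?thesis using \<open>b \<in> S\<close> by (metis dvd_sym)
next
  case False
  then have "tyr (w - b) = Near" using w by (simp add: dtype_N_iff)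
  then obtain \<rho> where \<rho>: "coprime \<rho> r" "R dvd (k - k0) - \<rho> * (w - b)"
    using unit_dtype[OF prime_r, of "k - k0" "w - b"] hole_N[OF k] by auto
  obtain b' where "b' \<in> S" "R dvd k - k0 - \<rho> * (b' - b)" using s[OF \<rho>(1)] by blast
  then show ?thesis using unit_cancel[OF coprime_sq(1)[OF \<rho>(1)] _ \<rho>(2)] by blast
qed

text \<open>Partners differ modulo \<open>R\<close>, so the class embeds into the \<open>r\<close>
  residues modulo \<open>R\<close> lying over that of \<open>b\<close> modulo \<open>r\<close>;
  \<open>serves_offset\<close> shows that it fills them.\<close>

lemma card_class_D:
  assumes k: "hole k" and b: "b \<in> B"
    and s: "\<And>\<rho>. coprime \<rho> r \<Longrightarrow> \<exists>b'\<in>class_D b. R dvd k - k0 - \<rho> * (b' - b)"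
  shows "card (class_D b) = nat r"
proof (rule card_eq_residues[where m = r and b = b])
  show "s = s'" if "s \<in> class_D b" "s' \<in> class_D b" "R dvd s - s'" for s s'
  proof -
    have "p ^ m dvd s - s'" "q dvd s - s'" "r dvd s - s'" using that by (blast intro: dvd_rules)+
    then have "s = s' \<or> partner s s'" using near_cases that by blast
    then show ?thesis using that(3) dtype_E_iff[of r r "s - s'"] by auto
  qed
  show "\<exists>s\<in>class_D b. R dvd s - w" if "r dvd w - b" for w
    by (rule serves_offset[OF k b that s]) (use b in auto)
qed (use pos fin_B in auto)

text \<open>Partners differ modulo \<open>Q\<close> as well.\<close>

lemma card_class_D_le: "card (class_D b) \<le> nat q"
proof (rule card_le_residues[where m = q and b = b])
  show "s = s'" if "s \<in> class_D b" "s' \<in> class_D b" "Q dvd s - s'" for s s'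
  proof -
    have "p ^ m dvd s - s'" "q dvd s - s'" "r dvd s - s'" using that by (blast intro: dvd_rules)+
    then have "s = s' \<or> partner s s'" using near_cases that by blast
    then show ?thesis using that(3) dtype_E_iff[of q q "s - s'"] by auto
  qed
qed (use pos in auto)

text \<open>Both outcomes put \<open>z\<close> at third coordinate \<open>k0\<close>, so
  \<open>serves_offset\<close> reaches all \<open>r\<close> residues modulo \<open>R\<close>.
  Elements of the class that agree modulo \<open>R\<close> also agree modulo \<open>q\<close>, by
  the avoided types, and partners never agree modulo \<open>R\<close>.\<close>

lemma second_fourth:
  assumes k: "hole k" and s: "serves k (\<lambda>z d. far c1 k0 z \<and> has_type d t1 Far Near)" "t1 \<noteq> Far"
    and a: "avoids Equal Far Equal" "avoids Near Far Equal" and b: "b \<in> B"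
  shows "card (class_r b) = nat r"
proof (rule card_eq_residues[where m = r and b = b])
  show "s = s'" if s: "s \<in> class_r b" "s' \<in> class_r b" "R dvd s - s'" for s s'
  proof -
    have d: "p ^ m dvd s - s'" "r dvd s - s'" using that by (blast intro: dvd_rules)+
    have Equal: "tyr (s - s') = Equal" using s(3) by (simp add: dtype_E_iff)
    have "typ (s - s') \<noteq> Far" using d(1) by (simp add: dtype_F_iff)
    then have "tyq (s - s') \<noteq> Far" using a s(1,2) Equal unfolding avoids_def by (cases "typ (s - s')") auto
    then have "q dvd s - s'" by (simp add: dtype_F_iff)
    then have "s = s' \<or> partner s s'" using near_cases d that by blast
    then show ?thesis using Equal by auto
  qed
  show "\<exists>s\<in>class_r b. R dvd s - w" if "r dvd w - b" for w
  proof (rule serves_offset[OF k b that])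
    fix \<rho> assume \<rho>: "coprime \<rho> r"
    obtain z b' where z: "b' \<in> B" "R dvd k - z - \<rho> * (b' - b)"
      "R dvd z - k0 \<and> has_type (b' - b) Equal Near Near \<or> far c1 k0 z \<and> has_type (b' - b) t1 Far Near"
      by (rule servesE[OF s(1) b, of 1 1 \<rho>]) (use \<rho> in auto)
    have "R dvd z - k0" using z(3) unfolding far_def by blast
    then have "R dvd k - k0 - \<rho> * (b' - b)" using z(2) dvd_replace by blast
    moreover have "p ^ m dvd b' - b" "r dvd b' - b" using z(3) s(2) unfolding has_type_def
      by (metis dtype_F_iff dist_type.distinct)+
    ultimately show "\<exists>b'\<in>class_r b. R dvd k - k0 - \<rho> * (b' - b)" using z(1) by blast
  qed (use b in auto)
qed (use pos fin_B in auto)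

text \<open>An element \<open>s\<close> of the class that differs from \<open>b\<close> modulo
  \<open>q\<close> must agree with \<open>b\<close> modulo \<open>R\<close>, because of the avoided
  types. But then it is \<open>Near\<close> to the partner \<open>b''\<close> in the third
  coordinate, and its difference to \<open>b''\<close> has an avoided type.\<close>

lemma partner_class:
  assumes a: "avoids Equal Far Near" "avoids Near Far Near" and b: "partner b b''" and s: "s \<in> class_r b"
  shows "q dvd s - b"
proof (rule ccontr)
  assume "\<not> q dvd s - b"
  then have Far: "tyq (s - b) = Far" by (simp add: dtype_F_iff)
  have t: "typ (s - b) \<noteq> Far" "tyr (s - b) \<noteq> Far" using s by (auto simp: dtype_F_iff)
  have 3: "tyr (s - b) = Equal" using a s b t Far unfolding avoids_def
    by (cases "typ (s - b)"; cases "tyr (s - b)") auto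
  have "typ (s - b'') = typ (s - b)" using b by (metis dtype_E_iff dtype_shift')
  moreover have "tyr (s - b'') = Near" using b 3 by (metis dtype_E_iff dtype_shift)
  moreover have "\<not> q dvd s - b''" using b \<open>\<not> q dvd s - b\<close> by (metis dtype_N_iff dvd_rules)
  then have "tyq (s - b'') = Far" by (simp add: dtype_F_iff)
  ultimately show False using a s b t unfolding avoids_def
    by (cases "typ (s - b)") auto
qed

text \<open>By \<open>partner_class\<close> the far outcome is impossible at a \<open>b\<close> with
  a partner, which leaves the partner outcome for every dilation.\<close>

lemma first_third_partner:
  assumes k: "hole k" and s: "serves k (\<lambda>z d. X z \<and> has_type d t1 Far Equal)" "t1 \<noteq> Far"
    and a: "avoids Equal Far Near" "avoids Near Far Near" and b: "partner b b''"
  shows "class_r b = class_D b" "card (class_D b) = nat r"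
proof -
  show "class_r b = class_D b" using partner_class[OF a b] by blast
  show "card (class_D b) = nat r"
  proof (rule card_class_D[OF k])
    show "b \<in> B" using b by blast
    fix \<rho> assume \<rho>: "coprime \<rho> r"
    obtain z b' where z: "b' \<in> B" "R dvd k - z - \<rho> * (b' - b)"
      "R dvd z - k0 \<and> has_type (b' - b) Equal Near Near \<or> X z \<and> has_type (b' - b) t1 Far Equal"
      by (rule servesE[OF s(1) \<open>b \<in> B\<close>, of 1 1 \<rho>]) (use \<rho> in auto)
    have "p ^ m dvd b' - b" "r dvd b' - b" using z(3) s(2) unfolding has_type_def
      by (metis dtype_F_iff dist_type.distinct)+
    moreover from this have "q dvd b' - b" using partner_class[OF a b] z(1) by blast
    then have "tyq (b' - b) \<noteq> Far" by (simp add: dtype_F_iff)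
    then have "R dvd z - k0" using z(3) unfolding has_type_def by blast
    then have "R dvd k - k0 - \<rho> * (b' - b)" using z(2) dvd_replace by blast
    ultimately show "\<exists>b'\<in>class_D b. R dvd k - k0 - \<rho> * (b' - b)" using z(1) \<open>q dvd b' - b\<close> by blast
  qed
qed

lemma none_card:
  assumes k: "hole k" and s: "serves k (\<lambda>z d. False)" and b: "b \<in> B"
  shows "card (class_D b) = nat r"
proof (rule card_class_D[OF k b])
  fix \<rho> assume \<rho>: "coprime \<rho> r"
  obtain z b' where z: "b' \<in> B" "R dvd k - z - \<rho> * (b' - b)"
    "R dvd z - k0 \<and> has_type (b' - b) Equal Near Near \<or> False"
    by (rule servesE[OF s b, of 1 1 \<rho>]) (use \<rho> in auto)
  then have "p ^ m dvd b' - b" "q dvd b' - b" "r dvd b' - b" unfolding has_type_def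
    by (metis dtype_F_iff dist_type.distinct)+
  moreover have "R dvd k - k0 - \<rho> * (b' - b)" using z dvd_replace by blast
  ultimately show "\<exists>b'\<in>class_D b. R dvd k - k0 - \<rho> * (b' - b)" using z(1) by blast
qed

lemma dtype_E_at: "j * k dvd z - c \<Longrightarrow> j * k dvd z' - c \<Longrightarrow> dtype j k (z - z') = Equal"
  unfolding dtype_E_iff by (metis dvd_sym dvd_tr)

lemma dtype_E_diff: "dtype j k (s - b) = Equal \<Longrightarrow> dtype j k (s' - b) = Equal \<Longrightarrow> dtype j k (s - s') = Equal"
  by (simp add: dtype_E_at dtype_E_iff)

lemma tyq_q: "tyq q = Near"
proof -
  have "\<not> Q dvd q" using prime_q
    by (metis dvd_mult_cancel1 mult.right_neutral not_prime_0 not_prime_unit dvd_times_left_cancel_iff)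
  then show ?thesis by (simp add: dtype_N_iff)
qed

lemma no_partner_type:
  assumes b: "b \<in> B" "\<nexists>b''. partner b b''" and s: "s \<in> class_r b" "s \<noteq> b"
  shows "tyq (s - b) = Far" "typ (s - b) \<noteq> Far" "tyr (s - b) \<noteq> Far"
proof -
  show t: "typ (s - b) \<noteq> Far" "tyr (s - b) \<noteq> Far" using s by (auto simp: dtype_F_iff)
  have "\<not> q dvd s - b"
  proof
    assume "q dvd s - b"
    then have "b = s \<or> partner b s" using s b by (intro near_cases) (auto intro: dvd_sym)
    then show False using s b by blast
  qed
  then show "tyq (s - b) = Far" by (simp add: dtype_F_iff)
qed

text \<open>Without a partner of \<open>b\<close>, all other elements of the class are
  \<open>Far\<close> from \<open>b\<close> in the second coordinate, and the avoided types make them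
  agree with \<open>b\<close> modulo \<open>R\<close>. So no two elements of the class are partners,
  and \<open>near_cases\<close> applies.\<close>

lemma no_partner_class:
  assumes b: "b \<in> B" "\<nexists>b''. partner b b''" and a: "avoids Equal Far Near" "avoids Near Far Near"
    and s: "s \<in> class_r b" "s' \<in> class_r b" "q dvd s - s'"
  shows "s = s'"
proof -
  have Equal: "tyr (s - b) = Equal" if "s \<in> class_r b" for s
  proof (cases "s = b")
    case False
    then have t: "tyq (s - b) = Far" "typ (s - b) = Equal \<or> typ (s - b) = Near" "tyr (s - b) = Equal \<or> tyr (s - b) = Near"
      using no_partner_type[OF b that False] dist_type.exhaust by metis+
    have "s \<in> B" using that by blast
    then show ?thesis using avoidsD[OF a(1) _ b(1) _ t(1)] avoidsD[OF a(2) _ b(1) _ t(1)] t(2,3) by blast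
  qed simp
  have "tyr (s - s') = Equal" using Equal[OF s(1)] Equal[OF s(2)] by (rule dtype_E_diff)
  moreover have "p ^ m dvd s - s'" "r dvd s - s'" using s by (metis (mono_tags, lifting) mem_Collect_eq dvd_sym dvd_tr)+
  then have "s = s' \<or> partner s s'" using near_cases s by blast
  ultimately show ?thesis by auto
qed

text \<open>Two far points in this position that differ modulo \<open>q\<close> would have the type
  \<open>Equal\<close>, \<open>Far\<close>, \<open>Equal\<close>, which occurs in
  \<open>B - B\<close>. So \<open>z\<close> is the same modulo \<open>q\<close> for all dilations,
  and a suitable unit makes \<open>b'\<close> hit \<open>w\<close> modulo \<open>q\<close>.\<close>

lemma first_row:
  assumes s: "serves k (\<lambda>z d. far a0 k z \<and> has_type d Equal Far Equal)"
    and b: "b \<in> B" "\<nexists>b''. partner b b''"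
  shows "\<exists>b'\<in>B. P dvd b' - b \<and> R dvd b' - b \<and> q dvd b' - w"
proof (cases "q dvd w - b")
  case True
  then show ?thesis using b by (intro bexI[of _ b]) (auto intro: dvd_sym)
next
  case False
  have type: "far a0 k z \<and> has_type (b' - b) Equal Far Equal"
    if "b' \<in> B" "R dvd z - k0 \<and> has_type (b' - b) Equal Near Near \<or> far a0 k z \<and> has_type (b' - b) Equal Far Equal" for z b'
  proof -
    have "\<not> has_type (b' - b) Equal Near Near"
    proof
      assume "has_type (b' - b) Equal Near Near"
      then have "partner b b'" using b that(1) unfolding has_type_def by (metis dtype_diff_commute)
      then show False using b by blast
    qed
    then show ?thesis using that(2) by blast
  qed
  obtain z b' where z: "z \<in> A" "b' \<in> B" "far a0 k z" "has_type (b' - b) Equal Far Equal"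
    by (rule servesE[OF s b(1), of 1 1 1]) (use type in auto)
  have "\<not> q dvd j0 - z" using z(3) j0 unfolding far_def by (metis dvd_rules)
  then obtain \<rho> where \<rho>: "coprime \<rho> q" "q dvd (j0 - z) - \<rho> * (w - b)"
    using unit_mod[OF prime_q _ False] by blast
  obtain z' c where c: "z' \<in> A" "c \<in> B" "Q dvd j0 - z' - \<rho> * (c - b)" "far a0 k z'" "has_type (c - b) Equal Far Equal"
    by (rule servesE[OF s b(1), of 1 \<rho> 1]) (use type \<rho> in auto)
  have "q dvd z' - z"
  proof (rule ccontr)
    assume "\<not> q dvd z' - z"
    then have "tyq (z' - z) = Far" by (simp add: dtype_F_iff)
    moreover have "typ (z' - z) = Equal" "tyr (z' - z) = Equal"
      using c(4) z(3) unfolding far_def by (blast intro: dtype_E_at)+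
    ultimately have "avoids Equal Far Equal" using avoidsI[OF c(1) z(1)] by auto
    then show False using z(2,4) b(1) unfolding avoids_def has_type_def by blast
  qed
  moreover have "q dvd j0 - z' - \<rho> * (c - b)" using c(3) by (rule dvd_mult_left)
  ultimately have "q dvd j0 - z - \<rho> * (c - b)" using dvd_replace by blast
  then have "q dvd c - w" using unit_cancel[OF \<rho>(1) _ \<rho>(2)] by blast
  then show ?thesis using c(2,5) unfolding has_type_def by (metis dtype_E_iff)
qed

lemma first_single:
  assumes s: "serves k (\<lambda>z d. far a0 k z \<and> has_type d Equal Far Equal)"
    and a: "avoids Equal Far Near" "avoids Near Far Near" and b: "b \<in> B" "\<nexists>b''. partner b b''"
  shows "card (class_r b) = nat q"
proof (rule card_eq_residues[where m = 1 and b = b])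
  show "s = s'" if "s \<in> class_r b" "s' \<in> class_r b" "1 * q dvd s - s'" for s s'
    using no_partner_class[OF b a that(1,2)] that(3) by simp
  show "\<exists>s\<in>class_r b. 1 * q dvd s - w" for w
    using first_row[OF s b, of w] by (auto intro: dvd_mult_left)
qed (use pos fin_B in auto)

text \<open>Now the passage from plane \<open>a0\<close> to plane \<open>a1\<close> is matched by
  the first coordinate: the unit carrying \<open>w - b\<close> to \<open>a0 - a1\<close> yields an
  element of the class over each of the \<open>p\<close> residues modulo \<open>P\<close>.\<close>

lemma third_single:
  assumes k: "hole k" and s: "serves k (\<lambda>z d. far a1 k z \<and> has_type d Near Far Equal)"
    and a: "avoids Equal Far Equal" "avoids Equal Far Near" "avoids Near Far Near" and b: "b \<in> B" "\<nexists>b''. partner b b''"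
  shows "card (class_r b) = nat p"
proof (rule card_eq_residues[where m = "p ^ m" and b = b])
  show "s = s'" if s: "s \<in> class_r b" "s' \<in> class_r b" "P dvd s - s'" for s s'
  proof -
    have "tyr (s - s') \<noteq> Far" using s by (metis (mono_tags, lifting) mem_Collect_eq dtype_F_iff dvd_rules)
    moreover have "typ (s - s') = Equal" using s(3) by (simp add: dtype_E_iff)
    ultimately have "tyq (s - s') \<noteq> Far" using a s(1,2) unfolding avoids_def by (cases "tyr (s - s')") auto
    then have "q dvd s - s'" by (simp add: dtype_F_iff)
    then show ?thesis using no_partner_class[OF b a(2,3) s(1,2)] by blast
  qed
  show "\<exists>s\<in>class_r b. P dvd s - w" if w: "p ^ m dvd w - b" for w
  proof (cases "P dvd w - b")
    case True
    then show ?thesis using b by (intro bexI[of _ b]) (auto intro: dvd_sym)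
  next
    case False
    then have "typ (w - b) = Near" using w by (simp add: dtype_N_iff)
    then obtain \<rho> where \<rho>: "coprime \<rho> p" "P dvd (a0 - a1) - \<rho> * (w - b)"
      using unit_typ[of "a0 - a1" "w - b"] typ_a01 by auto
    obtain z b' where z: "b' \<in> B" "P dvd a0 - z - \<rho> * (b' - b)"
      "R dvd z - k0 \<and> has_type (b' - b) Equal Near Near \<or> far a1 k z \<and> has_type (b' - b) Near Far Equal"
      by (rule servesE[OF s b(1), of \<rho> 1 1]) (use \<rho> in auto)
    have "\<not> has_type (b' - b) Equal Near Near"
    proof
      assume "has_type (b' - b) Equal Near Near"
      then have "partner b b'" using b z(1) unfolding has_type_def by (metis dtype_diff_commute)
      then show False using b by blast
    qed
    then have f: "far a1 k z" and t: "has_type (b' - b) Near Far Equal" using z(3) by auto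
    have "P dvd a0 - a1 - \<rho> * (b' - b)" using z(2) f dvd_replace unfolding far_def by blast
    then have "P dvd b' - w" using unit_cancel[OF coprime_sq(2)[OF \<rho>(1)] _ \<rho>(2)] by blast
    moreover have "p ^ m dvd b' - b" "r dvd b' - b" using t unfolding has_type_def
      by (metis dtype_F_iff dist_type.distinct)+
    ultimately show ?thesis using z(1) by blast
  qed
qed (use pos fin_B in auto)

section \<open>Excluding partners by comparing class sizes\<close>

lemma nat_primes: "prime (nat p)" "prime (nat q)" "prime (nat r)" "nat p \<noteq> nat q" "nat p \<noteq> nat r" "nat q \<noteq> nat r"
  using prime_p prime_q prime_r distinct pos by (auto simp: prime_nat_iff_prime eq_nat_nat_iff)

lemma class_q_fibres: "c \<in> S \<Longrightarrow> S = {b' \<in> B. p ^ m dvd b' - b} \<Longrightarrow> {c' \<in> S. c' mod q = c mod q} = class_q c"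
proof -
  assume c: "c \<in> S" and S: "S = {b' \<in> B. p ^ m dvd b' - b}"
  then have "p ^ m dvd c - b" by blast
  then have "p ^ m dvd c' - b \<longleftrightarrow> p ^ m dvd c' - c" for c' by (metis dvd_sym dvd_tr)
  then show ?thesis unfolding S mod_eq_dvd_iff by blast
qed

lemma class_r_fibres: "c \<in> S \<Longrightarrow> S = {b' \<in> B. p ^ m dvd b' - b} \<Longrightarrow> {c' \<in> S. c' mod r = c mod r} = class_r c"
proof -
  assume c: "c \<in> S" and S: "S = {b' \<in> B. p ^ m dvd b' - b}"
  then have "p ^ m dvd c - b" by blast
  then have "p ^ m dvd c' - b \<longleftrightarrow> p ^ m dvd c' - c" for c' by (metis dvd_sym dvd_tr)
  then show ?thesis unfolding S mod_eq_dvd_iff by blast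
qed

lemma class_D_fibres: "c \<in> class_q b \<Longrightarrow> {c' \<in> class_q b. c' mod r = c mod r} = class_D c"
proof -
  assume c: "c \<in> class_q b"
  then have "p ^ m dvd c' - b \<longleftrightarrow> p ^ m dvd c' - c" "q dvd c' - b \<longleftrightarrow> q dvd c' - c" for c'
    by simp_all (metis dvd_sym dvd_tr)+
  then show ?thesis unfolding mod_eq_dvd_iff by blast
qed

text \<open>A \<open>class_q\<close> is a disjoint union of sets \<open>class_D\<close>, so
  \<open>r\<close> would divide \<open>q\<close>.\<close>

lemma class_D_not_r:
  assumes "\<And>b. b \<in> B \<Longrightarrow> card (class_q b) = nat q" "\<And>b. b \<in> B \<Longrightarrow> card (class_D b) = nat r"
  shows False
proof -
  obtain b where b: "b \<in> B" using B_nonempty by blast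
  have "nat r dvd card (class_q b)"
  proof (rule dvd_card_fibres[where f = "\<lambda>c. c mod r"])
    fix c assume c: "c \<in> class_q b"
    then show "nat r dvd card {c' \<in> class_q b. c' mod r = c mod r}"
      using class_D_fibres[OF c] assms(2)[of c] by auto
  qed (use fin_B in auto)
  then show False using assms(1)[OF b] primes_dvd_imp_eq[OF nat_primes(3,2)] nat_primes(6) by simp
qed

text \<open>An instance of \<open>two_fibre_sizes\<close>: the elements of \<open>B\<close> in one
  class modulo \<open>p ^ m\<close> are split modulo \<open>r\<close>, and splitting them modulo
  \<open>q\<close> shows that \<open>q\<close> divides their number.\<close>

lemma class_r_sizes:
  assumes q: "\<And>b. b \<in> B \<Longrightarrow> card (class_q b) = nat q" and rq: "r < q"
    and r: "\<And>b. b \<in> B \<Longrightarrow> card (class_r b) \<in> {nat q, nat r}" and b: "b \<in> B" "card (class_r b) = nat r"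
  shows False
proof -
  let ?S = "{b' \<in> B. p ^ m dvd b' - b}"
  show False
  proof (rule two_fibre_sizes[where S = ?S and q = "nat q" and r = "nat r" and g = "\<lambda>c. c mod r" and b = b])
    show "card {c' \<in> ?S. c' mod r = c mod r} \<in> {nat q, nat r}" if "c \<in> ?S" for c
      using class_r_fibres[OF that refl] r[of c] that by simp
    show "nat q dvd card ?S"
    proof (rule dvd_card_fibres[where f = "\<lambda>c. c mod q"])
      show "nat q dvd card {c' \<in> ?S. c' mod q = c mod q}" if "c \<in> ?S" for c
        using class_q_fibres[OF that refl] q[of c] that by simp
    qed (use fin_B in auto)
    have "(\<lambda>c. c mod r) ` ?S \<subseteq> {0..<r}" using pos by auto
    then have "card ((\<lambda>c. c mod r) ` ?S) \<le> card {0..<r}" by (rule card_mono[rotated]) simp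
    then show "card ((\<lambda>c. c mod r) ` ?S) \<le> nat r" by simp
    show "nat r < nat q" using rq pos by simp
    show "b \<in> ?S" using b by simp
    then show "card {c' \<in> ?S. c' mod r = b mod r} = nat r" using class_r_fibres[of b ?S b] b by simp
  qed (use fin_B nat_primes in auto)
qed

text \<open>If partners exist, then a residue class of \<open>B\<close> modulo \<open>p ^ m * q * r\<close> has at most
  \<open>min q r\<close> elements, so a class of \<open>r > q\<close> elements cannot occur.\<close>

lemma partners_larger:
  assumes part: "\<not> avoids Equal Near Near" and qr: "q < r"
  shows "\<forall>b\<in>B. card (class_r b) = nat r"
proof -
  obtain k where k: "hole k" using hole_r by blast
  obtain b b'' where b: "partner b b''" using part unfolding avoids_def by blast
  have no: "card (class_D b) \<noteq> nat r" using card_class_D_le[of b] qr pos by linarith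
  show ?thesis using k
  proof (cases rule: kinds)
    case none
    then show ?thesis using none_card[OF k] no b by blast
  next
    case first
    then show ?thesis using first_third_partner(2)[OF k first(1) _ first(2,4) b] no by simp
  next
    case second
    then show ?thesis using second_fourth[OF k second(1) _ second(2,3)] by auto
  next
    case third
    then show ?thesis using first_third_partner(2)[OF k third(1) _ third(3,4) b] no by simp
  next
    case fourth
    then show ?thesis using second_fourth[OF k fourth(1) _ fourth(2,4)] by auto
  qed
qed

text \<open>Two holes on the line through \<open>k0\<close> would both be served by far points of \<open>A\<close> in the
  plane \<open>a1\<close>, and two of these differ as the partners in \<open>B\<close> do.\<close>

lemma third_two_holes:
  assumes k: "hole k" and third: "serves k (\<lambda>z d. far a1 k z \<and> has_type d Near Far Equal)"
      "avoids Equal Far Equal" "avoids Equal Far Near" "avoids Near Far Near"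
    and b: "b \<in> B" "\<nexists>b''. partner b b''"
    and k': "hole k'" "\<not> R dvd k' - k"
  shows "avoids Equal Near Near"
proof -
  have notO: "\<not> has_type (b' - b) Equal Near Near" if "b' \<in> B" for b'
  proof
    assume "has_type (b' - b) Equal Near Near"
    then have "partner b b'" using b that unfolding has_type_def by (metis dtype_diff_commute)
    then show False using b by blast
  qed
  obtain z1 b1 where 1: "b1 \<in> B" "P dvd a0 - z1 - 1 * (b1 - b)" "far a1 k z1" "has_type (b1 - b) Near Far Equal"
    by (rule servesE[OF third(1) b(1), of 1 1 1]) (use notO in auto)
  have "\<not> q dvd j0 - z1" using 1(3) j0 unfolding far_def by (metis dvd_rules)
  \<comment> \<open>The summand \<open>q\<close> aims the second dilation at second coordinate
    \<open>z1 - q\<close>, which is \<open>Near\<close> to \<open>z1\<close>.\<close>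
  then have "\<not> q dvd j0 - z1 + q" by simp
  then have "tyq (j0 - z1 + q) = tyq (b1 - b)" using 1(4) dtype_F_iff[of q q] unfolding has_type_def by metis
  then obtain \<rho> where \<rho>: "coprime \<rho> q" "Q dvd (j0 - z1 + q) - \<rho> * (b1 - b)"
    using unit_dtype[OF prime_q] by blast
  \<comment> \<open>The full \<open>outcome\<close> is needed because \<open>serves\<close> is known
    for \<open>k\<close> only; the avoided types, which concern \<open>B\<close> alone, then rule
    out all positions but the third.\<close>
  obtain z2 b2 where 2: "b2 \<in> B" "P dvd a0 - z2 - 1 * (b2 - b)" "Q dvd j0 - z2 - \<rho> * (b2 - b)"
    and t: "far a0 k' z2 \<and> has_type (b2 - b) Equal Far Equal \<or> far a0 k0 z2 \<and> has_type (b2 - b) Equal Far Near \<or>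
     far a1 k' z2 \<and> has_type (b2 - b) Near Far Equal \<or> far a1 k0 z2 \<and> has_type (b2 - b) Near Far Near"
    by (rule outcome[OF k'(1) b(1), of 1 \<rho> 1]) (use \<rho> notO in auto)
  have 3: "far a1 k' z2" "has_type (b2 - b) Near Far Equal"
    using t third(2-4) 2(1) b(1) unfolding has_type_def avoids_def by blast+
  have e1: "P dvd a0 - a1 - 1 * (b1 - b)" using 1(2,3) dvd_replace unfolding far_def by blast
  have e2: "P dvd a0 - a1 - 1 * (b2 - b)" using 2(2) 3(1) dvd_replace unfolding far_def by blast
  have P: "P dvd b1 - b2" by (rule unit_cancel[OF _ e1 e2]) simp
  have R: "R dvd b1 - b2" using 1(4) 3(2) dtype_E_diff unfolding has_type_def dtype_E_iff[symmetric] by blast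
  have "tyq (b1 - b2) \<noteq> Far" using avoidsD[OF third(2) 1(1) 2(1)] P R by (auto simp: dtype_E_iff)
  then have "q dvd b1 - b2" by (simp add: dtype_F_iff)
  then have "b1 = b2 \<or> partner b1 b2" using P R 1(1) 2(1) by (intro near_cases) (auto intro: dvd_mult_left)
  then have eq: "b1 = b2" using R by (auto simp: dtype_E_iff[symmetric])
  have Q: "Q dvd z2 - (z1 - q)"
  proof -
    have "Q dvd (j0 - z1 + q - \<rho> * (b1 - b)) - (j0 - z2 - \<rho> * (b2 - b))"
      using \<rho>(2) 2(3) by (rule dvd_diff)
    then show ?thesis unfolding eq by (simp add: algebra_simps)
  qed
  have A: "z1 \<in> A" "z2 \<in> A" using 1 3 unfolding far_def by auto
  have "tyq (z2 - z1) = Near" using dtype_shift[OF Q, of z1] tyq_q by (simp add: dtype_minus)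
  moreover have "typ (z2 - z1) = Equal" using 1(3) 3(1) unfolding far_def by (blast intro: dtype_E_at)
  moreover have "r dvd k' - k" using k k' by (metis dvd_rules)
  then have "tyr (k' - k) = Near" using k' by (simp add: dtype_N_iff)
  then have "tyr (z2 - z1) = Near" using dtype_at[of r r z2 k' z1 k] 1(3) 3(1) unfolding far_def by simp
  ultimately show ?thesis using avoidsI[OF A(2,1)] by auto
qed

text \<open>For \<open>r > 2\<close> there is a third residue modulo \<open>R\<close> besides
  \<open>k0\<close> and \<open>k\<close> in the grid class. If it is a hole,
  \<open>third_two_holes\<close> applies; if not, a point of \<open>A\<close> there and a point of
  the line at \<open>k0\<close> differ by the type of partners. Either way partners would be
  avoided.\<close>

lemma third_r_eq_2:
  assumes part: "\<not> avoids Equal Near Near"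
    and k: "hole k" and third: "serves k (\<lambda>z d. far a1 k z \<and> has_type d Near Far Equal)"
      "avoids Equal Far Equal" "avoids Equal Far Near" "avoids Near Far Near"
    and b: "b \<in> B" "\<nexists>b''. partner b b''"
  shows "r = 2"
proof (rule ccontr)
  assume "r \<noteq> 2"
  then have r3: "r > 2" using prime_ge_2_int[OF prime_r] by simp
  have kN: "tyr (k - k0) = Near" by (rule hole_N[OF k])
  \<comment> \<open>Doubling the step keeps \<open>k'\<close> apart from \<open>k0\<close> modulo
    \<open>R\<close> because \<open>r\<close> is odd, and \<open>k' - k\<close> is again
    \<open>k - k0\<close>.\<close>
  define k' where "k' = k0 + 2 * (k - k0)"
  have rk: "r dvd k - k0" "\<not> R dvd k - k0" using kN by (auto simp: dtype_N_iff)
  have n2: "\<not> R dvd k' - k0"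
  proof
    assume "R dvd k' - k0"
    then have "R dvd 2 * (k - k0)" unfolding k'_def by simp
    moreover have "\<not> r dvd 2" using r3 by (auto dest: zdvd_imp_le)
    then have "coprime r 2" by (rule prime_imp_coprime[OF prime_r])
    then have "coprime R 2" unfolding coprime_mult_left_iff by blast
    ultimately show False using rk coprime_dvd_mult_right_iff[of "R" 2 "k - k0"] by blast
  qed
  have n1: "\<not> R dvd k' - k" using rk(2) unfolding k'_def by simp
  have "k' - k0 = 2 * (k - k0)" unfolding k'_def by simp
  then have rk': "r dvd k' - k0" using rk(1) by (simp only: dvd_mult)
  show False
  proof (cases "hole k'")
    case True
    then show False using third_two_holes[OF k third b True n1] part by blast
  next
    case False
    have "r dvd k' - x0" using rk' k0 by (metis dvd_rules)
    then obtain z where z: "z \<in> A" "P dvd z - a0" "q dvd z - x0" "R dvd z - k'" using False by blast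
    obtain z' where z': "z' \<in> A" "P dvd z' - a0" "Q dvd z' - (z + q)" "R dvd z' - k0"
      using line_q[of "z + q"] dvd_add[OF z(3) dvd_refl] by (auto simp: algebra_simps)
    have "tyq (z' - z) = Near" using dtype_shift[OF z'(3), of z] tyq_q by simp
    moreover have "typ (z' - z) = Equal" using z'(2) z(2) by (rule dtype_E_at)
    moreover have "tyr (k0 - k') = Near" using rk' n2 dtype_diff_commute[of r r k0 k'] by (simp add: dtype_N_iff)
    then have "tyr (z' - z) = Near" using dtype_at[OF z'(4) z(4)] by simp
    ultimately have "avoids Equal Near Near" using avoidsI[OF z'(1) z(1)] by auto
    then show False using part by blast
  qed
qed

text \<open>If every element has a partner, all sets \<open>class_D\<close> have size
  \<open>r\<close>. Otherwise \<open>r = 2\<close>, and \<open>class_q b\<close> splits into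
  \<open>class_D b\<close>, of size 2, and some \<open>class_D t\<close>. A partner of
  \<open>t\<close> would give \<open>q = 4\<close>. If \<open>t\<close> has none,
  \<open>class_r t\<close> has \<open>p\<close> elements and so contains some \<open>s\<close> other
  than \<open>t\<close>; since there are only two residues modulo \<open>r\<close>, every element of
  \<open>class_q s\<close> is forced to be \<open>s\<close>, giving \<open>q = 1\<close>.\<close>

lemma third_impossible:
  assumes part: "partner b b''" and qq: "\<And>b. b \<in> B \<Longrightarrow> card (class_q b) = nat q" and rq: "r < q"
    and k: "hole k" and third: "serves k (\<lambda>z d. far a1 k z \<and> has_type d Near Far Equal)"
      "avoids Equal Far Equal" "avoids Equal Far Near" "avoids Near Far Near"
  shows False
proof (cases "\<exists>c\<in>B. \<nexists>c''. partner c c''")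
  case False
  then show False using class_D_not_r[OF qq] first_third_partner(2)[OF k third(1) _ third(3,4)] by blast
next
  case True
  have "\<not> avoids Equal Near Near" using part unfolding avoids_def by blast
  then have r2: "r = 2" using third_r_eq_2 k third True by blast
  have rn: "nat r = 2" using r2 by simp
  have parity: "2 dvd u - w" if "\<not> 2 dvd u - v" "\<not> 2 dvd v - w" for u v w :: int
    using that by presburger
  have b: "b \<in> B" using part by blast
  have Sb: "class_r b = class_D b" "card (class_D b) = nat r"
    by (rule first_third_partner[OF k third(1) _ third(3,4) part]; simp)+
  have fin: "finite (class_r c)" "finite (class_q c)" for c using fin_B by auto
  have "\<not> class_q b \<subseteq> class_r b"
  proof
    assume "class_q b \<subseteq> class_r b"
    then have "card (class_q b) \<le> card (class_r b)" by (rule card_mono[OF fin(1)])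
    then have "nat q \<le> nat r" unfolding qq[OF b] Sb .
    then show False using rq pos by simp
  qed
  then obtain t where t: "t \<in> class_q b" "\<not> r dvd t - b" by blast
  then have tB: "t \<in> B" "p ^ m dvd t - b" "q dvd t - b" by auto
  have qbt: "class_q b = class_D b \<union> class_D t" (is "?L = ?R")
  proof (intro equalityI subsetI)
    fix u assume u: "u \<in> ?L"
    have "r dvd u - b \<or> r dvd u - t" using parity[of u t b] t(2) unfolding r2 by blast
    then show "u \<in> ?R" using u tB by simp (metis dvd_sym dvd_tr)
  next
    fix u assume "u \<in> ?R"
    then show "u \<in> ?L" using tB by simp (metis dvd_tr)
  qed
  have "class_D b \<inter> class_D t = {}" using t(2) by auto (metis dvd_sym dvd_tr)
  then have "card (class_q b) = card (class_D b) + card (class_D t)"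
    unfolding qbt using fin_B by (intro card_Un_disjoint) auto
  then have qsum: "nat q = 2 + card (class_D t)" using qq[OF b] Sb(2) rn by linarith
  show False
  proof (cases "\<exists>t''. partner t t''")
    case True
    then obtain t'' where "partner t t''" by blast
    then have "card (class_D t) = nat r"
      by (rule first_third_partner(2)[OF k third(1) _ third(3,4), rotated]) simp
    then have "nat q = 2 * 2" using qsum rn by linarith
    then show False using nat_primes(2) prime_product[of 2 "2::nat"] by simp
  next
    case False
    have "card (class_r t) = nat p" by (rule third_single[OF k third tB(1) False])
    then have "\<not> class_r t \<subseteq> {t}"
      using prime_ge_2_nat[OF nat_primes(1)] card_mono[of "{t}" "class_r t"] by fastforce
    then obtain s where s: "s \<in> class_r t" "s \<noteq> t" by blast
    have ts: "tyq (s - t) = Far" "typ (s - t) \<noteq> Far" "tyr (s - t) \<noteq> Far"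
      using no_partner_type[OF tB(1) False s] by auto
    have "u = s" if u: "u \<in> class_q s" for u
    proof (cases "r dvd u - t")
      case True
      then have "u \<in> class_r t" "q dvd u - s" using u s by simp_all (metis dvd_tr)+
      then show ?thesis using no_partner_class[OF tB(1) False third(3,4)] s by blast
    next
      case False
      have "r dvd u - b" using parity[of u t b] False t(2) unfolding r2 by blast
      moreover have "p ^ m dvd u - b" using u s tB by simp (metis dvd_tr)
      ultimately have "q dvd u - b" using Sb(1) u by blast
      then have "q dvd s - t" using u tB(3) by simp (metis dvd_sym dvd_tr)
      then show ?thesis using ts(1) by (simp add: dtype_F_iff)
    qed
    then have "class_q s = {s}" using s by auto
    then have "card (class_q s) = 1" by simp
    moreover have sB: "s \<in> B" using s by blast
    ultimately have "nat q = 1" using qq[OF sB] by linarith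
    then show False using nat_primes(2) by simp
  qed
qed

text \<open>With \<open>q\<close> and \<open>r\<close> exchanged, \<open>partners_larger\<close>
  gives every \<open>class_q\<close> size \<open>q\<close>. Each kind of service of a hole
  contradicts this.\<close>

lemma no_partners_if_less:
  assumes rq: "r < q"
  shows "avoids Equal Near Near"
proof (rule ccontr)
  assume part: "\<not> avoids Equal Near Near"
  interpret sw: corner p r q m A B x0 a1 a0 k0 j0 by (rule swapped_corner)
  have "\<not> sw.avoids Equal Near Near" using part unfolding avoids_def sw.avoids_def by blast
  then have qq: "card (class_q b) = nat q" if "b \<in> B" for b
    using sw.partners_larger[OF _ rq] that by simp
  obtain b b'' where b: "partner b b''" using part unfolding avoids_def by blast
  obtain k where k: "hole k" using hole_r by blast
  show False using k
  proof (cases rule: kinds)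
    case none
    then show False using class_D_not_r[OF qq] none_card[OF k] by blast
  next
    case first
    have "card (class_r c) \<in> {nat q, nat r}" if "c \<in> B" for c
      using first_single[OF first(1,2,4) that] first_third_partner[OF k first(1) _ first(2,4), of c] by (cases "\<exists>c''. partner c c''") auto
    moreover have "card (class_r b) = nat r"
      using first_third_partner[OF k first(1) _ first(2,4) b] by simp
    ultimately show False using class_r_sizes[OF qq rq] b by blast
  next
    case second
    then show False using second_fourth[OF k second(1) _ second(2,3)] class_r_sizes[OF qq rq] b by auto
  next
    case third
    then show False using third_impossible[OF b qq rq k] by blast
  next
    case fourth
    then show False using second_fourth[OF k fourth(1) _ fourth(2,4)] class_r_sizes[OF qq rq] b by auto
  qed
qed

lemma no_partners: "avoids Equal Near Near"
proof (cases "r < q")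
  case True
  then show ?thesis by (rule no_partners_if_less)
next
  case False
  interpret sw: corner p r q m A B x0 a1 a0 k0 j0 by (rule swapped_corner)
  have "sw.avoids Equal Near Near" using False distinct(3) by (intro sw.no_partners_if_less) simp
  then show ?thesis unfolding avoids_def sw.avoids_def by blast
qed

section \<open>Consequences for \<open>B\<close> and for the missing lines of the corner\<close>

lemma B_eq_mod_D:
  assumes "b \<in> B" "b' \<in> B" "p ^ m dvd b - b'" "q dvd b - b'" "r dvd b - b'"
  shows "b = b'"
  using near_cases[OF assms] no_partners unfolding avoids_def by blast

text \<open>\<open>B\<close> is injective modulo \<open>p ^ m * q * r\<close> and has exactly that
  many elements, so every residue occurs; the Chinese remainder theorem picks the required
  one.\<close>

lemma B_onto_class:
  assumes b: "b \<in> B"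
  shows "\<exists>s\<in>class_r b. q dvd s - w"
proof -
  define D where "D = p ^ m * q * r"
  have D: "D > 0" using pos by (simp add: D_def)
  have "inj_on (\<lambda>b. b mod D) B"
  proof (rule inj_onI)
    fix c c' assume c: "c \<in> B" "c' \<in> B" "c mod D = c' mod D"
    then have "D dvd c - c'" by (simp add: mod_eq_dvd_iff)
    then have "p ^ m dvd c - c'" "q dvd c - c'" "r dvd c - c'"
      unfolding D_def by (auto dest: dvd_mult_left dvd_mult_right)
    then show "c = c'" using B_eq_mod_D c by blast
  qed
  then have "card ((\<lambda>b. b mod D) ` B) = nat D" using card_image card_B D_def by metis
  moreover have "(\<lambda>b. b mod D) ` B \<subseteq> {0..<D}" using D by auto
  ultimately have onto: "(\<lambda>b. b mod D) ` B = {0..<D}" using D by (intro card_subset_eq) auto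
  have "coprime p q" "coprime r q" using prime_p prime_q prime_r distinct by (auto intro: primes_coprime)
  then have "coprime (p ^ m * r) q" by simp
  then obtain y where y: "[y = b] (mod p ^ m * r)" "[y = w] (mod q)"
    using binary_chinese_remainder_int by blast
  have "y mod D \<in> (\<lambda>b. b mod D) ` B" unfolding onto using D by simp
  then obtain s where s: "s \<in> B" "s mod D = y mod D" by auto
  then have "D dvd s - y" by (simp add: mod_eq_dvd_iff)
  then have "p ^ m dvd s - y" "q dvd s - y" "r dvd s - y"
    unfolding D_def by (auto dest: dvd_mult_left dvd_mult_right)
  moreover have "p ^ m dvd y - b" "r dvd y - b" "q dvd y - w"
    using y by (auto simp: cong_iff_dvd_diff dest: dvd_mult_left dvd_mult_right)
  ultimately have "p ^ m dvd s - b" "r dvd s - b" "q dvd s - w" by (metis dvd_tr)+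
  then show ?thesis using s by blast
qed

lemma card_class_r:
  assumes "b \<in> B" shows "card (class_r b) = nat q"
proof (rule card_eq_residues[where m = 1 and b = b])
  show "s = s'" if s: "s \<in> class_r b" "s' \<in> class_r b" "1 * q dvd s - s'" for s s'
  proof -
    have "p ^ m dvd s - b" "p ^ m dvd s' - b" "r dvd s - b" "r dvd s' - b" using s by auto
    then have "p ^ m dvd s - s'" "r dvd s - s'" by (metis dvd_sym dvd_tr)+
    then show ?thesis using B_eq_mod_D s by simp
  qed
  show "\<exists>s\<in>class_r b. 1 * q dvd s - w" for w using B_onto_class[OF assms] by simp
qed (use pos fin_B in auto)

lemma no_partner: "\<nexists>b''. partner b b''"
  using no_partners unfolding avoids_def by blast

text \<open>Now \<open>class_r b\<close> has \<open>q\<close> elements and \<open>class_D b\<close>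
  only one, whereas the other kinds demand \<open>r\<close> or \<open>p\<close> elements,
  respectively \<open>r\<close> elements, of these classes.\<close>

lemma serves_first:
  assumes k: "hole k"
  shows "serves k (\<lambda>z d. far a0 k z \<and> has_type d Equal Far Equal)"
proof -
  obtain b where b: "b \<in> B" using B_nonempty by blast
  have n: "card (class_D b) \<noteq> nat r"
  proof -
    have "class_D b \<subseteq> {b}" using B_eq_mod_D b by auto
    then have "card (class_D b) \<le> 1" using card_mono[of "{b}"] by fastforce
    then show ?thesis using prime_ge_2_nat[OF nat_primes(3)] by linarith
  qed
  show ?thesis using k
  proof (cases rule: kinds)
    case none
    then show ?thesis using none_card[OF k _ b] n by blast
  next
    case second
    have "card (class_r b) = nat r" by (rule second_fourth[OF k second(1) _ second(2,3) b]) simp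
    then show ?thesis using card_class_r[OF b] nat_primes(6) by linarith
  next
    case third
    have "card (class_r b) = nat p" by (rule third_single[OF k third b no_partner])
    then show ?thesis using card_class_r[OF b] nat_primes(4) by linarith
  next
    case fourth
    have "card (class_r b) = nat r" by (rule second_fourth[OF k fourth(1) _ fourth(2,4) b]) simp
    then show ?thesis using card_class_r[OF b] nat_primes(6) by linarith
  qed
qed

lemma B_row_q:
  assumes "b \<in> B"
  shows "\<exists>b'\<in>B. P dvd b' - b \<and> R dvd b' - b \<and> q dvd b' - w"
proof -
  obtain k where "hole k" using hole_r by blast
  then show ?thesis using first_row[OF serves_first assms no_partner] by blast
qed

text \<open>One far point \<open>z0\<close> fixes the class modulo \<open>q\<close>. For any
  \<open>v\<close> in that class, the unit carrying \<open>b0 - b\<close> to \<open>j0 - v\<close>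
  modulo \<open>Q\<close> leads to an element of \<open>B\<close> congruent to \<open>b0\<close>
  modulo \<open>q\<close>, \<open>P\<close> and \<open>R\<close>, hence to \<open>b0\<close> itself;
  this pins \<open>z\<close> to \<open>v\<close> modulo \<open>Q\<close>.\<close>

lemma shifted_fiber:
  assumes k: "hole k"
  shows "\<exists>y. \<forall>v. q dvd v - y \<longrightarrow> (\<exists>z\<in>A. P dvd z - a0 \<and> Q dvd z - v \<and> R dvd z - k)"
proof -
  obtain b where b: "b \<in> B" using B_nonempty by blast
  note s = serves_first[OF k]
  have notO: "\<not> has_type (b' - b) Equal Near Near" if "b' \<in> B" for b'
    using no_partners b that unfolding avoids_def has_type_def by blast
  obtain z0 b0 where z0: "z0 \<in> A" "b0 \<in> B" "far a0 k z0" "has_type (b0 - b) Equal Far Equal"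
    by (rule servesE[OF s b, of 1 1 1]) (use notO in auto)
  show ?thesis
  proof (intro exI[of _ z0] allI impI)
    fix v assume v: "q dvd v - z0"
    have "\<not> q dvd j0 - v" using z0(3) j0 v unfolding far_def by (metis dvd_rules)
    then have "tyq (j0 - v) = tyq (b0 - b)" using z0(4) dtype_F_iff[of q q] unfolding has_type_def by metis
    then obtain \<rho> where \<rho>: "coprime \<rho> q" "Q dvd (j0 - v) - \<rho> * (b0 - b)"
      using unit_dtype[OF prime_q] by blast
    obtain z b' where z: "z \<in> A" "b' \<in> B" "Q dvd j0 - z - \<rho> * (b' - b)" "far a0 k z" "has_type (b' - b) Equal Far Equal"
      by (rule servesE[OF s b, of 1 \<rho> 1]) (use notO \<rho> in auto)
    have "q dvd z - z0"
    proof (rule ccontr)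
      assume "\<not> q dvd z - z0"
      then have "tyq (z - z0) = Far" by (simp add: dtype_F_iff)
      moreover have "typ (z - z0) = Equal" "tyr (z - z0) = Equal"
        using z(4) z0(3) unfolding far_def by (blast intro: dtype_E_at)+
      ultimately have "avoids Equal Far Equal" using avoidsI[OF z(1) z0(1)] by auto
      then show False using z0(2,4) b unfolding avoids_def has_type_def by blast
    qed
    then have "q dvd z - v" using v by (metis dvd_sym dvd_tr)
    then have "q dvd j0 - v - \<rho> * (b' - b)" using dvd_replace[OF dvd_mult_left[OF z(3)]] by blast
    then have "q dvd b' - b0" using unit_cancel[OF \<rho>(1) _ dvd_mult_left[OF \<rho>(2)]] by blast
    moreover have "P dvd b' - b0" "R dvd b' - b0"
      using z(5) z0(4) dtype_E_diff[of _ _ b' b b0] unfolding has_type_def dtype_E_iff by blast+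
    ultimately have "b' = b0" using B_eq_mod_D[OF z(2) z0(2)] by (auto dest: dvd_mult_left)
    then have "Q dvd (j0 - v - \<rho> * (b0 - b)) - (j0 - z - \<rho> * (b0 - b))" using \<rho>(2) z(3) by (simp only: dvd_diff)
    then have "Q dvd z - v" by simp
    then show "\<exists>z\<in>A. P dvd z - a0 \<and> Q dvd z - v \<and> R dvd z - k"
      using z(1,4) unfolding far_def by blast
  qed
qed

end

subsection \<open>Planes outside the corner\<close>

text \<open>The additional facts concern \<open>B\<close> alone, so they persist while
  \<open>A\<close> is changed by fiber shifts.\<close>

locale product_tiling = dilation_tiling +
  assumes mod_D: "\<And>b b'. b \<in> B \<Longrightarrow> b' \<in> B \<Longrightarrow> p ^ m dvd b - b' \<Longrightarrow> q dvd b - b' \<Longrightarrow> r dvd b - b' \<Longrightarrow> b = b'"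
    and row_q: "\<And>b w. b \<in> B \<Longrightarrow> \<exists>b'\<in>B. P dvd b' - b \<and> R dvd b' - b \<and> q dvd b' - w"
    and row_r: "\<And>b w. b \<in> B \<Longrightarrow> \<exists>b'\<in>B. P dvd b' - b \<and> Q dvd b' - b \<and> r dvd b' - w"
begin

lemma swapped_product: "product_tiling p r q m A B"
proof -
  interpret sw: dilation_tiling p r q m A B by (rule swapped)
  show ?thesis by unfold_locales (use mod_D row_q row_r in blast)+
qed

text \<open>The row in the \<open>r\<close> direction through \<open>b\<close> contains an element
  congruent to \<open>b'\<close> modulo \<open>r\<close>, and \<open>mod_D\<close> identifies it
  with \<open>b'\<close>.\<close>

lemma B_square:
  assumes "b \<in> B" "b' \<in> B" "p ^ m dvd b' - b" "q dvd b' - b"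
  shows "Q dvd b' - b"
proof -
  obtain d where d: "d \<in> B" "P dvd d - b" "Q dvd d - b" "r dvd d - b'" using row_r[OF assms(1)] by blast
  have "p ^ m dvd d - b'" using dvd_mult_left[OF d(2)] assms(3) by (metis dvd_sym dvd_tr)
  moreover have "q dvd d - b'" using dvd_mult_left[OF d(3)] assms(4) by (metis dvd_sym dvd_tr)
  ultimately have "d = b'" using mod_D d(1,4) assms(2) by blast
  then show ?thesis using d by simp
qed

lemma not_dvd_succ: "\<not> q dvd b' - b" if "q dvd b' - (b + 1)" for b b' :: int
proof
  assume "q dvd b' - b"
  then have "q dvd (b' - b) - (b' - (b + 1))" using that by (rule dvd_diff)
  then have "q dvd 1" by simp
  then show False using prime_q not_prime_unit by blast
qed

text \<open>The other two possibilities occur in \<open>B - B\<close>: a step along a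
  \<open>q\<close>-row gives \<open>Equal\<close>, \<open>Far\<close>, \<open>Equal\<close>, and a
  further step along an \<open>r\<close>-row gives \<open>Equal\<close>, \<open>Far\<close>,
  \<open>Far\<close>.\<close>

lemma plane_types:
  assumes z: "z \<in> A" "z' \<in> A" "P dvd z - z'" and Far: "\<not> q dvd z - z'"
  shows "tyr (z - z') = Near"
proof -
  interpret sw: product_tiling p r q m A B by (rule swapped_product)
  obtain b where b: "b \<in> B" using B_nonempty by blast
  obtain c where c: "c \<in> B" "P dvd c - b" "R dvd c - b" "q dvd c - (b + 1)" using row_q[OF b] by blast
  have cF: "tyq (c - b) = Far" using not_dvd_succ[OF c(4)] by (simp add: dtype_F_iff)
  have zF: "tyq (z - z') = Far" using Far by (simp add: dtype_F_iff)
  have zE: "typ (z - z') = Equal" using z(3) by (simp add: dtype_E_iff)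
  have ne: "c \<noteq> b" using cF by (auto simp: dtype_def)
  have 1: "tyr (z - z') \<noteq> Equal"
  proof
    assume "tyr (z - z') = Equal"
    moreover have "typ (c - b) = Equal" "tyr (c - b) = Equal" using c(2,3) by (simp_all add: dtype_E_iff)
    ultimately show False using no_common_type[OF z(1,2) c(1) b] zE zF cF ne by simp
  qed
  obtain d where d: "d \<in> B" "P dvd d - c" "Q dvd d - c" "r dvd d - (c + 1)" using row_r[OF c(1)] by blast
  have "tyq (d - b) = Far" using dtype_shift[OF d(3), of b] cF by simp
  moreover have "typ (d - b) = Equal" using c(2) d(2) unfolding dtype_E_iff by (metis dvd_tr)
  moreover have "tyr (d - c) = Far" using sw.not_dvd_succ[OF d(4)] by (simp add: dtype_F_iff)
  then have "tyr (d - b) = Far" using dtype_shift'[OF c(3), of d] by simp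
  moreover from calculation(1) have "d \<noteq> b" by (auto simp: dtype_def)
  ultimately have "tyr (z - z') \<noteq> Far" using no_common_type[OF z(1,2) d(1) b] zE zF by fastforce
  then show ?thesis using 1 dist_type.exhaust by blast
qed

end

locale two_planes = product_tiling +
  fixes x0 a0 a1 :: int
  assumes a01: "p ^ m dvd a0 - a1" "\<not> P dvd a0 - a1"
    and plane0: "\<And>v w. q dvd v - x0 \<Longrightarrow> r dvd w - x0 \<Longrightarrow>
      \<exists>z\<in>A. P dvd z - a0 \<and> Q dvd z - v \<and> R dvd z - w"
    and plane1: "\<And>v w. q dvd v - x0 \<Longrightarrow> r dvd w - x0 \<Longrightarrow>
      \<exists>z\<in>A. P dvd z - a1 \<and> Q dvd z - v \<and> R dvd z - w"
begin

lemma swapped_planes: "two_planes p r q m A B x0 a0 a1"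
proof -
  interpret sw: product_tiling p r q m A B by (rule swapped_product)
  show ?thesis by unfold_locales (use a01 plane0 plane1 in blast)+
qed

text \<open>Both full planes contain a point on the \<open>p\<close>-fiber of the point to be
  covered, so \<open>served_p\<close> applies twice; since the planes differ, only the plane
  \<open>e\<close> remains for \<open>z\<close>. The dilation is 1 in the first coordinate.\<close>

lemma plane_cover:
  assumes e: "p ^ m dvd e - a0" and x: "q dvd x2 - x0" "r dvd x3 - x0"
    and b: "b \<in> B" and \<rho>: "coprime \<rho>2 q" "coprime \<rho>3 r"
  obtains z b' where "z \<in> A" "b' \<in> B" "P dvd z - e" "P dvd b' - b"
    "Q dvd x2 - z - \<rho>2 * (b' - b)" "R dvd x3 - z - \<rho>3 * (b' - b)"
proof -
  have c1: "coprime 1 p" by simp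
  obtain z b' where z: "z \<in> A" "b' \<in> B" and d1: "P dvd e - z - 1 * (b' - b)"
    and d2: "Q dvd x2 - z - \<rho>2 * (b' - b)" and d3: "R dvd x3 - z - \<rho>3 * (b' - b)"
    using cover[OF b c1 \<rho>] by blast
  note g = cover_gcd[OF c1 \<rho> d1 d2 d3]
  obtain a' where a': "a' \<in> A" "P dvd a' - a0" "Q dvd a' - x2" "R dvd a' - x3"
    using plane0[OF x] by blast
  obtain a'' where a'': "a'' \<in> A" "P dvd a'' - a1" "Q dvd a'' - x2" "R dvd a'' - x3"
    using plane1[OF x] by blast
  have "p ^ m dvd a' - e" using dvd_mult_left[OF a'(2)] e by (metis dvd_sym dvd_tr)
  then have 1: "P dvd z - e \<or> P dvd z - a'"
    by (rule served_p[OF z(1) a'(1) b z(2) g _ a'(3,4)])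
  have "p ^ m dvd a'' - e" using dvd_mult_left[OF a''(2)] e a01(1) by (metis dvd_sym dvd_tr)
  then have 2: "P dvd z - e \<or> P dvd z - a''"
    by (rule served_p[OF z(1) a''(1) b z(2) g _ a''(3,4)])
  have ze: "P dvd z - e"
  proof (rule ccontr)
    assume "\<not> P dvd z - e"
    then have "P dvd z - a0" "P dvd z - a1" using 1 2 a'(2) a''(2) by (metis dvd_tr)+
    then show False using a01(2) by (metis dvd_sym dvd_tr)
  qed
  then have "P dvd (e - z - 1 * (b' - b)) + (z - e)" using d1 by (rule dvd_add[rotated])
  then have "P dvd - (b' - b)" by simp
  then have "P dvd b' - b" by (simp only: dvd_minus_iff)
  then show thesis using that z ze d2 d3 by blast
qed

text \<open>To hit \<open>w\<close>, a grid point and a unit are chosen such that only one residue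
  of \<open>b'\<close> modulo \<open>q\<close> is possible: the point \<open>w\<close> with unit 1
  if the column class is that of the grid, and otherwise \<open>x0\<close> with the unit carrying
  \<open>u - b\<close> to \<open>x0 - w\<close>. By \<open>B_square\<close> this residue determines
  \<open>b'\<close> modulo \<open>Q\<close>. The third coordinate is treated likewise, its class
  modulo \<open>r\<close> being fixed by \<open>plane_types\<close>.\<close>

lemma plane_columns:
  assumes e: "p ^ m dvd e - a0"
    and c: "\<And>z. z \<in> A \<Longrightarrow> P dvd z - e \<Longrightarrow> q dvd z - c" and w: "q dvd w - c"
  shows "\<exists>v. \<forall>v'. r dvd v' - v \<longrightarrow> (\<exists>z\<in>A. P dvd z - e \<and> Q dvd z - w \<and> R dvd z - v')"
proof -
  interpret sw: product_tiling p r q m A B by (rule swapped_product)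
  obtain b where b: "b \<in> B" using B_nonempty by blast
  have same_q: "Q dvd b' - b''" if "b' \<in> B" "b'' \<in> B" "P dvd b' - b" "P dvd b'' - b" "q dvd b' - b''" for b' b''
    using B_square[OF that(2,1) _ that(5)] that(3,4) by (meson dvd_mult_left dvd_sym dvd_tr)
  have same_r: "R dvd b' - b''" if "b' \<in> B" "b'' \<in> B" "P dvd b' - b" "P dvd b'' - b" "r dvd b' - b''" for b' b''
    using sw.B_square[OF that(2,1) _ that(5)] that(3,4) by (meson dvd_mult_left dvd_sym dvd_tr)
  have cancel: "k dvd z - w'" if "k dvd x - z - \<rho> * (b' - b)" "k dvd x - w' - \<rho> * (u - b)" "k dvd b' - u" for k x z w' \<rho> b' u :: int
  proof -
    have "k dvd (x - w' - \<rho> * (u - b)) - (x - z - \<rho> * (b' - b)) - \<rho> * (b' - u)"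
      by (intro dvd_diff dvd_mult that)
    then show ?thesis by (simp add: algebra_simps)
  qed
  have "\<exists>x2 \<rho> u. q dvd x2 - x0 \<and> coprime \<rho> q \<and> u \<in> B \<and> P dvd u - b \<and> Q dvd x2 - w - \<rho> * (u - b)"
  proof (cases "q dvd c - x0")
    case True
    then show ?thesis using dvd_tr[OF w True] b by (intro exI[of _ w] exI[of _ 1] exI[of _ b]) simp
  next
    case False
    obtain u where u: "u \<in> B" "P dvd u - b" "q dvd u - (b + 1)" using row_q[OF b] by blast
    have "\<not> q dvd x0 - w" using False w by (metis dvd_sym dvd_tr)
    then have "tyq (x0 - w) = tyq (u - b)" using not_dvd_succ[OF u(3)] dtype_F_iff[of q q] by metis
    then obtain \<rho> where "coprime \<rho> q" "Q dvd (x0 - w) - \<rho> * (u - b)" using unit_dtype[OF prime_q] by blast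
    then show ?thesis using u by (intro exI[of _ x0] exI[of _ \<rho>] exI[of _ u]) auto
  qed
  then obtain x2 \<rho>2 u where x2: "q dvd x2 - x0" "coprime \<rho>2 q" "u \<in> B" "P dvd u - b"
    "Q dvd x2 - w - \<rho>2 * (u - b)" by blast
  have col: "\<exists>z\<in>A. \<exists>b'\<in>B. P dvd z - e \<and> Q dvd z - w \<and> P dvd b' - b \<and> R dvd x3 - z - \<rho>3 * (b' - b)"
    if x3: "r dvd x3 - x0" and \<rho>3: "coprime \<rho>3 r" for x3 \<rho>3
  proof -
    obtain z b' where z: "z \<in> A" "b' \<in> B" "P dvd z - e" "P dvd b' - b"
      "Q dvd x2 - z - \<rho>2 * (b' - b)" "R dvd x3 - z - \<rho>3 * (b' - b)"
      by (rule plane_cover[OF e x2(1) x3 b x2(2) \<rho>3])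
    have "q dvd z - w" using c[OF z(1,3)] w by (metis dvd_sym dvd_tr)
    then have "q dvd x2 - w - \<rho>2 * (b' - b)" using dvd_replace[OF dvd_mult_left[OF z(5)]] by blast
    then have "q dvd b' - u" using unit_cancel[OF x2(2) _ dvd_mult_left[OF x2(5)]] by blast
    then have "Q dvd b' - u" using same_q z(2,4) x2(3,4) by blast
    then have "Q dvd z - w" using cancel[OF z(5) x2(5)] by blast
    then show ?thesis using z by blast
  qed
  obtain z0 where z0: "z0 \<in> A" "P dvd z0 - e" "Q dvd z0 - w" using col[of x0 1] by auto
  have near: "r dvd z - z0" if z: "z \<in> A" "P dvd z - e" "Q dvd z - w" for z
  proof (rule ccontr)
    assume n: "\<not> r dvd z - z0"
    have "P dvd z - z0" "Q dvd z - z0" using z z0 by (metis dvd_sym dvd_tr)+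
    then show False using sw.plane_types[OF z(1) z0(1) _ n] by (simp add: dtype_def)
  qed
  show ?thesis
  proof (intro exI[of _ z0] allI impI)
    fix v' assume v': "r dvd v' - z0"
    have "\<exists>x3 \<rho> u. r dvd x3 - x0 \<and> coprime \<rho> r \<and> u \<in> B \<and> P dvd u - b \<and> R dvd x3 - v' - \<rho> * (u - b)"
    proof (cases "r dvd z0 - x0")
      case True
      then show ?thesis using dvd_tr[OF v' True] b by (intro exI[of _ v'] exI[of _ 1] exI[of _ b]) simp
    next
      case False
      obtain u where u: "u \<in> B" "P dvd u - b" "r dvd u - (b + 1)" using row_r[OF b] by blast
      have "\<not> r dvd x0 - v'" using False v' by (metis dvd_sym dvd_tr)
      then have "tyr (x0 - v') = tyr (u - b)" using sw.not_dvd_succ[OF u(3)] dtype_F_iff[of r r] by metis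
      then obtain \<rho> where "coprime \<rho> r" "R dvd (x0 - v') - \<rho> * (u - b)" using unit_dtype[OF prime_r] by blast
      then show ?thesis using u by (intro exI[of _ x0] exI[of _ \<rho>] exI[of _ u]) auto
    qed
    then obtain x3 \<rho>3 u3 where x3: "r dvd x3 - x0" "coprime \<rho>3 r" "u3 \<in> B" "P dvd u3 - b"
      "R dvd x3 - v' - \<rho>3 * (u3 - b)" by blast
    obtain z b' where z: "z \<in> A" "b' \<in> B" "P dvd z - e" "Q dvd z - w" "P dvd b' - b"
      "R dvd x3 - z - \<rho>3 * (b' - b)" using col[OF x3(1,2)] by blast
    have "r dvd z - v'" using near[OF z(1,3,4)] v' by (metis dvd_sym dvd_tr)
    then have "r dvd x3 - v' - \<rho>3 * (b' - b)" using dvd_replace[OF dvd_mult_left[OF z(6)]] by blast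
    then have "r dvd b' - u3" using unit_cancel[OF x3(2) _ dvd_mult_left[OF x3(5)]] by blast
    then have "R dvd b' - u3" using same_r z(2,5) x3(3,4) by blast
    then have "R dvd z - v'" using cancel[OF z(6) x3(5)] by blast
    then show "\<exists>z\<in>A. P dvd z - e \<and> Q dvd z - w \<and> R dvd z - v'" using z by blast
  qed
qed

text \<open>By \<open>plane_types\<close>, points of the plane that differ modulo \<open>q\<close>
  agree modulo \<open>r\<close>. If two such points exist, any further point differs modulo
  \<open>q\<close> from one of them, so the whole plane lies in one class modulo
  \<open>r\<close>.\<close>

lemma plane_structure:
  assumes e: "p ^ m dvd e - a0"
  shows "(\<exists>c. \<forall>w. q dvd w - c \<longrightarrow> (\<exists>v. \<forall>v'. r dvd v' - v \<longrightarrow>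
        (\<exists>z\<in>A. P dvd z - e \<and> Q dvd z - w \<and> R dvd z - v'))) \<or>
    (\<exists>c. \<forall>w. r dvd w - c \<longrightarrow> (\<exists>v. \<forall>v'. q dvd v' - v \<longrightarrow>
        (\<exists>z\<in>A. P dvd z - e \<and> R dvd z - w \<and> Q dvd z - v')))"
proof -
  interpret sw: two_planes p r q m A B x0 a0 a1 by (rule swapped_planes)
  show ?thesis
  proof (cases "\<exists>c. \<forall>z\<in>A. P dvd z - e \<longrightarrow> q dvd z - c")
    case True
    then obtain c where c: "\<And>z. z \<in> A \<Longrightarrow> P dvd z - e \<Longrightarrow> q dvd z - c" by blast
    show ?thesis by (intro disjI1 exI[of _ c] allI impI plane_columns[OF e c])
  next
    case False
    have far: "r dvd z - z'" if z: "z \<in> A" "P dvd z - e" "z' \<in> A" "P dvd z' - e" "\<not> q dvd z - z'" for z z'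
    proof -
      have "P dvd z - z'" using z(2,4) by (metis dvd_sym dvd_tr)
      then have "tyr (z - z') = Near" using plane_types z(1,3,5) by blast
      then show ?thesis by (simp add: dtype_N_iff)
    qed
    obtain z1 where z1: "z1 \<in> A" "P dvd z1 - e"
      using False by blast
    obtain z2 where z2: "z2 \<in> A" "P dvd z2 - e" "\<not> q dvd z2 - z1" using False by blast
    have c: "r dvd z - z1" if z: "z \<in> A" "P dvd z - e" for z
    proof (cases "q dvd z - z1")
      case True
      then have "\<not> q dvd z - z2" using z2(3) by (metis dvd_sym dvd_tr)
      then have "r dvd z - z2" using far[OF z z2(1,2)] by blast
      moreover have "r dvd z2 - z1" by (rule far[OF z2(1,2) z1 z2(3)])
      ultimately show ?thesis by (rule dvd_tr)
    next
      case False
      then show ?thesis using far[OF z z1] by blast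
    qed
    show ?thesis by (intro disjI2 exI[of _ z1] allI impI sw.plane_columns[OF e c])
  qed
qed

end

subsection \<open>Tijdeman's theorem\<close>

lemma prime_dvd_binomial_diff:
  fixes x y :: "'a :: comm_ring_1"
  assumes l: "prime l"
  shows "of_nat l dvd (x + y) ^ l - (x ^ l + y ^ l)"
proof -
  have l0: "l > 0" using l by (rule prime_gt_0_nat)
  have "(x + y) ^ l = (\<Sum>k\<le>l. of_nat (l choose k) * x ^ k * y ^ (l - k))" by (rule binomial_ring)
  also have "{..l} = insert 0 (insert l {0<..<l})" using l0 by auto
  finally have "(x + y) ^ l - (x ^ l + y ^ l) = (\<Sum>k\<in>{0<..<l}. of_nat (l choose k) * x ^ k * y ^ (l - k))"
    using l0 by simp
  also have "of_nat l dvd \<dots>"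
  proof (intro dvd_sum dvd_mult2)
    fix k assume "k \<in> {0<..<l}"
    then have "l dvd l choose k" using l by (intro dvd_choose_prime) auto
    then show "(of_nat l :: 'a) dvd of_nat (l choose k)" by (auto elim!: dvdE)
  qed
  finally show ?thesis .
qed

lemma prime_dvd_sum_power_diff:
  fixes f :: "'b \<Rightarrow> 'a :: comm_ring_1"
  assumes l: "prime l" and "finite S"
  shows "of_nat l dvd (\<Sum>i\<in>S. f i) ^ l - (\<Sum>i\<in>S. f i ^ l)"
  using assms(2)
proof induction
  case empty
  then show ?case using prime_gt_0_nat[OF l] by (simp add: zero_power)
next
  case (insert i S)
  have "of_nat l dvd ((f i + sum f S) ^ l - (f i ^ l + sum f S ^ l)) + (sum f S ^ l - (\<Sum>i\<in>S. f i ^ l))"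
    using prime_dvd_binomial_diff[OF l] insert.IH by (rule dvd_add)
  then show ?case using insert.hyps by (simp add: algebra_simps)
qed

text \<open>The coefficient at exponent \<open>x\<close> after reduction modulo
  \<open>X ^ M - 1\<close>. The cut-off \<open>n\<close> keeps the sum finite and has to bound the
  degrees involved.\<close>

definition reduced_coeff :: "nat \<Rightarrow> nat \<Rightarrow> nat \<Rightarrow> int poly \<Rightarrow> int" where
  "reduced_coeff n M x f = (\<Sum>i | i \<le> n \<and> i mod M = x. poly.coeff f i)"

lemma reduced_coeff_add: "reduced_coeff n M x (f + g) = reduced_coeff n M x f + reduced_coeff n M x g"
  by (simp add: reduced_coeff_def sum.distrib)

lemma reduced_coeff_diff: "reduced_coeff n M x (f - g) = reduced_coeff n M x f - reduced_coeff n M x g"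
  by (simp add: reduced_coeff_def sum_subtractf)

lemma reduced_coeff_sum: "reduced_coeff n M x (\<Sum>i\<in>S. f i) = (\<Sum>i\<in>S. reduced_coeff n M x (f i))"
  unfolding reduced_coeff_def coeff_sum by (rule sum.swap)

lemma reduced_coeff_of_nat: "reduced_coeff n M x (of_nat l * f) = int l * reduced_coeff n M x f"
  by (simp add: reduced_coeff_def sum_distrib_left of_nat_poly)

lemma reduced_coeff_monom:
  assumes "k \<le> n"
  shows "reduced_coeff n M x (Polynomial.monom c k) = (if k mod M = x then c else 0)"
proof -
  have "reduced_coeff n M x (Polynomial.monom c k) = (\<Sum>i | i \<le> n \<and> i mod M = x. if k = i then c else 0)"
    unfolding reduced_coeff_def by simp
  also have "\<dots> = (if k mod M = x then c else 0)" using assms by (subst sum.delta') auto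
  finally show ?thesis .
qed

text \<open>Multiplication by \<open>X ^ M\<close> moves coefficients only within their residue
  class modulo \<open>M\<close>.\<close>

lemma reduced_coeff_multiple:
  assumes "Polynomial.degree g + M \<le> n" "M > 0"
  shows "reduced_coeff n M x ((Polynomial.monom 1 M - 1) * g) = 0"
proof -
  let ?S = "\<lambda>n. {i. i \<le> n \<and> i mod M = x}"
  have "(\<Sum>i\<in>?S n. poly.coeff (Polynomial.monom 1 M * g) i) = (\<Sum>i\<in>(\<lambda>i. i + M) ` ?S (n - M). poly.coeff (Polynomial.monom 1 M * g) i)"
  proof (rule sum.mono_neutral_right)
    show "(\<lambda>i. i + M) ` ?S (n - M) \<subseteq> ?S n" using assms by auto
    show "\<forall>i\<in>?S n - (\<lambda>i. i + M) ` ?S (n - M). poly.coeff (Polynomial.monom 1 M * g) i = 0"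
    proof
      fix i assume i: "i \<in> ?S n - (\<lambda>i. i + M) ` ?S (n - M)"
      have "i < M"
      proof (rule ccontr)
        assume "\<not> i < M"
        then have "i = (i - M) + M" "(i - M) mod M = x" using i by (auto simp: le_mod_geq)
        moreover have "i - M \<le> n - M" using i by auto
        ultimately have "i \<in> (\<lambda>i. i + M) ` ?S (n - M)" by blast
        then show False using i by blast
      qed
      then show "poly.coeff (Polynomial.monom 1 M * g) i = 0" by (simp add: coeff_monom_mult)
    qed
  qed simp
  also have "\<dots> = (\<Sum>i\<in>?S (n - M). poly.coeff (Polynomial.monom 1 M * g) (i + M))"
    by (rule sum.reindex_cong[of "\<lambda>i. i + M"]) (auto simp: inj_on_def)
  also have "\<dots> = (\<Sum>i\<in>?S (n - M). poly.coeff g i)" by (simp add: coeff_monom_mult)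
  also have "\<dots> = (\<Sum>i\<in>?S n. poly.coeff g i)"
    by (rule sum.mono_neutral_left) (use assms in \<open>auto intro!: coeff_eq_0\<close>)
  finally show ?thesis
    by (simp add: reduced_coeff_def algebra_simps sum_subtractf)
qed

lemma monom_mod_dvd:
  "(Polynomial.monom 1 M - 1 :: int poly) dvd Polynomial.monom 1 k - Polynomial.monom 1 (k mod M)"
proof -
  have "Polynomial.monom 1 M - 1 dvd (Polynomial.monom 1 M :: int poly) ^ (k div M) - 1 ^ (k div M)"
    unfolding power_diff_sumr2 by simp
  then have "Polynomial.monom 1 M - 1 dvd Polynomial.monom 1 (k mod M) * ((Polynomial.monom 1 M :: int poly) ^ (k div M) - 1)"
    by (intro dvd_mult) simp
  also have "Polynomial.monom 1 (k mod M) * ((Polynomial.monom 1 M :: int poly) ^ (k div M) - 1)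
    = Polynomial.monom 1 k - Polynomial.monom 1 (k mod M)"
    by (simp add: monom_power mult_monom algebra_simps)
  finally show ?thesis .
qed

text \<open>A surjection between finite sets of equal size is injective, so uniqueness of
  representations can be traded for a count.\<close>

lemma tiling_iff_cover:
  assumes "M > 0"
  shows "tiling M A B \<longleftrightarrow> A \<subseteq> zmod M \<and> B \<subseteq> zmod M \<and> card A * card B = M \<and>
    (\<forall>x\<in>zmod M. \<exists>a\<in>A. \<exists>b\<in>B. (a + b) mod int M = x)"
proof -
  have cz: "card (zmod M) = M" "finite (zmod M)" by (auto simp: zmod_def)
  show ?thesis
  proof
    assume t: "tiling M A B"
    then have bij: "bij_betw (\<lambda>(a, b). (a + b) mod int M) (A \<times> B) (zmod M)" by (simp add: tiling_def)
    then have "card (A \<times> B) = M" using bij_betw_same_card cz by fastforce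
    moreover have "\<exists>a\<in>A. \<exists>b\<in>B. (a + b) mod int M = x" if "x \<in> zmod M" for x
    proof -
      have "x \<in> (\<lambda>(a, b). (a + b) mod int M) ` (A \<times> B)" using bij that by (simp add: bij_betw_def)
      then show ?thesis by auto
    qed
    ultimately show "A \<subseteq> zmod M \<and> B \<subseteq> zmod M \<and> card A * card B = M \<and>
      (\<forall>x\<in>zmod M. \<exists>a\<in>A. \<exists>b\<in>B. (a + b) mod int M = x)"
      using t by (simp add: tiling_def card_cartesian_product)
  next
    assume h: "A \<subseteq> zmod M \<and> B \<subseteq> zmod M \<and> card A * card B = M \<and>
      (\<forall>x\<in>zmod M. \<exists>a\<in>A. \<exists>b\<in>B. (a + b) mod int M = x)"
    then have "finite (A \<times> B)" using cz finite_subset by blast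
    moreover have im: "(\<lambda>(a, b). (a + b) mod int M) ` (A \<times> B) = zmod M"
    proof
      show "(\<lambda>(a, b). (a + b) mod int M) ` (A \<times> B) \<subseteq> zmod M" using assms by (auto simp: zmod_def)
      show "zmod M \<subseteq> (\<lambda>(a, b). (a + b) mod int M) ` (A \<times> B)" using h by force
    qed
    moreover have "card (A \<times> B) = card (zmod M)" using h cz by (simp add: card_cartesian_product)
    ultimately have "inj_on (\<lambda>(a, b). (a + b) mod int M) (A \<times> B)" by (intro eq_card_imp_inj_on) auto
    then show "tiling M A B" using im h by (simp add: tiling_def bij_betw_def)
  qed
qed

text \<open>Tijdeman's theorem for a prime \<open>l\<close>: modulo \<open>l\<close> and \<open>X ^ M - 1\<close>, the polynomial
  \<open>A(X) B(X ^ l)\<close> is \<open>A(X) B(X) ^ l = |B| ^ (l - 1) * (1 + X + \<dots> + X ^ (M - 1))\<close>, so that no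
  coefficient of it can vanish.\<close>

lemma tiling_prime_cover:
  assumes t: "tiling M A B" and M: "M > 0" and l: "prime l" "\<not> l dvd M" and x: "x \<in> zmod M"
  shows "\<exists>a\<in>A. \<exists>b\<in>B. (a + int l * b) mod int M = x"
proof (rule ccontr)
  assume none: "\<not> ?thesis"
  define h :: "int poly" where "h = Polynomial.monom 1 M - 1"
  define T :: "int poly" where "T = (\<Sum>i<M. Polynomial.monom 1 i)"
  define a :: "int poly" where "a = (\<Sum>i\<in>A. Polynomial.monom 1 (nat i))"
  define b :: "int poly" where "b = (\<Sum>i\<in>B. Polynomial.monom 1 (nat i))"
  define b' :: "int poly" where "b' = (\<Sum>i\<in>B. Polynomial.monom 1 (nat i) ^ l)"
  have tt: "A \<subseteq> zmod M" "B \<subseteq> zmod M" "card A * card B = M"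
    and bij: "bij_betw (\<lambda>(a, b). (a + b) mod int M) (A \<times> B) (zmod M)"
    using t tiling_iff_cover[OF M] by (auto simp: tiling_def)
  have fin: "finite A" "finite B" using tt finite_subset[of _ "zmod M"] by (auto simp: zmod_def)
  have nn: "i \<in> A \<Longrightarrow> i \<ge> 0" "i \<in> B \<Longrightarrow> i \<ge> 0" for i using tt by (auto simp: zmod_def)
  have T': "T = (\<Sum>i\<in>zmod M. Polynomial.monom 1 (nat i))"
    unfolding T_def by (rule sum.reindex_cong[of nat]) (auto simp: zmod_def inj_on_def image_iff intro!: bexI[of _ "int _"])
  have ab: "a * b = (\<Sum>(i, j)\<in>A \<times> B. Polynomial.monom 1 (nat i + nat j))"
    unfolding a_def b_def by (simp add: sum_product sum.cartesian_product mult_monom)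
  have "T = (\<Sum>(i, j)\<in>A \<times> B. Polynomial.monom 1 (nat ((i + j) mod int M)))"
    unfolding T' by (rule sum.reindex_bij_betw[OF bij, symmetric, THEN trans]) (auto simp: case_prod_unfold)
  also have "\<dots> = (\<Sum>(i, j)\<in>A \<times> B. Polynomial.monom 1 ((nat i + nat j) mod M))"
    using nn by (intro sum.cong) (auto simp: nat_mod_distrib nat_add_distrib)
  finally have "a * b - T = (\<Sum>(i, j)\<in>A \<times> B. Polynomial.monom 1 (nat i + nat j) - Polynomial.monom 1 ((nat i + nat j) mod M))"
    using ab by (simp add: sum_subtractf case_prod_unfold)
  also have "h dvd \<dots>" unfolding h_def by (intro dvd_sum) (auto simp: monom_mod_dvd)
  finally have 1: "h dvd a * b - T" .
  have hT: "h = [:- 1, 1:] * T"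
  proof -
    have "(Polynomial.monom 1 1 :: int poly) ^ M - 1 = (Polynomial.monom 1 1 - 1) * (\<Sum>i<M. Polynomial.monom 1 1 ^ i)"
      by (rule power_diff_1_eq)
    then show ?thesis by (simp add: h_def T_def monom_power monom_altdef one_pCons)
  qed
  \<comment> \<open>\<open>X - 1\<close> divides \<open>g - g(1)\<close>, and
    \<open>(X - 1) * T\<close> is \<open>X ^ M - 1\<close>: multiplying \<open>T\<close> by
    \<open>g\<close> only scales it.\<close>
  have 2: "h dvd T * g - T * [:poly g 1:]" for g
  proof -
    have "poly (g - [:poly g 1:]) 1 = 0" by simp
    then have "[:- 1, 1:] dvd g - [:poly g 1:]" by (simp only: poly_eq_0_iff_dvd)
    then have "[:- 1, 1:] * T dvd (g - [:poly g 1:]) * T" by (rule mult_dvd_mono) simp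
    then show ?thesis unfolding hT by (simp only: algebra_simps)
  qed
  have l0: "l > 0" using l by (simp add: prime_gt_0_nat)
  have 3: "of_nat l dvd b ^ l - b'" unfolding b_def b'_def by (rule prime_dvd_sum_power_diff[OF l(1) fin(2)])
  have b1: "poly b 1 = int (card B)" unfolding b_def by (simp add: poly_sum poly_monom)
  have bl: "b ^ l = b * b ^ (l - 1)" using l0 by (cases l) simp_all
  have "h dvd (a * b - T) * b ^ (l - 1) + (T * b ^ (l - 1) - T * [:poly (b ^ (l - 1)) 1:])"
    using 1 2 by (intro dvd_add dvd_mult2)
  also have "\<dots> = a * b ^ l - T * [:int (card B) ^ (l - 1):]"
    unfolding bl poly_power b1 by (simp only: algebra_simps)
  finally obtain u where u: "a * b ^ l - T * [:int (card B) ^ (l - 1):] = h * u" by (auto elim: dvdE)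
  obtain v where v: "b ^ l - b' = of_nat l * v" using 3 by (auto elim: dvdE)
  have eq: "a * b' = T * [:int (card B) ^ (l - 1):] + h * u - of_nat l * (a * v)"
  proof -
    have "a * b' = a * b ^ l - a * (b ^ l - b')" by (simp add: algebra_simps)
    also have "\<dots> = a * b ^ l - a * (of_nat l * v)" unfolding v ..
    also have "\<dots> = (T * [:int (card B) ^ (l - 1):] + h * u) - a * (of_nat l * v)" using u by (simp add: algebra_simps)
    finally show ?thesis by (simp add: algebra_simps)
  qed
  \<comment> \<open>One bound for all terms: the multiple \<open>h * u\<close>, the monomials of
    \<open>T\<close>, and the exponents of \<open>a * b'\<close>.\<close>
  define n where "n = Polynomial.degree u + M + M + l * M"
  let ?c = "reduced_coeff n M (nat x)"
  have xM: "nat x < M" "int (nat x) = x" using x by (auto simp: zmod_def)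
  have "a * b' = (\<Sum>(i, j)\<in>A \<times> B. Polynomial.monom 1 (nat i + nat j * l))"
    unfolding a_def b'_def by (simp add: sum_product sum.cartesian_product mult_monom monom_power)
  then have "?c (a * b') = (\<Sum>(i, j)\<in>A \<times> B. ?c (Polynomial.monom 1 (nat i + nat j * l)))"
    by (simp add: reduced_coeff_sum case_prod_unfold)
  also have "\<dots> = 0"
  proof (rule sum.neutral, clarify)
    fix i j assume ij: "i \<in> A" "j \<in> B"
    have "i \<in> zmod M" "j \<in> zmod M" using ij tt(1,2) by blast+
    then have "nat i < M" "nat j < M" by (auto simp: zmod_def)
    then have "l * nat j \<le> l * M" by (intro mult_le_mono2) simp
    then have "nat i + nat j * l \<le> n" using \<open>nat i < M\<close> unfolding n_def mult.commute[of _ l] by linarith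
    moreover have "(nat i + nat j * l) mod M \<noteq> nat x"
    proof
      assume "(nat i + nat j * l) mod M = nat x"
      then have "int ((nat i + nat j * l) mod M) = x" using xM by simp
      then have "(i + int l * j) mod int M = x" using nn ij by (simp add: zmod_int mult.commute)
      then show False using none ij by blast
    qed
    ultimately show "?c (Polynomial.monom 1 (nat i + nat j * l)) = 0" by (simp add: reduced_coeff_monom)
  qed
  finally have "?c (T * [:int (card B) ^ (l - 1):]) + ?c (h * u) - int l * ?c (a * v) = 0"
    unfolding eq reduced_coeff_add reduced_coeff_diff reduced_coeff_of_nat .
  moreover have "?c (h * u) = 0" unfolding h_def by (rule reduced_coeff_multiple) (use M n_def in auto)
  moreover have "?c (T * [:int (card B) ^ (l - 1):]) = int (card B) ^ (l - 1)"
  proof -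
    have "T * [:int (card B) ^ (l - 1):] = (\<Sum>i<M. Polynomial.monom (int (card B) ^ (l - 1)) i)"
      unfolding T_def sum_distrib_right by (rule sum.cong[OF refl]) (simp add: smult_monom)
    then have "?c (T * [:int (card B) ^ (l - 1):]) = (\<Sum>i<M. ?c (Polynomial.monom (int (card B) ^ (l - 1)) i))"
      by (simp add: reduced_coeff_sum)
    also have "\<dots> = (\<Sum>i<M. if i = nat x then int (card B) ^ (l - 1) else 0)"
      by (intro sum.cong refl, subst reduced_coeff_monom) (auto simp: n_def)
    also have "\<dots> = int (card B) ^ (l - 1)" using xM by simp
    finally show ?thesis .
  qed
  ultimately have "int (card B) ^ (l - 1) = int l * ?c (a * v)" by linarith
  then have "int l dvd int (card B) ^ (l - 1)" by simp
  then have "int l dvd int (card B)" using l(1) prime_dvd_power[of "int l" "int (card B)" "l - 1"] by simp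
  then have "l dvd card B" by simp
  then have "l dvd M" using tt(3) by (metis dvd_mult)
  then show False using l(2) by blast
qed

definition dilate :: "nat \<Rightarrow> nat \<Rightarrow> int set \<Rightarrow> int set" where
  "dilate M u B = (\<lambda>b. (int u * b) mod int M) ` B"

lemma tiling_dilate_prime:
  assumes t: "tiling M A B" and M: "M > 0" and l: "prime l" "\<not> l dvd M"
  shows "tiling M A (dilate M l B)"
proof -
  have tt: "A \<subseteq> zmod M" "B \<subseteq> zmod M" "card A * card B = M" using t tiling_iff_cover[OF M] by auto
  have inj: "inj_on (\<lambda>b. (int l * b) mod int M) B"
  proof (rule inj_onI)
    fix b b' assume b: "b \<in> B" "b' \<in> B" "int l * b mod int M = int l * b' mod int M"
    then have "int M dvd int l * (b - b')" by (simp add: mod_eq_dvd_iff algebra_simps)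
    moreover have "coprime l M" using l by (intro prime_imp_coprime) auto
    then have "coprime (int M) (int l)" by (simp add: coprime_commute)
    ultimately have "int M dvd b - b'" by (simp add: coprime_dvd_mult_right_iff)
    then have "b mod int M = b' mod int M" by (simp add: mod_eq_dvd_iff)
    moreover have "b mod int M = b" "b' mod int M = b'" using b tt by (auto simp: zmod_def)
    ultimately show "b = b'" by simp
  qed
  show ?thesis unfolding tiling_iff_cover[OF M]
  proof (intro conjI ballI)
    show "dilate M l B \<subseteq> zmod M" using M by (auto simp: dilate_def zmod_def)
    show "card A * card (dilate M l B) = M" using tt inj by (simp add: dilate_def card_image)
    fix x assume "x \<in> zmod M"
    then obtain a b where "a \<in> A" "b \<in> B" "(a + int l * b) mod int M = x"
      using tiling_prime_cover[OF t M l] by blast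
    then show "\<exists>a\<in>A. \<exists>b\<in>dilate M l B. (a + b) mod int M = x" unfolding dilate_def
      by (intro bexI[of _ a] bexI[of _ "int l * b mod int M"]) (simp_all add: mod_add_right_eq)
  qed (use tt in auto)
qed

lemma tiling_dilate:
  assumes t: "tiling M A B" and M: "M > 0" and u: "u > 0" "coprime u M"
  shows "tiling M A (dilate M u B)"
  using u
proof (induction u rule: less_induct)
  case (less u)
  have B: "B \<subseteq> zmod M" using t by (simp add: tiling_def)
  show ?case
  proof (cases "u = 1")
    case True
    have "dilate M 1 B = (\<lambda>b. b) ` B" unfolding dilate_def
      by (rule image_cong) (use B in \<open>auto simp: zmod_def\<close>)
    then show ?thesis using t True by simp
  next
    case False
    then obtain l where l: "prime l" "l dvd u" using prime_factor_nat by blast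
    then obtain v where v: "u = l * v" by (auto elim: dvdE)
    have "\<not> l dvd M" using l less.prems by (metis coprime_common_divisor not_prime_unit)
    moreover have "v < u" "v > 0" using v l less.prems prime_gt_1_nat by (auto simp: mult_less_cancel_right)
    moreover have "coprime v M" using less.prems v by simp
    ultimately have "tiling M A (dilate M l (dilate M v B))"
      using less.IH[of v] tiling_dilate_prime M l by blast
    moreover have "dilate M l (dilate M v B) = dilate M u B"
      unfolding dilate_def image_image v by (simp add: mod_mult_right_eq mult.assoc)
    ultimately show ?thesis by simp
  qed
qed

subsection \<open>Fibers and fiber shifts\<close>

locale three_primes =
  fixes p q r m M :: nat
  assumes primes: "prime p" "prime q" "prime r" and distinct: "p \<noteq> q" "p \<noteq> r" "q \<noteq> r"
    and M_eq: "M = p ^ Suc m * q\<^sup>2 * r\<^sup>2"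
begin

abbreviation "P \<equiv> int p ^ m * int p"
abbreviation "Q \<equiv> int q * int q"
abbreviation "R \<equiv> int r * int r"

lemma swapped: "three_primes p r q m M"
  by unfold_locales (use primes distinct M_eq in \<open>auto simp: mult.assoc mult.commute\<close>)

lemma pos: "p > 0" "q > 0" "r > 0" "M > 0"
  using primes prime_gt_0_nat M_eq by auto

lemma int_M: "int M = P * Q * R"
  unfolding M_eq by (simp add: power2_eq_square)

lemma coprimes: "coprime (int p) (int q)" "coprime (int p) (int r)" "coprime (int q) (int r)"
  using primes distinct by (auto intro: primes_coprime)

lemma coprime_PQR: "coprime P Q" "coprime (P * Q) R" "coprime P R" "coprime Q R"
  using coprimes by simp_all

lemma M_dvd_iff: "int M dvd d \<longleftrightarrow> P dvd d \<and> Q dvd d \<and> R dvd d"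
  unfolding int_M using coprime_PQR
  by (metis divides_mult dvd_mult_left dvd_mult_right)

lemma crt: "\<exists>x\<in>zmod M. P dvd x - x1 \<and> Q dvd x - x2 \<and> R dvd x - x3"
proof -
  obtain y where y: "[y = x1] (mod P)" "[y = x2] (mod Q)"
    using binary_chinese_remainder_int[OF coprime_PQR(1)] by blast
  obtain z where z: "[z = y] (mod P * Q)" "[z = x3] (mod R)"
    using binary_chinese_remainder_int[OF coprime_PQR(2)] by blast
  have M: "int M dvd z mod int M - z" by (metis mod_eq_dvd_iff mod_mod_trivial)
  have "P * Q dvd z - y" "P dvd y - x1" "Q dvd y - x2" "R dvd z - x3"
    using y z by (auto simp: cong_iff_dvd_diff)
  moreover have "P dvd z - y" "Q dvd z - y" using calculation(1) by (metis dvd_mult_left, metis dvd_mult_right)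
  ultimately have "P dvd z mod int M - x1" "Q dvd z mod int M - x2" "R dvd z mod int M - x3"
    using M unfolding M_dvd_iff by (metis dvd_tr)+
  moreover have "z mod int M \<in> zmod M" using pos by (simp add: zmod_def)
  ultimately show ?thesis by blast
qed

lemma zmod_eqI:
  assumes "x \<in> zmod M" "y \<in> zmod M" "P dvd x - y" "Q dvd x - y" "R dvd x - y"
  shows "x = y"
proof -
  have "int M dvd x - y" using assms by (simp add: M_dvd_iff)
  then have "x mod int M = y mod int M" by (simp add: mod_eq_dvd_iff)
  then show ?thesis using assms by (simp add: zmod_def)
qed

lemma coprime_unit:
  assumes "coprime \<rho>1 (int p)" "coprime \<rho>2 (int q)" "coprime \<rho>3 (int r)"
  obtains u where "u > 0" "coprime u M" "P dvd int u - \<rho>1" "Q dvd int u - \<rho>2" "R dvd int u - \<rho>3"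
proof -
  obtain x where x: "x \<in> zmod M" "P dvd x - \<rho>1" "Q dvd x - \<rho>2" "R dvd x - \<rho>3" using crt by blast
  have c: "coprime x k" if "k dvd x - \<rho>" "coprime \<rho> k" for k \<rho>
  proof -
    have "[x = \<rho>] (mod k)" using that(1) by (simp add: cong_iff_dvd_diff)
    then show ?thesis using that(2) cong_imp_coprime cong_sym by blast
  qed
  have "coprime x P" by (rule c[OF x(2)]) (use assms in simp)
  moreover have "coprime x Q" by (rule c[OF x(3)]) (use assms in simp)
  moreover have "coprime x R" by (rule c[OF x(4)]) (use assms in simp)
  ultimately have co: "coprime x (int M)" unfolding int_M by simp
  have x0: "x \<ge> 0" using x(1) by (simp add: zmod_def)
  have "int p dvd int M" unfolding int_M by simp
  \<comment> \<open>Since \<open>M > 1\<close>, a unit cannot be represented by 0;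
    \<open>tiling_dilate\<close> requires a positive factor.\<close>
  then have "\<not> int M dvd 1" using primes(1) by (metis dvd_trans not_prime_unit prime_nat_int_transfer)
  then have "x \<noteq> 0" using co by auto
  then have "nat x > 0" using x0 by simp
  moreover have "coprime (nat x) M" using co x0 by (metis coprime_int_iff int_nat_eq)
  ultimately show thesis using that[of "nat x"] x x0 by simp
qed

text \<open>\<open>cover\<close> is the tiling with the dilate of \<open>B\<close> by a unit having
  the three given residues. For \<open>div_disjoint\<close>, equal gcds supply a unit
  \<open>u\<close> such that \<open>a + u * b'\<close> and \<open>a' + u * b\<close> agree modulo
  \<open>M\<close>, and uniqueness in the tiling with that dilate finishes.\<close>

lemma dilation_tiling:
  assumes t: "tiling M A B" and card: "card A = p * q * r"
  shows "dilation_tiling (int p) (int q) (int r) m A B"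
proof
  have tt: "A \<subseteq> zmod M" "B \<subseteq> zmod M" "card A * card B = M" using t tiling_iff_cover[OF pos(4)] by auto
  show "prime (int p)" "prime (int q)" "prime (int r)" using primes by auto
  show "int p \<noteq> int q" "int p \<noteq> int r" "int q \<noteq> int r" using distinct by auto
  have "(p * q * r) * card B = (p * q * r) * (p ^ m * q * r)"
    using tt(3) unfolding card M_eq by (simp only: power2_eq_square power_Suc mult.assoc mult.commute mult.left_commute)
  moreover have "p * q * r \<noteq> 0" using pos by simp
  ultimately have cB: "card B = p ^ m * q * r" using mult_left_cancel by blast
  then show "card B = nat (int p ^ m * int q * int r)" by (simp add: nat_mult_distrib flip: of_nat_power of_nat_mult)
  have "card B > 0" using cB pos by simp
  then show "finite B" "B \<noteq> {}" using card_gt_0_iff by blast+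
  note dil = tiling_dilate[OF t pos(4)]
  show "\<exists>z\<in>A. \<exists>b'\<in>B. P dvd x1 - z - \<rho>1 * (b' - b) \<and> Q dvd x2 - z - \<rho>2 * (b' - b) \<and> R dvd x3 - z - \<rho>3 * (b' - b)"
    if b: "b \<in> B" and \<rho>: "coprime \<rho>1 (int p)" "coprime \<rho>2 (int q)" "coprime \<rho>3 (int r)" for b \<rho>1 \<rho>2 \<rho>3 x1 x2 x3
  proof -
    obtain u where u: "u > 0" "coprime u M" "P dvd int u - \<rho>1" "Q dvd int u - \<rho>2" "R dvd int u - \<rho>3"
      by (rule coprime_unit[OF \<rho>])
    obtain x where x: "P dvd x - x1" "Q dvd x - x2" "R dvd x - x3" using crt by blast
    have "(x + int u * b) mod int M \<in> zmod M" using pos by (simp add: zmod_def)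
    then obtain z c where z: "z \<in> A" "c \<in> dilate M u B" "(z + c) mod int M = (x + int u * b) mod int M"
      using dil[OF u(1,2)] unfolding tiling_iff_cover[OF pos(4)] by blast
    then obtain b' where b': "b' \<in> B" "c = int u * b' mod int M" by (auto simp: dilate_def)
    have "(z + int u * b') mod int M = (x + int u * b) mod int M"
      using z(3) unfolding b'(2) by (simp add: mod_add_right_eq)
    then have "int M dvd (z + int u * b') - (x + int u * b)" by (simp add: mod_eq_dvd_iff)
    then have "int M dvd - ((z + int u * b') - (x + int u * b))" by (simp only: dvd_minus_iff)
    then have "int M dvd x - z - int u * (b' - b)" by (simp add: algebra_simps)
    then have d: "P dvd x - z - int u * (b' - b)" "Q dvd x - z - int u * (b' - b)" "R dvd x - z - int u * (b' - b)"
      by (auto simp: M_dvd_iff)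
    have conv: "k dvd y - z - \<rho> * (b' - b)"
      if "k dvd x - z - int u * (b' - b)" "k dvd x - y" "k dvd int u - \<rho>" for k y \<rho>
    proof -
      have "k dvd (x - z - int u * (b' - b)) - (x - y) + (int u - \<rho>) * (b' - b)"
        by (intro dvd_add dvd_diff dvd_mult2 that)
      then show ?thesis by (simp add: algebra_simps)
    qed
    show ?thesis using z(1) b'(1) conv[OF d(1) x(1) u(3)] conv[OF d(2) x(2) u(4)] conv[OF d(3) x(3) u(5)] by blast
  qed
  show "a = a' \<and> b = b'"
    if a: "a \<in> A" "a' \<in> A" and b: "b \<in> B" "b' \<in> B" and g: "gcd (a - a') P = gcd (b - b') P"
      "gcd (a - a') Q = gcd (b - b') Q" "gcd (a - a') R = gcd (b - b') R" for a a' b b'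
  proof -
    obtain \<rho>1 where 1: "coprime \<rho>1 (int p)" "P dvd (a - a') - \<rho>1 * (b - b')"
      using unit_ratio_prime_power[of "int p" "a - a'" "Suc m" "b - b'"] g(1) primes by (auto simp: mult.commute)
    obtain \<rho>2 where 2: "coprime \<rho>2 (int q)" "Q dvd (a - a') - \<rho>2 * (b - b')"
      using unit_ratio_prime_power[of "int q" "a - a'" 2 "b - b'"] g(2) primes by (auto simp: power2_eq_square)
    obtain \<rho>3 where 3: "coprime \<rho>3 (int r)" "R dvd (a - a') - \<rho>3 * (b - b')"
      using unit_ratio_prime_power[of "int r" "a - a'" 2 "b - b'"] g(3) primes by (auto simp: power2_eq_square)
    obtain u where u: "u > 0" "coprime u M" "P dvd int u - \<rho>1" "Q dvd int u - \<rho>2" "R dvd int u - \<rho>3"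
      by (rule coprime_unit[OF 1(1) 2(1) 3(1)])
    have conv: "k dvd (a + int u * b') - (a' + int u * b)"
      if "k dvd (a - a') - \<rho> * (b - b')" "k dvd int u - \<rho>" for k \<rho>
    proof -
      have "k dvd ((a - a') - \<rho> * (b - b')) - (int u - \<rho>) * (b - b')" by (intro dvd_diff dvd_mult2 that)
      then show ?thesis by (simp add: algebra_simps)
    qed
    have "int M dvd (a + int u * b') - (a' + int u * b)"
      using conv[OF 1(2) u(3)] conv[OF 2(2) u(4)] conv[OF 3(2) u(5)] by (simp add: M_dvd_iff)
    then have "(a + int u * b') mod int M = (a' + int u * b) mod int M" by (simp add: mod_eq_dvd_iff)
    then have e: "(a + int u * b' mod int M) mod int M = (a' + int u * b mod int M) mod int M"
      by (simp add: mod_add_right_eq)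
    have bij: "inj_on (\<lambda>(a, b). (a + b) mod int M) (A \<times> dilate M u B)"
      using dil[OF u(1,2)] by (auto simp: tiling_def bij_betw_def)
    have mem: "(a, int u * b' mod int M) \<in> A \<times> dilate M u B" "(a', int u * b mod int M) \<in> A \<times> dilate M u B"
      using a b by (auto simp: dilate_def)
    have "(a, int u * b' mod int M) = (a', int u * b mod int M)"
      by (rule inj_onD[OF bij _ mem]) (use e in simp)
    then have aa: "a = a'" and ub: "int u * b' mod int M = int u * b mod int M" by auto
    have "int M dvd int u * (b' - b)" using ub by (simp add: mod_eq_dvd_iff algebra_simps)
    moreover have "coprime (int M) (int u)" using u(2) by (simp add: coprime_commute)
    ultimately have "int M dvd b' - b" by (simp add: coprime_dvd_mult_right_iff)
    then have "b' = b" using zmod_eqI b tt(2) unfolding M_dvd_iff by blast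
    then show ?thesis using aa by simp
  qed
qed

lemma M_div: "int (M div q) = P * int q * R" "int (M div p) = int p ^ m * Q * R" "int (M div q\<^sup>2) = P * R"
proof -
  have "M = q * (p ^ Suc m * q * r\<^sup>2)" "M = p * (p ^ m * q\<^sup>2 * r\<^sup>2)" "M = q\<^sup>2 * (p ^ Suc m * r\<^sup>2)"
    unfolding M_eq by (simp_all add: power2_eq_square)
  then have "M div q = p ^ Suc m * q * r\<^sup>2" "M div p = p ^ m * q\<^sup>2 * r\<^sup>2" "M div q\<^sup>2 = p ^ Suc m * r\<^sup>2"
    using pos by (metis nonzero_mult_div_cancel_left less_numeral_extra(3) power_not_zero)+
  then show "int (M div q) = P * int q * R" "int (M div p) = int p ^ m * Q * R" "int (M div q\<^sup>2) = P * R"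
    by (simp_all add: power2_eq_square)
qed

text \<open>Passage to coordinates: multiples of \<open>M div q\<close> vanish modulo
  \<open>P\<close> and \<open>R\<close> and run through the multiples of \<open>q\<close> modulo
  \<open>Q\<close>.\<close>

lemma in_fiber_at:
  "y \<in> fiber_at M q x \<longleftrightarrow> y \<in> zmod M \<and> P dvd y - x \<and> int q dvd y - x \<and> R dvd y - x"
proof
  assume "y \<in> fiber_at M q x"
  then obtain k where y: "y = (x + int (k * (M div q))) mod int M"
    by (auto simp: fiber_at_def sumset_def fiber_def)
  have "int M dvd y - (x + int (k * (M div q)))" unfolding y by (metis mod_eq_dvd_iff mod_mod_trivial)
  then have d: "P dvd y - (x + int (k * (M div q)))" "Q dvd y - (x + int (k * (M div q)))" "R dvd y - (x + int (k * (M div q)))"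
    unfolding M_dvd_iff by auto
  have e: "d dvd y - x" if "d dvd y - (x + int (k * (M div q)))" "d dvd int (M div q)" for d :: int
  proof -
    have "d dvd y - (x + int (k * (M div q))) + int k * int (M div q)" by (intro dvd_add that(1) dvd_mult that(2))
    then show ?thesis by simp
  qed
  show "y \<in> zmod M \<and> P dvd y - x \<and> int q dvd y - x \<and> R dvd y - x"
  proof (intro conjI)
    show "y \<in> zmod M" using y pos by (simp add: zmod_def)
    show "P dvd y - x" by (rule e[OF d(1)]) (simp add: M_div)
    show "int q dvd y - x" by (rule e[OF dvd_mult_left[OF d(2)]]) (simp add: M_div)
    show "R dvd y - x" by (rule e[OF d(3)]) (simp add: M_div)
  qed
next
  assume y: "y \<in> zmod M \<and> P dvd y - x \<and> int q dvd y - x \<and> R dvd y - x"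
  have "coprime P (int q)" "coprime (P * int q) R" using coprimes by simp_all
  then have "P * int q * R dvd y - x" using y by (meson divides_mult)
  then obtain t where t: "y - x = int (M div q) * t" unfolding M_div by (auto elim: dvdE)
  define k where "k = nat (t mod int q)"
  have k: "k < q" "int k = t mod int q" using pos unfolding k_def by (auto simp: nat_less_iff)
  have "int q dvd t - int k" unfolding k(2) by (metis dvd_minus_mod)
  then have "int (M div q) * int q dvd int (M div q) * (t - int k)" by (intro mult_dvd_mono) auto
  moreover have "int (M div q) * int q = int M" unfolding M_div int_M by simp
  moreover have "int (M div q) * (t - int k) = y - (x + int (k * (M div q)))"
    using t by (simp add: algebra_simps)
  ultimately have "y mod int M = (x + int (k * (M div q))) mod int M" by (simp add: mod_eq_dvd_iff)
  then have "y = (x + int (k * (M div q))) mod int M" using y by (simp add: zmod_def)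
  then show "y \<in> fiber_at M q x" using k(1) by (auto simp: fiber_at_def sumset_def fiber_def)
qed

lemma in_plane_at:
  "y \<in> plane_at M q r x \<longleftrightarrow> y \<in> zmod M \<and> P dvd y - x \<and> int q dvd y - x \<and> int r dvd y - x"
proof -
  interpret sw: three_primes p r q m M by (rule swapped)
  have eq: "y \<in> plane_at M q r x \<longleftrightarrow> (\<exists>s\<in>fiber_at M q x. y \<in> fiber_at M r s)"
    by (auto simp: plane_at_def fiber_at_def sumset_def)
  show ?thesis unfolding eq in_fiber_at sw.in_fiber_at
  proof
    assume "\<exists>s\<in>fiber_at M q x. y \<in> zmod M \<and> P dvd y - s \<and> int r dvd y - s \<and> Q dvd y - s"
    then obtain s where s: "P dvd s - x" "int q dvd s - x" "R dvd s - x"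
      "y \<in> zmod M" "P dvd y - s" "int r dvd y - s" "Q dvd y - s" by (auto simp: in_fiber_at)
    then show "y \<in> zmod M \<and> P dvd y - x \<and> int q dvd y - x \<and> int r dvd y - x"
      using dvd_tr[OF s(5,1)] dvd_tr[OF dvd_mult_left[OF s(7)] s(2)] dvd_tr[OF s(6) dvd_mult_left[OF s(3)]] by blast
  next
    assume y: "y \<in> zmod M \<and> P dvd y - x \<and> int q dvd y - x \<and> int r dvd y - x"
    obtain s where s: "s \<in> zmod M" "P dvd s - x" "Q dvd s - y" "R dvd s - x" using crt by blast
    have "int q dvd s - x" using dvd_tr[OF dvd_mult_left[OF s(3)]] y by blast
    moreover have "P dvd y - s" using dvd_tr[OF _ dvd_sym[OF s(2)]] y by blast
    moreover have "int r dvd y - s" using dvd_tr[OF _ dvd_sym[OF dvd_mult_left[OF s(4)]]] y by blast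
    ultimately show "\<exists>s\<in>fiber_at M q x. y \<in> zmod M \<and> P dvd y - s \<and> int r dvd y - s \<and> Q dvd y - s"
      using s y dvd_sym[OF s(3)] by (intro bexI[of _ s]) (auto simp: in_fiber_at)
  qed
qed

lemma fibered_iff:
  assumes "S \<subseteq> zmod M"
  shows "fibered M q S \<longleftrightarrow> (\<forall>z\<in>S. fiber_at M q z \<subseteq> S)"
proof
  assume "fibered M q S"
  then obtain S' where S': "S' \<subseteq> S" "S = sumset M S' (fiber M q)" by (auto simp: fibered_def)
  have S: "S = (\<Union>s\<in>S'. fiber_at M q s)" unfolding S'(2) by (auto simp: sumset_def fiber_at_def)
  show "\<forall>z\<in>S. fiber_at M q z \<subseteq> S"
  proof (intro ballI subsetI)
    fix z y assume z: "z \<in> S" and y: "y \<in> fiber_at M q z"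
    obtain s where s: "s \<in> S'" "z \<in> fiber_at M q s" using z S by blast
    have "y \<in> fiber_at M q s" using s(2) y unfolding in_fiber_at by (blast intro: dvd_tr)
    then show "y \<in> S" using S s by blast
  qed
next
  assume h: "\<forall>z\<in>S. fiber_at M q z \<subseteq> S"
  have "z \<in> fiber_at M q z" if "z \<in> S" for z using that assms by (auto simp: in_fiber_at)
  then have "S = (\<Union>z\<in>S. fiber_at M q z)" using h by blast
  also have "\<dots> = sumset M S (fiber M q)" by (auto simp: sumset_def fiber_at_def)
  finally show "fibered M q S" unfolding fibered_def by blast
qed

lemma gcd_shift:
  assumes "P dvd d" "R dvd d" "\<not> int q dvd d"
  shows "gcd d (int M) = int (M div q\<^sup>2)"
proof -
  have "P * R dvd d" by (rule divides_mult[OF assms(1,2) coprime_PQR(3)])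
  then obtain t where t: "d = P * R * t" by (auto elim: dvdE)
  have "\<not> int q dvd t" using assms(3) t by auto
  then have "coprime (int q) t" using primes(2) by (intro prime_imp_coprime) auto
  then have "coprime t Q" by (simp add: coprime_commute)
  have "gcd d (int M) = gcd (P * R * t) (P * R * Q)" unfolding t int_M by (simp add: mult.assoc mult.left_commute mult.commute)
  also have "\<dots> = P * R * gcd t Q" by (simp add: gcd_mult_left abs_mult)
  also have "\<dots> = P * R" using \<open>coprime t Q\<close> by simp
  finally show ?thesis by (simp add: M_div)
qed

lemma fiber_translate:
  "bij_betw (\<lambda>y. (y + (x' - x)) mod int M) (fiber_at M q x) (fiber_at M q x')"
proof -
  have maps: "(y + d) mod int M \<in> fiber_at M q (x + d)" if y: "y \<in> fiber_at M q x" for x y d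
  proof -
    have "int M dvd (y + d) mod int M - (y + d)" by (metis mod_eq_dvd_iff mod_mod_trivial)
    moreover have "(y + d) - (x + d) = y - x" by simp
    ultimately have "P dvd (y + d) mod int M - (x + d)" "int q dvd (y + d) mod int M - (x + d)"
      "R dvd (y + d) mod int M - (x + d)"
      using y unfolding M_dvd_iff in_fiber_at by (metis dvd_tr dvd_mult_left)+
    then show ?thesis using pos by (simp add: in_fiber_at zmod_def)
  qed
  have inv: "((y + d) mod int M + - d) mod int M = y" if "y \<in> fiber_at M q x" for x y d
    using that by (simp add: mod_diff_left_eq in_fiber_at zmod_def)
  show ?thesis
  proof (rule bij_betw_byWitness[where f' = "\<lambda>y. (y + - (x' - x)) mod int M"])
    show "\<forall>y\<in>fiber_at M q x. ((y + (x' - x)) mod int M + - (x' - x)) mod int M = y"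
      using inv by blast
    show "\<forall>y\<in>fiber_at M q x'. ((y + - (x' - x)) mod int M + (x' - x)) mod int M = y"
      using inv[of _ x' "- (x' - x)"] by simp
    show "(\<lambda>y. (y + (x' - x)) mod int M) ` fiber_at M q x \<subseteq> fiber_at M q x'"
      using maps[of _ x "x' - x"] by auto
    show "(\<lambda>y. (y + - (x' - x)) mod int M) ` fiber_at M q x' \<subseteq> fiber_at M q x"
      using maps[of _ x' "- (x' - x)"] by auto
  qed
qed

end

section \<open>Fiber shifts that preserve the tiling, and filling planes by them\<close>

locale shift_setting = three_primes +
  fixes B :: "int set"
  assumes B_row_q: "\<And>b w. b \<in> B \<Longrightarrow> \<exists>b'\<in>B. P dvd b' - b \<and> R dvd b' - b \<and> int q dvd b' - w"
    and B_row_r: "\<And>b w. b \<in> B \<Longrightarrow> \<exists>b'\<in>B. P dvd b' - b \<and> Q dvd b' - b \<and> int r dvd b' - w"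
begin

lemma swapped_setting: "shift_setting p r q m M B"
proof -
  interpret sw: three_primes p r q m M by (rule swapped)
  show ?thesis by unfold_locales (use B_row_q B_row_r in blast)+
qed

text \<open>A sum \<open>s + b\<close> with \<open>s\<close> in the old fiber is rewritten with the
  element \<open>b'\<close> of the \<open>q\<close>-row of \<open>b\<close> that satisfies
  \<open>b' = b + x - x'\<close> modulo \<open>q\<close>; then \<open>s + b - b'\<close> lies in the
  new fiber.\<close>

lemma fiber_shift_q:
  assumes t: "tiling M S B" and x: "x \<in> zmod M" "x' \<in> zmod M" and sub: "fiber_at M q x \<subseteq> S"
    and d: "P dvd x - x'" "R dvd x - x'" "\<not> int q dvd x - x'"
  shows "fiber_shift M {q, r} B S ((S - fiber_at M q x) \<union> fiber_at M q x')"
    "tiling M ((S - fiber_at M q x) \<union> fiber_at M q x') B"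
proof -
  let ?S = "(S - fiber_at M q x) \<union> fiber_at M q x'"
  have tt: "S \<subseteq> zmod M" "B \<subseteq> zmod M" "card S * card B = M"
    and cov: "\<And>y. y \<in> zmod M \<Longrightarrow> \<exists>s\<in>S. \<exists>b\<in>B. (s + b) mod int M = y"
    using t unfolding tiling_iff_cover[OF pos(4)] by auto
  have fin: "finite (zmod M)" by (simp add: zmod_def)
  have finS: "finite S" using tt(1) fin finite_subset by blast
  have sub': "?S \<subseteq> zmod M" using tt(1) by (auto simp: in_fiber_at)
  have cover: "\<exists>s\<in>?S. \<exists>b\<in>B. (s + b) mod int M = y" if y: "y \<in> zmod M" for y
  proof -
    obtain s b where s: "s \<in> S" "b \<in> B" "(s + b) mod int M = y" using cov[OF y] by blast
    show ?thesis
    proof (cases "s \<in> fiber_at M q x")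
      case False
      then show ?thesis using s by blast
    next
      case True
      obtain b' where b': "b' \<in> B" "P dvd b' - b" "R dvd b' - b" "int q dvd b' - (b + x - x')"
        using B_row_q[OF s(2)] by blast
      define s' where "s' = (y - b') mod int M"
      have sM: "int M dvd s' - (y - b')" unfolding s'_def by (metis mod_eq_dvd_iff mod_mod_trivial)
      have "int M dvd y - (s + b)" using s(3) by (metis mod_eq_dvd_iff mod_mod_trivial)
      with sM have "int M dvd (s' - (y - b')) + (y - (s + b))" by (rule dvd_add)
      then have e: "int M dvd s' - (s + b - b')" by (simp add: algebra_simps)
      have conv: "k dvd s' - x'" if "k dvd s' - (s + b - b')" "k dvd s - x" "k dvd b' - (b + x - x')" for k :: int
      proof -
        have "k dvd (s' - (s + b - b')) + (s - x) - (b' - (b + x - x'))" by (intro dvd_add dvd_diff that)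
        then show ?thesis by (simp add: algebra_simps)
      qed
      have conv2: "k dvd b' - (b + x - x')" if "k dvd b' - b" "k dvd x - x'" for k :: int
        using dvd_diff[OF that] by (simp add: algebra_simps)
      have "P dvd s - x" "int q dvd s - x" "R dvd s - x" using True by (auto simp: in_fiber_at)
      moreover have "P dvd s' - (s + b - b')" "R dvd s' - (s + b - b')" "Q dvd s' - (s + b - b')"
        using e by (auto simp: M_dvd_iff)
      ultimately have "P dvd s' - x'" "int q dvd s' - x'" "R dvd s' - x'"
        using conv conv2[OF b'(2) d(1)] conv2[OF b'(3) d(2)] b'(4) dvd_mult_left by blast+
      moreover have "s' \<in> zmod M" using pos unfolding s'_def by (simp add: zmod_def)
      ultimately have "s' \<in> ?S" by (simp add: in_fiber_at)
      moreover have "(s' + b') mod int M = y" unfolding s'_def using y by (simp add: mod_add_left_eq zmod_def)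
      ultimately show ?thesis using b'(1) by blast
    qed
  qed
  have finF: "finite (fiber_at M q x)" "finite (fiber_at M q x')"
    by (rule finite_subset[OF _ fin], auto simp: in_fiber_at)+
  have "card (fiber_at M q x') = card (fiber_at M q x)"
    using bij_betw_same_card[OF fiber_translate] by metis
  \<comment> \<open>Only an inequality, as the new fiber might overlap the rest of \<open>S\<close>;
    covering all of \<open>zmod M\<close> forces equality afterwards.\<close>
  then have "card ?S \<le> card S"
    using card_Un_le[of "S - fiber_at M q x" "fiber_at M q x'"] card_Diff_subset[OF finF(1) sub] card_mono[OF finS sub]
    by linarith
  then have le: "card ?S * card B \<le> M" using tt(3) by (metis mult_le_mono1)
  have finB: "finite B" using tt(2) fin finite_subset by blast
  have "zmod M \<subseteq> (\<lambda>(s, b). (s + b) mod int M) ` (?S \<times> B)" using cover by force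
  then have "card (zmod M) \<le> card (?S \<times> B)"
    using finS finF finB by (intro surj_card_le) auto
  then have "M \<le> card ?S * card B" by (simp add: card_cartesian_product zmod_def)
  then show til: "tiling M ?S B"
    unfolding tiling_iff_cover[OF pos(4)] using le sub' tt(2) cover by auto
  show "fiber_shift M {q, r} B S ?S"
    unfolding fiber_shift_def using x sub til gcd_shift[OF d] by blast
qed

text \<open>The rows are moved one at a time. The last conjunct, that nothing changes off these
  rows, keeps the unmoved rows available in the induction and later protects the other
  planes.\<close>

lemma shift_rows:
  assumes "finite W" "tiling M S B"
    and "\<And>w w'. w \<in> W \<Longrightarrow> w' \<in> W \<Longrightarrow> R dvd w - w' \<Longrightarrow> w = w'"
    and "\<And>w. w \<in> W \<Longrightarrow> \<exists>u. \<forall>v. int q dvd v - u \<longrightarrow> (\<exists>z\<in>S. P dvd z - e \<and> Q dvd z - v \<and> R dvd z - w)"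
  shows "\<exists>S'. (fiber_shift M {q, r} B)\<^sup>*\<^sup>* S S' \<and> tiling M S' B \<and>
    (\<forall>w\<in>W. \<forall>v. int q dvd v - c \<longrightarrow> (\<exists>z\<in>S'. P dvd z - e \<and> Q dvd z - v \<and> R dvd z - w)) \<and>
    (\<forall>z. (P dvd z - e \<longrightarrow> (\<forall>w\<in>W. \<not> R dvd z - w)) \<longrightarrow> (z \<in> S' \<longleftrightarrow> z \<in> S))"
  using assms
proof (induction W rule: finite_induct)
  case empty
  then show ?case by blast
next
  case (insert w W)
  have W: "w = w'" if "w \<in> W" "w' \<in> W" "R dvd w - w'" for w w'
    by (rule insert.prems(2)) (use that in auto)
  have "\<exists>S1. (fiber_shift M {q, r} B)\<^sup>*\<^sup>* S S1 \<and> tiling M S1 B \<and>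
    (\<forall>w\<in>W. \<forall>v. int q dvd v - c \<longrightarrow> (\<exists>z\<in>S1. P dvd z - e \<and> Q dvd z - v \<and> R dvd z - w)) \<and>
    (\<forall>z. (P dvd z - e \<longrightarrow> (\<forall>w\<in>W. \<not> R dvd z - w)) \<longrightarrow> (z \<in> S1 \<longleftrightarrow> z \<in> S))"
    by (rule insert.IH[OF insert.prems(1)]) (erule (2) W, rule insert.prems(3), erule insertI2)
  then obtain S1 where S1: "(fiber_shift M {q, r} B)\<^sup>*\<^sup>* S S1" "tiling M S1 B"
    "\<forall>w\<in>W. \<forall>v. int q dvd v - c \<longrightarrow> (\<exists>z\<in>S1. P dvd z - e \<and> Q dvd z - v \<and> R dvd z - w)"
    "\<forall>z. (P dvd z - e \<longrightarrow> (\<forall>w\<in>W. \<not> R dvd z - w)) \<longrightarrow> (z \<in> S1 \<longleftrightarrow> z \<in> S)"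
    by (elim exE conjE) (rule that; assumption)
  obtain u where u: "\<And>v. int q dvd v - u \<Longrightarrow> \<exists>z\<in>S. P dvd z - e \<and> Q dvd z - v \<and> R dvd z - w"
    using insert.prems(3) by blast
  have new: "\<not> R dvd z - w'" if "R dvd z - w" "w' \<in> W" for z w'
    using insert.prems(2)[of w w'] insert.hyps(2) that by (metis dvd_sym dvd_tr insertCI)
  have u1: "\<exists>z\<in>S1. P dvd z - e \<and> Q dvd z - v \<and> R dvd z - w" if v: "int q dvd v - u" for v
  proof -
    obtain z where z: "z \<in> S" "P dvd z - e" "Q dvd z - v" "R dvd z - w" using u[OF v] by blast
    then have "z \<in> S1" using S1(4)[rule_format, of z] new[of z] by blast
    then show ?thesis using z by blast
  qed
  show ?case
  proof (cases "int q dvd u - c")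
    \<comment> \<open>The row already lies in the target class, and a shift within the class would
      not have the required gcd.\<close>
    case True
    then have "\<exists>z\<in>S1. P dvd z - e \<and> Q dvd z - v \<and> R dvd z - w" if "int q dvd v - c" for v
      using u1 that by (metis dvd_sym dvd_tr)
    then show ?thesis using S1 by (intro exI[of _ S1]) auto
  next
    case False
    obtain x where x: "x \<in> zmod M" "P dvd x - e" "Q dvd x - u" "R dvd x - w" using crt by blast
    obtain x' where x': "x' \<in> zmod M" "P dvd x' - e" "Q dvd x' - c" "R dvd x' - w" using crt by blast
    have S1z: "S1 \<subseteq> zmod M" using S1(2) by (simp add: tiling_def)
    have sub: "fiber_at M q x \<subseteq> S1"
    proof
      fix y assume y: "y \<in> fiber_at M q x"
      have "int q dvd y - u" using y dvd_mult_left[OF x(3)] unfolding in_fiber_at by (blast intro: dvd_tr)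
      then obtain z where z: "z \<in> S1" "P dvd z - e" "Q dvd z - y" "R dvd z - w" using u1 by blast
      have "z = y"
      proof (rule zmod_eqI)
        show "P dvd z - y" "R dvd z - y" using y z x unfolding in_fiber_at by (metis dvd_sym dvd_tr)+
      qed (use y z S1z in \<open>auto simp: in_fiber_at\<close>)
      then show "y \<in> S1" using z by simp
    qed
    have "P dvd x - x'" "R dvd x - x'" using x x' by (metis dvd_sym dvd_tr)+
    moreover have "\<not> int q dvd x - x'"
    proof
      assume "int q dvd x - x'"
      then have "int q dvd x - c" using dvd_mult_left[OF x'(3)] by (rule dvd_tr)
      then show False using False dvd_mult_left[OF x(3)] by (metis dvd_sym dvd_tr)
    qed
    ultimately have sh: "fiber_shift M {q, r} B S1 ((S1 - fiber_at M q x) \<union> fiber_at M q x')"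
      "tiling M ((S1 - fiber_at M q x) \<union> fiber_at M q x') B"
      using fiber_shift_q[OF S1(2) x(1) x'(1) sub] by blast+
    let ?S = "(S1 - fiber_at M q x) \<union> fiber_at M q x'"
    have row: "P dvd z - e \<and> R dvd z - w" if "z \<in> fiber_at M q x \<or> z \<in> fiber_at M q x'" for z
      using that x x' unfolding in_fiber_at by (metis dvd_tr)
    have full: "\<exists>z\<in>?S. P dvd z - e \<and> Q dvd z - v \<and> R dvd z - w'" if w': "w' \<in> insert w W" and v: "int q dvd v - c" for w' v
    proof (cases "w' = w")
      case True
      obtain z where z: "z \<in> zmod M" "P dvd z - e" "Q dvd z - v" "R dvd z - w" using crt by blast
      have "int q dvd z - x'" using dvd_mult_left[OF z(3)] v dvd_mult_left[OF x'(3)] by (metis dvd_sym dvd_tr)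
      moreover have "P dvd z - x'" "R dvd z - x'" using z x' by (metis dvd_sym dvd_tr)+
      ultimately have "z \<in> ?S" using z by (simp add: in_fiber_at)
      then show ?thesis using z True by blast
    next
      case False
      then have "w' \<in> W" using w' by blast
      then obtain z where z: "z \<in> S1" "P dvd z - e" "Q dvd z - v" "R dvd z - w'" using S1(3) v by blast
      have "z \<notin> fiber_at M q x" using row new[of z w'] \<open>w' \<in> W\<close> z(4) by blast
      then show ?thesis using z by blast
    qed
    have same: "z \<in> ?S \<longleftrightarrow> z \<in> S" if "P dvd z - e \<longrightarrow> (\<forall>w\<in>insert w W. \<not> R dvd z - w)" for z
      using that row[of z] S1(4)[rule_format, of z] by blast
    have "(fiber_shift M {q, r} B)\<^sup>*\<^sup>* S ?S" using S1(1) sh(1) by (rule rtranclp.rtrancl_into_rtrancl)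
    then show ?thesis using sh(2) full same by blast
  qed
qed

abbreviation full_plane :: "int \<Rightarrow> int \<Rightarrow> int set \<Rightarrow> bool" where
  "full_plane x0 e S \<equiv> \<forall>v w. int q dvd v - x0 \<longrightarrow> int r dvd w - x0 \<longrightarrow>
     (\<exists>z\<in>S. P dvd z - e \<and> Q dvd z - v \<and> R dvd z - w)"

lemma residue_set:
  fixes k :: nat
  assumes "k > 0"
  shows "finite {w \<in> {0..<int k * int k}. int k dvd w - c}"
    and "\<And>w w'. w \<in> {w \<in> {0..<int k * int k}. int k dvd w - c} \<Longrightarrow> w' \<in> {w \<in> {0..<int k * int k}. int k dvd w - c} \<Longrightarrow>
      int k * int k dvd w - w' \<Longrightarrow> w = w'"
    and "\<And>w. int k dvd w - c \<Longrightarrow> \<exists>w'\<in>{w \<in> {0..<int k * int k}. int k dvd w - c}. int k * int k dvd w - w'"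
proof -
  show "finite {w \<in> {0..<int k * int k}. int k dvd w - c}" by (rule finite_subset[of _ "{0..<int k * int k}"]) auto
  show "w = w'" if "w \<in> {w \<in> {0..<int k * int k}. int k dvd w - c}" "w' \<in> {w \<in> {0..<int k * int k}. int k dvd w - c}"
      "int k * int k dvd w - w'" for w w'
  proof -
    have "w mod (int k * int k) = w' mod (int k * int k)" using that(3) by (simp add: mod_eq_dvd_iff)
    then show ?thesis using that(1,2) by simp
  qed
  show "\<exists>w'\<in>{w \<in> {0..<int k * int k}. int k dvd w - c}. int k * int k dvd w - w'" if w: "int k dvd w - c" for w
  proof -
    let ?w = "w mod (int k * int k)"
    have d: "int k * int k dvd ?w - w" by (metis mod_eq_dvd_iff mod_mod_trivial)
    then have "int k dvd ?w - c" using w dvd_mult_left by (metis dvd_tr)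
    moreover have "?w \<in> {0..<int k * int k}" using assms by simp
    ultimately show ?thesis using dvd_sym[OF d] by blast
  qed
qed

text \<open>A plane that consists of fibers in the \<open>q\<close> direction is filled in two rounds: each fiber
  is moved along its own direction into the residue class of \<open>x0\<close> modulo \<open>q\<close>, and then the
  resulting fibers in the \<open>r\<close> direction are moved into the class of \<open>x0\<close> modulo \<open>r\<close>.\<close>

lemma fill_plane_rows:
  assumes t: "tiling M S B"
    and rows: "\<And>w. int r dvd w - c \<Longrightarrow> \<exists>u. \<forall>v. int q dvd v - u \<longrightarrow> (\<exists>z\<in>S. P dvd z - e \<and> R dvd z - w \<and> Q dvd z - v)"
  shows "\<exists>S'. (fiber_shift M {q, r} B)\<^sup>*\<^sup>* S S' \<and> tiling M S' B \<and> full_plane x0 e S' \<and>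
    (\<forall>z. \<not> P dvd z - e \<longrightarrow> (z \<in> S' \<longleftrightarrow> z \<in> S))"
proof -
  interpret sw: shift_setting p r q m M B by (rule swapped_setting)
  define W where "W = {w \<in> {0..<R}. int r dvd w - c}"
  note W = residue_set[OF pos(3), where c = c, folded W_def]
  have "\<exists>u. \<forall>v. int q dvd v - u \<longrightarrow> (\<exists>z\<in>S. P dvd z - e \<and> Q dvd z - v \<and> R dvd z - w)" if "w \<in> W" for w
    using rows[of w] that unfolding W_def by blast
  from shift_rows[OF W(1) t W(2) this, of x0]
  obtain S1 where S1: "(fiber_shift M {q, r} B)\<^sup>*\<^sup>* S S1" "tiling M S1 B"
    "\<And>w v. w \<in> W \<Longrightarrow> int q dvd v - x0 \<Longrightarrow> \<exists>z\<in>S1. P dvd z - e \<and> Q dvd z - v \<and> R dvd z - w"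
    "\<And>z. \<not> P dvd z - e \<Longrightarrow> z \<in> S1 \<longleftrightarrow> z \<in> S"
    by blast
  have all: "\<exists>z\<in>S1. P dvd z - e \<and> Q dvd z - v \<and> R dvd z - w" if w: "int r dvd w - c" and v: "int q dvd v - x0" for w v
  proof -
    obtain w' where w': "w' \<in> W" "R dvd w - w'" using W(3)[OF w] by blast
    obtain z where "z \<in> S1" "P dvd z - e" "Q dvd z - v" "R dvd z - w'" using S1(3)[OF w'(1) v] by blast
    then show ?thesis using dvd_tr[OF _ dvd_sym[OF w'(2)]] by blast
  qed
  define V where "V = {w \<in> {0..<Q}. int q dvd w - x0}"
  note V = residue_set[OF pos(2), where c = x0, folded V_def]
  have "\<exists>u. \<forall>v. int r dvd v - u \<longrightarrow> (\<exists>z\<in>S1. P dvd z - e \<and> R dvd z - v \<and> Q dvd z - w)" if "w \<in> V" for w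
    using all[of _ w] that unfolding V_def by blast
  from sw.shift_rows[OF V(1) S1(2) V(2) this, of x0]
  obtain S2 where S2: "(fiber_shift M {r, q} B)\<^sup>*\<^sup>* S1 S2" "tiling M S2 B"
    "\<And>w v. w \<in> V \<Longrightarrow> int r dvd v - x0 \<Longrightarrow> \<exists>z\<in>S2. P dvd z - e \<and> R dvd z - v \<and> Q dvd z - w"
    "\<And>z. \<not> P dvd z - e \<Longrightarrow> z \<in> S2 \<longleftrightarrow> z \<in> S1"
    by blast
  have "full_plane x0 e S2"
  proof (intro allI impI)
    fix v w assume v: "int q dvd v - x0" and w: "int r dvd w - x0"
    obtain v' where v': "v' \<in> V" "Q dvd v - v'" using V(3)[OF v] by blast
    obtain z where "z \<in> S2" "P dvd z - e" "R dvd z - w" "Q dvd z - v'" using S2(3)[OF v'(1) w] by blast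
    then show "\<exists>z\<in>S2. P dvd z - e \<and> Q dvd z - v \<and> R dvd z - w" using dvd_tr[OF _ dvd_sym[OF v'(2)]] by blast
  qed
  moreover have "(fiber_shift M {q, r} B)\<^sup>*\<^sup>* S S2"
    using S1(1) S2(1) by (simp add: insert_commute)
  ultimately show ?thesis using S1(4) S2(2,4) by blast
qed

lemma fill_plane_columns:
  assumes t: "tiling M S B"
    and cols: "\<And>w. int q dvd w - c \<Longrightarrow> \<exists>u. \<forall>v. int r dvd v - u \<longrightarrow> (\<exists>z\<in>S. P dvd z - e \<and> Q dvd z - w \<and> R dvd z - v)"
  shows "\<exists>S'. (fiber_shift M {q, r} B)\<^sup>*\<^sup>* S S' \<and> tiling M S' B \<and> full_plane x0 e S' \<and>
    (\<forall>z. \<not> P dvd z - e \<longrightarrow> (z \<in> S' \<longleftrightarrow> z \<in> S))"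
proof -
  interpret sw: shift_setting p r q m M B by (rule swapped_setting)
  have "\<exists>S'. (fiber_shift M {r, q} B)\<^sup>*\<^sup>* S S' \<and> tiling M S' B \<and> sw.full_plane x0 e S' \<and>
    (\<forall>z. \<not> P dvd z - e \<longrightarrow> (z \<in> S' \<longleftrightarrow> z \<in> S))"
    by (rule sw.fill_plane_rows[OF t]) (rule cols)
  then obtain S' where S': "(fiber_shift M {r, q} B)\<^sup>*\<^sup>* S S'" "tiling M S' B" "sw.full_plane x0 e S'"
    "\<forall>z. \<not> P dvd z - e \<longrightarrow> (z \<in> S' \<longleftrightarrow> z \<in> S)"
    by (elim exE conjE) (rule that; assumption)
  have "full_plane x0 e S'" using S'(3) by blast
  moreover have "(fiber_shift M {q, r} B)\<^sup>*\<^sup>* S S'" using S'(1) by (simp only: insert_commute)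
  ultimately show ?thesis using S'(2,4) by blast
qed

text \<open>The planes \<open>a0\<close> and \<open>a1\<close> stay full throughout, so
  \<open>plane_structure\<close> remains available at every stage; a plane that coincides with one
  of them needs no shift.\<close>

lemma fill_planes:
  assumes fin: "finite T" and t: "tiling M S B" and card: "card S = p * q * r"
    and mod_D: "\<And>b b'. b \<in> B \<Longrightarrow> b' \<in> B \<Longrightarrow> int p ^ m dvd b - b' \<Longrightarrow> int q dvd b - b' \<Longrightarrow> int r dvd b - b' \<Longrightarrow> b = b'"
    and a01: "int p ^ m dvd a0 - a1" "\<not> P dvd a0 - a1"
    and full: "full_plane x0 a0 S" "full_plane x0 a1 S"
    and T: "\<And>e. e \<in> T \<Longrightarrow> int p ^ m dvd e - a0"
  shows "\<exists>S'. (fiber_shift M {q, r} B)\<^sup>*\<^sup>* S S' \<and> tiling M S' B \<and>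
    full_plane x0 a0 S' \<and> full_plane x0 a1 S' \<and> (\<forall>e\<in>T. full_plane x0 e S')"
  using fin T
proof (induction T rule: finite_induct)
  case empty
  then show ?case using t full by blast
next
  case (insert e T)
  have cong: "full_plane x0 e' S'" if "full_plane x0 e S'" "P dvd e - e'" for e e' S'
    using that by (meson dvd_tr)
  have "\<exists>S1. (fiber_shift M {q, r} B)\<^sup>*\<^sup>* S S1 \<and> tiling M S1 B \<and>
    full_plane x0 a0 S1 \<and> full_plane x0 a1 S1 \<and> (\<forall>e\<in>T. full_plane x0 e S1)"
    by (rule insert.IH) (rule insert.prems, erule insertI2)
  then obtain S1 where S1: "(fiber_shift M {q, r} B)\<^sup>*\<^sup>* S S1" "tiling M S1 B"
    "full_plane x0 a0 S1" "full_plane x0 a1 S1" "\<forall>e\<in>T. full_plane x0 e S1"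
    by (elim exE conjE) (rule that; assumption)
  show ?case
  proof (cases "P dvd a0 - e \<or> P dvd a1 - e")
    case True
    then have "full_plane x0 e S1" using cong S1(3,4) by blast
    then show ?thesis using S1 by blast
  next
    case False
    have "card S1 * card B = card S * card B"
      using S1(2) t unfolding tiling_iff_cover[OF pos(4)] by simp
    moreover have "card B \<noteq> 0" using t pos unfolding tiling_iff_cover[OF pos(4)] by auto
    ultimately have c1: "card S1 = p * q * r" using card by simp
    \<comment> \<open>The dilation and divisor conditions are derived afresh for the current set
      \<open>S1\<close>, which tiles with the same \<open>B\<close>.\<close>
    interpret d: dilation_tiling "int p" "int q" "int r" m S1 B by (rule dilation_tiling[OF S1(2) c1])
    interpret tp: two_planes "int p" "int q" "int r" m S1 B x0 a0 a1
    proof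
      show "int p ^ m dvd a0 - a1" "\<not> P dvd a0 - a1" by (rule a01)+
      show "\<exists>z\<in>S1. P dvd z - a0 \<and> Q dvd z - v \<and> R dvd z - w"
        "\<exists>z\<in>S1. P dvd z - a1 \<and> Q dvd z - v \<and> R dvd z - w"
        if "int q dvd v - x0" "int r dvd w - x0" for v w using S1(3,4) that by blast+
    qed (use mod_D B_row_q B_row_r in auto)
    have "int p ^ m dvd e - a0" using insert.prems by blast
    then have "\<exists>S2. (fiber_shift M {q, r} B)\<^sup>*\<^sup>* S1 S2 \<and> tiling M S2 B \<and> full_plane x0 e S2 \<and>
      (\<forall>z. \<not> P dvd z - e \<longrightarrow> (z \<in> S2 \<longleftrightarrow> z \<in> S1))"
    proof (elim tp.plane_structure[THEN disjE] exE)
      fix c assume "\<forall>w. int q dvd w - c \<longrightarrow> (\<exists>v. \<forall>v'. int r dvd v' - v \<longrightarrow>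
        (\<exists>z\<in>S1. P dvd z - e \<and> Q dvd z - w \<and> R dvd z - v'))"
      then show ?thesis by (intro fill_plane_columns[OF S1(2), of c]) blast
    next
      fix c assume "\<forall>w. int r dvd w - c \<longrightarrow> (\<exists>v. \<forall>v'. int q dvd v' - v \<longrightarrow>
        (\<exists>z\<in>S1. P dvd z - e \<and> R dvd z - w \<and> Q dvd z - v'))"
      then show ?thesis by (intro fill_plane_rows[OF S1(2), of c]) blast
    qed
    then obtain S2 where S2: "(fiber_shift M {q, r} B)\<^sup>*\<^sup>* S1 S2" "tiling M S2 B" "full_plane x0 e S2"
      "\<forall>z. \<not> P dvd z - e \<longrightarrow> (z \<in> S2 \<longleftrightarrow> z \<in> S1)"
      by (elim exE conjE) (rule that; assumption)
    have keep: "full_plane x0 e' S2" if f: "full_plane x0 e' S1" and e': "\<not> P dvd e' - e" for e'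
    proof (intro allI impI)
      fix v w assume "int q dvd v - x0" "int r dvd w - x0"
      then obtain z where z: "z \<in> S1" "P dvd z - e'" "Q dvd z - v" "R dvd z - w" using f by blast
      have "\<not> P dvd z - e" using z(2) e' by (metis dvd_sym dvd_tr)
      then show "\<exists>z\<in>S2. P dvd z - e' \<and> Q dvd z - v \<and> R dvd z - w" using S2(4) z by blast
    qed
    have "full_plane x0 e' S2" if "e' \<in> insert e T" for e'
    proof (cases "P dvd e' - e")
      case True
      then show ?thesis using cong[OF S2(3)] dvd_sym by blast
    next
      case False
      then have "e' \<in> T" using that by auto
      then have "full_plane x0 e' S1" using S1(5) by blast
      then show ?thesis using keep False by blast
    qed
    moreover have "full_plane x0 a0 S2" "full_plane x0 a1 S2" using keep S1(3,4) False by blast+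
    moreover have "(fiber_shift M {q, r} B)\<^sup>*\<^sup>* S S2" using S1(1) S2(1) by (rule rtranclp_trans)
    ultimately show ?thesis using S2(2) by blast
  qed
qed

end

subsection \<open>Cyclotomic divisors\<close>

text \<open>Multiplicative order exactly \<open>s\<close>, phrased through exponents because sums of
  powers of \<open>z\<close> are compared by reducing exponents modulo \<open>s\<close>.\<close>

definition primitive_root :: "nat \<Rightarrow> complex \<Rightarrow> bool" where
  "primitive_root s z \<longleftrightarrow> (\<forall>n. z ^ n = 1 \<longleftrightarrow> s dvd n)"

lemma cis_eq_1_iff_dvd:
  assumes "s > 0"
  shows "cis (2 * pi * real_of_int d / real s) = 1 \<longleftrightarrow> int s dvd d"
proof
  assume "cis (2 * pi * real_of_int d / real s) = 1"
  then have "cos (2 * pi * real_of_int d / real s) = 1" by (metis cis.sel(1) one_complex.sel(1))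
  then obtain n :: int where "2 * pi * real_of_int d / real s = real_of_int n * 2 * pi"
    using cos_one_2pi_int by blast
  then have "real_of_int d = real_of_int n * real s" using assms by (simp add: field_simps)
  then have "d = n * int s" by (metis of_int_eq_iff of_int_mult of_int_of_nat_eq)
  then show "int s dvd d" by simp
next
  assume "int s dvd d"
  then obtain n where "d = int s * n" by (auto elim: dvdE)
  then have "2 * pi * real_of_int d / real s = 2 * pi * real_of_int n" using assms by simp
  then show "cis (2 * pi * real_of_int d / real s) = 1" by (simp add: cis.ctr complex_eq_iff)
qed

lemma cis_power: "cis (2 * pi * real_of_int d / real s) ^ n = cis (2 * pi * real_of_int (int n * d) / real s)"
  by (simp add: DeMoivre mult.assoc mult.left_commute)

lemma primitive_root_cis:
  assumes "s > 0" "coprime k s"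
  shows "primitive_root s (cis (2 * pi * real k / real s))"
  unfolding primitive_root_def
proof
  fix n
  have "cis (2 * pi * real k / real s) ^ n = cis (2 * pi * real_of_int (int n * int k) / real s)"
    using cis_power[of "int k" s n] by simp
  also have "\<dots> = 1 \<longleftrightarrow> int s dvd int (n * k)" using cis_eq_1_iff_dvd[OF assms(1), of "int n * int k"] by simp
  also have "\<dots> \<longleftrightarrow> s dvd n * k" by (simp only: int_dvd_int_iff)
  also have "\<dots> \<longleftrightarrow> s dvd n" using assms(2) by (simp add: coprime_commute coprime_dvd_mult_left_iff)
  finally show "cis (2 * pi * real k / real s) ^ n = 1 \<longleftrightarrow> s dvd n" .
qed

lemma poly_mask: "poly (mask_poly S) z = (\<Sum>y\<in>S. z ^ nat y)"
  by (simp add: mask_poly_def poly_sum poly_monom)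

lemma prod_linear_factors_dvd:
  fixes f :: "complex poly"
  assumes "finite S" "\<And>a. a \<in> S \<Longrightarrow> poly f a = 0"
  shows "(\<Prod>a\<in>S. [:- a, 1:]) dvd f"
  using assms
proof (induction S arbitrary: f)
  case empty
  then show ?case by simp
next
  case (insert a S)
  then have "(\<Prod>a\<in>S. [:- a, 1:]) dvd f" by blast
  then obtain g where g: "f = (\<Prod>a\<in>S. [:- a, 1:]) * g" by (auto elim: dvdE)
  have "poly (\<Prod>a\<in>S. [:- a, 1:]) a \<noteq> 0"
    using insert.hyps by (auto simp: poly_prod)
  moreover have "poly f a = 0" by (rule insert.prems) simp
  ultimately have "poly g a = 0" using g by simp
  then have "[:- a, 1:] dvd g" by (simp add: poly_eq_0_iff_dvd)
  then have "[:- a, 1:] * (\<Prod>a\<in>S. [:- a, 1:]) dvd g * (\<Prod>a\<in>S. [:- a, 1:])" by (rule mult_dvd_mono) simp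
  then show ?case using insert.hyps g by (simp add: mult.commute)
qed

lemma cyclotomic_dvd_iff:
  assumes s: "s > 0"
  shows "cyclotomic s dvd f \<longleftrightarrow> (\<forall>k\<in>totatives s. poly f (cis (2 * pi * real k / real s)) = 0)"
proof
  assume d: "cyclotomic s dvd f"
  show "\<forall>k\<in>totatives s. poly f (cis (2 * pi * real k / real s)) = 0"
  proof
    fix k assume k: "k \<in> totatives s"
    have "poly (cyclotomic s) (cis (2 * pi * real k / real s)) = 0"
      unfolding cyclotomic_def poly_prod using k by (intro prod_zero) auto
    then show "poly f (cis (2 * pi * real k / real s)) = 0" using d by (auto elim!: dvdE)
  qed
next
  assume r: "\<forall>k\<in>totatives s. poly f (cis (2 * pi * real k / real s)) = 0"
  have inj: "inj_on (\<lambda>k. cis (2 * pi * real k / real s)) (totatives s)"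
  proof (rule inj_onI)
    fix k l assume k: "k \<in> totatives s" and l: "l \<in> totatives s"
      and eq: "cis (2 * pi * real k / real s) = cis (2 * pi * real l / real s)"
    have "cis (2 * pi * real_of_int (int k - int l) / real s) = cis (2 * pi * real k / real s) / cis (2 * pi * real l / real s)"
      unfolding cis_divide by (simp add: diff_divide_distrib right_diff_distrib)
    then have "cis (2 * pi * real_of_int (int k - int l) / real s) = 1" using eq by (simp add: cis_neq_zero)
    then have "int s dvd int k - int l" using cis_eq_1_iff_dvd[OF s] by blast
    moreover have "0 < k" "k \<le> s" "0 < l" "l \<le> s" using k l by (auto simp: totatives_def)
    then have "\<bar>int k - int l\<bar> < int s" by linarith
    ultimately have "int k - int l = 0" by (metis dvd_imp_le_int not_less abs_of_nat)
    then show "k = l" by simp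
  qed
  have "cyclotomic s = (\<Prod>a\<in>(\<lambda>k. cis (2 * pi * real k / real s)) ` totatives s. [:- a, 1:])"
    unfolding cyclotomic_def using inj by (simp add: prod.reindex)
  also have "\<dots> dvd f" by (rule prod_linear_factors_dvd) (use r in auto)
  finally show "cyclotomic s dvd f" .
qed

lemma cyclotomic_dvd_maskI:
  assumes "s > 0" "\<And>z. primitive_root s z \<Longrightarrow> (\<Sum>y\<in>S. z ^ nat y) = 0"
  shows "cyclotomic s dvd mask_poly S"
  unfolding cyclotomic_dvd_iff[OF assms(1)] poly_mask
  by (intro ballI assms(2) primitive_root_cis[OF assms(1)]) (auto simp: totatives_def)

lemma primitive_root_power_eq:
  assumes z: "primitive_root s z" and s: "int s dvd x - y" and "x \<ge> 0" "y \<ge> 0"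
  shows "z ^ nat x = z ^ nat y"
proof -
  have *: "z ^ nat x = z ^ nat y" if "int s dvd x - y" "y \<ge> 0" "y \<le> x" for x y
  proof -
    have "nat x = nat y + nat (x - y)" using that by simp
    moreover have "s dvd nat (x - y)" using that by (metis diff_ge_0_iff_ge int_dvd_int_iff int_nat_eq)
    then have "z ^ nat (x - y) = 1" using z by (simp add: primitive_root_def)
    ultimately show ?thesis by (simp add: power_add)
  qed
  show ?thesis
  proof (cases "y \<le> x")
    case True
    then show ?thesis using * assms by blast
  next
    case False
    then show ?thesis using *[of y x] assms by (simp add: dvd_diff_commute)
  qed
qed

text \<open>Translation by \<open>d\<close> permutes \<open>S\<close> and multiplies the sum by
  \<open>z ^ d\<close>, which differs from 1.\<close>

lemma periodic_sum_eq_0: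
  assumes S: "finite S" "S \<subseteq> zmod M" and closed: "\<And>y. y \<in> S \<Longrightarrow> (y + int d) mod int M \<in> S"
    and z: "primitive_root s z" and s: "s dvd M" "\<not> s dvd d"
  shows "(\<Sum>y\<in>S. z ^ nat y) = 0"
proof -
  let ?t = "\<lambda>y. (y + int d) mod int M"
  have "inj_on ?t S"
  proof (rule inj_onI)
    fix x y assume xy: "x \<in> S" "y \<in> S" "?t x = ?t y"
    then have "int M dvd x - y" by (simp add: mod_eq_dvd_iff)
    then have "x mod int M = y mod int M" by (simp add: mod_eq_dvd_iff)
    moreover have "x \<in> zmod M" "y \<in> zmod M" using xy S by auto
    ultimately show "x = y" by (simp add: zmod_def)
  qed
  then have "bij_betw ?t S S" using S(1) closed by (simp add: bij_betw_def endo_inj_surj image_subset_iff)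
  then have "(\<Sum>y\<in>S. z ^ nat y) = (\<Sum>y\<in>S. z ^ nat (?t y))" by (rule sum.reindex_bij_betw[symmetric])
  also have "\<dots> = (\<Sum>y\<in>S. z ^ nat y * z ^ d)"
  proof (rule sum.cong[OF refl])
    fix y assume "y \<in> S"
    then have y: "0 \<le> y" "y < int M" using S by (auto simp: zmod_def)
    have "int M dvd ?t y - (y + int d)" by (metis mod_eq_dvd_iff mod_mod_trivial)
    then have "int s dvd ?t y - (y + int d)" using s(1) by (meson dvd_trans int_dvd_int_iff)
    then have "z ^ nat (?t y) = z ^ nat (y + int d)" using y by (intro primitive_root_power_eq[OF z]) auto
    then show "z ^ nat (?t y) = z ^ nat y * z ^ d" using y by (simp add: nat_add_distrib power_add)
  qed
  also have "\<dots> = (\<Sum>y\<in>S. z ^ nat y) * z ^ d" by (rule sum_distrib_right[symmetric])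
  finally have "(\<Sum>y\<in>S. z ^ nat y) = (\<Sum>y\<in>S. z ^ nat y) * z ^ d" .
  moreover have "z ^ d \<noteq> 1" using z s(2) by (simp add: primitive_root_def)
  ultimately show ?thesis by (metis mult_cancel_left1 mult.right_neutral mult_cancel_left)
qed

text \<open>The exponents reduce to \<open>0, ..., D - 1\<close>, so the sum is a full geometric
  sum.\<close>

lemma complete_residues_sum_eq_0:
  assumes S: "finite S" "\<And>y. y \<in> S \<Longrightarrow> 0 \<le> y" "card S = D"
    and inj: "\<And>x y. x \<in> S \<Longrightarrow> y \<in> S \<Longrightarrow> int D dvd x - y \<Longrightarrow> x = y"
    and z: "primitive_root s z" and s: "s dvd D" "s \<noteq> 1" and D: "D > 0"
  shows "(\<Sum>y\<in>S. z ^ nat y) = 0"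
proof -
  have i: "inj_on (\<lambda>y. nat (y mod int D)) S"
  proof (rule inj_onI)
    fix x y assume xy: "x \<in> S" "y \<in> S" "nat (x mod int D) = nat (y mod int D)"
    then have "x mod int D = y mod int D" using D by (simp add: eq_nat_nat_iff)
    then show "x = y" using inj xy by (simp add: mod_eq_dvd_iff)
  qed
  have "(\<lambda>y. nat (y mod int D)) ` S \<subseteq> {..<D}" using D by (auto simp: nat_less_iff)
  moreover have "card ((\<lambda>y. nat (y mod int D)) ` S) = card {..<D}" using card_image[OF i] S(3) by simp
  ultimately have "(\<lambda>y. nat (y mod int D)) ` S = {..<D}" by (intro card_subset_eq) auto
  then have bij: "bij_betw (\<lambda>y. nat (y mod int D)) S {..<D}" using i by (simp add: bij_betw_def)
  have "(\<Sum>y\<in>S. z ^ nat y) = (\<Sum>y\<in>S. z ^ nat (y mod int D))"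
  proof (rule sum.cong[OF refl])
    fix y assume y: "y \<in> S"
    have "int D dvd y - y mod int D" by (metis dvd_minus_mod)
    then have "int s dvd y - y mod int D" using s(1) by (meson dvd_trans int_dvd_int_iff)
    then show "z ^ nat y = z ^ nat (y mod int D)" using S(2)[OF y] D by (intro primitive_root_power_eq[OF z]) auto
  qed
  also have "\<dots> = (\<Sum>t<D. z ^ t)" using sum.reindex_bij_betw[OF bij, of "\<lambda>t. z ^ t"] by simp
  finally have eq: "(\<Sum>y\<in>S. z ^ nat y) = (\<Sum>t<D. z ^ t)" .
  have "(z - 1) * (\<Sum>t<D. z ^ t) = z ^ D - 1" by (rule power_diff_1_eq[symmetric])
  moreover have "z ^ D = 1" "z ^ 1 \<noteq> 1" using z s unfolding primitive_root_def by (metis, metis nat_dvd_1_iff_1)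
  ultimately show ?thesis using eq by simp
qed

section \<open>Equidistribution in residue classes and prime powers dividing the cardinality\<close>

definition count_class :: "int set \<Rightarrow> nat \<Rightarrow> int \<Rightarrow> nat" where
  "count_class S L c = card {x \<in> S. int L dvd x - c}"

lemma sum_cis_eq:
  assumes "L > 0"
  shows "(\<Sum>t<L. cis (2 * pi * real_of_int (int t * d) / real L)) = (if int L dvd d then of_nat L else 0)"
proof (cases "int L dvd d")
  case True
  then have "cis (2 * pi * real_of_int (int t * d) / real L) = 1" for t
    by (subst cis_eq_1_iff_dvd[OF assms]) simp
  then show ?thesis using True by simp
next
  case False
  let ?z = "cis (2 * pi * real_of_int d / real L)"
  have z1: "?z \<noteq> 1" using False cis_eq_1_iff_dvd[OF assms] by blast
  have "?z ^ L = 1" unfolding cis_power using cis_eq_1_iff_dvd[OF assms, of "int L * d"] by simp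
  moreover have "(?z - 1) * (\<Sum>t<L. ?z ^ t) = ?z ^ L - 1" by (rule power_diff_1_eq[symmetric])
  ultimately have "(\<Sum>t<L. ?z ^ t) = 0" using z1 by simp
  then show ?thesis using False by (simp add: cis_power)
qed

text \<open>By Fourier inversion on \<open>\<int>/l ^ Suc k\<close>: only the frequencies divisible by \<open>l\<close> survive,
  and those do not distinguish residues that agree modulo \<open>l ^ k\<close>.\<close>

lemma count_class_equidistributed:
  assumes l: "prime l" and S: "finite S" "\<And>x. x \<in> S \<Longrightarrow> 0 \<le> x"
    and dvd: "cyclotomic (l ^ Suc k) dvd mask_poly S" and c: "int (l ^ k) dvd c - c'"
  shows "count_class S (l ^ Suc k) c = count_class S (l ^ Suc k) c'"
proof -
  define L where "L = l ^ Suc k"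
  have L: "L > 0" using prime_gt_0_nat[OF l] by (simp add: L_def)
  define e where "e d = cis (2 * pi * real_of_int d / real L)" for d :: int
  have e_add: "e (a + b) = e a * e b" for a b
    unfolding e_def cis_mult by (simp add: add_divide_distrib distrib_left)
  have e_1: "e d = 1 \<longleftrightarrow> int L dvd d" for d unfolding e_def by (rule cis_eq_1_iff_dvd[OF L])
  have inv: "(\<Sum>t<L. (\<Sum>x\<in>S. e (int t * x)) * e (int t * - c)) = of_nat L * of_nat (count_class S L c)" for c
  proof -
    have "(\<Sum>t<L. (\<Sum>x\<in>S. e (int t * x)) * e (int t * - c)) = (\<Sum>t<L. \<Sum>x\<in>S. e (int t * (x - c)))"
      by (simp add: sum_distrib_right right_diff_distrib flip: e_add)
    also have "\<dots> = (\<Sum>x\<in>S. \<Sum>t<L. e (int t * (x - c)))" by (rule sum.swap)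
    also have "\<dots> = (\<Sum>x\<in>S. if int L dvd x - c then of_nat L else 0)"
      unfolding e_def by (simp only: sum_cis_eq[OF L])
    also have "\<dots> = (\<Sum>x\<in>{x \<in> S. int L dvd x - c}. of_nat L)" using S(1) by (simp add: sum.If_cases Int_def)
    also have "\<dots> = of_nat L * of_nat (count_class S L c)" by (simp add: count_class_def mult.commute)
    finally show ?thesis .
  qed
  have "(\<Sum>x\<in>S. e (int t * x)) * e (int t * - c) = (\<Sum>x\<in>S. e (int t * x)) * e (int t * - c')" if t: "t < L" for t
  proof (cases "l dvd t")
    case True
    then have "int l * int (l ^ k) dvd int t * (c - c')" using c by (intro mult_dvd_mono) simp_all
    then have "e (int t * (c - c')) = 1" unfolding e_1 L_def by simp
    moreover have "e (int t * - c') = e (int t * - c) * e (int t * (c - c'))"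
      by (simp add: algebra_simps flip: e_add)
    ultimately show ?thesis by simp
  next
    case False
    then have "coprime l t" using l by (intro prime_imp_coprime) auto
    then have "coprime t L" by (simp add: L_def coprime_commute)
    moreover have "0 < t" using False by (cases t) auto
    ultimately have "t \<in> totatives L" using t by (simp add: totatives_def)
    then have "poly (mask_poly S) (cis (2 * pi * real t / real L)) = 0"
      using dvd cyclotomic_dvd_iff[OF L] unfolding L_def by blast
    moreover have "cis (2 * pi * real t / real L) ^ nat x = e (int t * x)" if "x \<in> S" for x
      using cis_power[of "int t" L "nat x"] S(2)[OF that] unfolding e_def by (simp add: mult.commute)
    ultimately have "(\<Sum>x\<in>S. e (int t * x)) = 0" by (simp add: poly_mask)
    then show ?thesis by simp
  qed
  then have "of_nat L * of_nat (count_class S L c) = (of_nat L * of_nat (count_class S L c') :: complex)"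
    unfolding inv[symmetric] by (intro sum.cong) auto
  then have "count_class S L c = count_class S L c'" using L by simp
  then show ?thesis by (simp add: L_def)
qed

lemma count_class_split:
  assumes l: "l > 0" and S: "finite S"
  shows "count_class S (l ^ k) c = (\<Sum>j<l. count_class S (l ^ Suc k) (c + int j * int (l ^ k)))"
proof -
  let ?X = "\<lambda>j. {x \<in> S. int (l ^ Suc k) dvd x - (c + int j * int (l ^ k))}"
  have lk: "int (l ^ k) > 0" using l by simp
  have mem: "x \<in> ?X j \<longleftrightarrow> x \<in> S \<and> (\<exists>t. x - c = int (l ^ k) * t \<and> int l dvd t - int j)" for x j
  proof
    assume "x \<in> ?X j"
    then obtain u where u: "x \<in> S" "x - (c + int j * int (l ^ k)) = int (l ^ Suc k) * u" by (auto elim: dvdE)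
    then have "x - c = int (l ^ k) * (int j + int l * u)" by (simp add: algebra_simps)
    then show "x \<in> S \<and> (\<exists>t. x - c = int (l ^ k) * t \<and> int l dvd t - int j)"
      using u(1) by (intro conjI exI[of _ "int j + int l * u"]) auto
  next
    assume "x \<in> S \<and> (\<exists>t. x - c = int (l ^ k) * t \<and> int l dvd t - int j)"
    then obtain t where t: "x \<in> S" "x - c = int (l ^ k) * t" "int l dvd t - int j" by blast
    have "int (l ^ k) * int l dvd int (l ^ k) * (t - int j)" using t(3) by (intro mult_dvd_mono) auto
    moreover have "int (l ^ k) * (t - int j) = x - (c + int j * int (l ^ k))" using t(2) by (simp add: algebra_simps)
    moreover have "int (l ^ Suc k) = int (l ^ k) * int l" by simp
    ultimately show "x \<in> ?X j" using t(1) by (simp only: mem_Collect_eq)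
  qed
  have "{x \<in> S. int (l ^ k) dvd x - c} = (\<Union>j\<in>{..<l}. ?X j)"
  proof (intro equalityI subsetI)
    fix x assume "x \<in> {x \<in> S. int (l ^ k) dvd x - c}"
    then obtain t where t: "x \<in> S" "x - c = int (l ^ k) * t" by (auto elim: dvdE)
    have "nat (t mod int l) < l" "int l dvd t - int (nat (t mod int l))" using l by (auto simp: nat_less_iff)
    then show "x \<in> (\<Union>j\<in>{..<l}. ?X j)" using t mem by blast
  next
    fix x assume "x \<in> (\<Union>j\<in>{..<l}. ?X j)"
    then obtain j t where "x \<in> S" "x - c = int (l ^ k) * t" using mem by blast
    then show "x \<in> {x \<in> S. int (l ^ k) dvd x - c}" by simp
  qed
  moreover have "card (\<Union>j\<in>{..<l}. ?X j) = (\<Sum>j<l. card (?X j))"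
  proof (rule card_UN_disjoint)
    show "\<forall>i\<in>{..<l}. \<forall>j\<in>{..<l}. i \<noteq> j \<longrightarrow> ?X i \<inter> ?X j = {}"
    proof (intro ballI impI equals0I)
      fix i j x assume ij: "i \<in> {..<l}" "j \<in> {..<l}" "i \<noteq> j" and x: "x \<in> ?X i \<inter> ?X j"
      obtain t where t: "x - c = int (l ^ k) * t" "int l dvd t - int i" using mem x by blast
      obtain t' where t': "x - c = int (l ^ k) * t'" "int l dvd t' - int j" using mem x by blast
      have "t = t'" using t(1) t'(1) lk mult_left_cancel[of "int (l ^ k)" t t'] by linarith
      then have "int l dvd int i - int j" using t(2) t'(2) by (metis dvd_sym dvd_tr)
      then have "int i mod int l = int j mod int l" by (simp add: mod_eq_dvd_iff)
      then show False using ij by simp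
    qed
  qed (use S in auto)
  ultimately show ?thesis by (simp add: count_class_def)
qed

text \<open>Descending in \<open>k\<close>: a class modulo \<open>l ^ k\<close> splits into
  \<open>l\<close> classes modulo \<open>l ^ Suc k\<close>, equally large if
  \<open>Suc k \<in> T\<close>, so each exponent in \<open>T\<close> contributes a factor
  \<open>l\<close>.\<close>

lemma prime_power_dvd_card:
  assumes l: "prime l" and S: "finite S" "\<And>x. x \<in> S \<Longrightarrow> 0 \<le> x"
    and T: "finite T" "T \<subseteq> {1..n}" "\<And>k. k \<in> T \<Longrightarrow> cyclotomic (l ^ k) dvd mask_poly S"
  shows "l ^ card T dvd card S"
proof -
  have l0: "l > 0" using l by (rule prime_gt_0_nat)
  have step: "l ^ card {i \<in> T. k < i} dvd count_class S (l ^ k) c" if "k \<le> n" for k c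
    using that
  proof (induction arbitrary: c rule: inc_induct)
    case base
    have "{i \<in> T. n < i} = {}" using T(2) by auto
    then show ?case by (simp only: card.empty power_0 one_dvd)
  next
    case (step k)
    have split: "count_class S (l ^ k) c = (\<Sum>j<l. count_class S (l ^ Suc k) (c + int j * int (l ^ k)))"
      by (rule count_class_split[OF l0 S(1)])
    show ?case
    proof (cases "Suc k \<in> T")
      case True
      have "count_class S (l ^ Suc k) (c + int j * int (l ^ k)) = count_class S (l ^ Suc k) c" for j
      proof (rule count_class_equidistributed[OF l S T(3)[OF True]])
        have "c + int j * int (l ^ k) - c = int j * int (l ^ k)" by linarith
        then show "int (l ^ k) dvd c + int j * int (l ^ k) - c" by (metis dvd_triv_right)
      qed
      then have "count_class S (l ^ k) c = l * count_class S (l ^ Suc k) c" unfolding split by simp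
      moreover have "{i \<in> T. k < i} = insert (Suc k) {i \<in> T. Suc k < i}" using True by auto
      then have "card {i \<in> T. k < i} = Suc (card {i \<in> T. Suc k < i})" using T(1) by simp
      ultimately show ?thesis using step.IH by (simp add: mult_dvd_mono)
    next
      case False
      then have "{i \<in> T. k < i} = {i \<in> T. Suc k < i}" by (auto simp: Suc_lessI le_less Suc_le_eq) (metis Suc_lessI)
      then show ?thesis unfolding split using step.IH by (auto intro!: dvd_sum)
    qed
  qed
  have "{i \<in> T. 0 < i} = T" using T(2) by auto
  moreover have "count_class S (l ^ 0) 0 = card S" by (simp add: count_class_def)
  ultimately show ?thesis using step[of 0 0] by simp
qed

section \<open>Cyclotomic divisors under fiber shifts, and (T2)\<close>

context three_primes
begin

abbreviation "D \<equiv> p ^ m * q * r"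

lemma D_pos: "D > 0" using pos by simp

lemma M_eq_D: "M = D * (p * q * r)"
  unfolding M_eq by (simp add: power2_eq_square)

lemma D_dvd_iff: "int D dvd d \<longleftrightarrow> int p ^ m dvd d \<and> int q dvd d \<and> int r dvd d"
proof -
  have "coprime (int p ^ m) (int q)" "coprime (int p ^ m * int q) (int r)" using coprimes by simp_all
  then show ?thesis unfolding of_nat_mult of_nat_power by (meson divides_mult dvd_mult_left dvd_mult_right)
qed

lemma in_grid: "y \<in> grid M D x \<longleftrightarrow> y \<in> zmod M \<and> int D dvd y - x"
proof
  assume "y \<in> grid M D x"
  then obtain k where y: "y = (x + int D * k) mod int M" by (auto simp: grid_def)
  have "int M dvd y - (x + int D * k)" unfolding y by (metis mod_eq_dvd_iff mod_mod_trivial)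
  moreover have "int D dvd int M" unfolding M_eq_D by (simp only: of_nat_mult dvd_triv_left)
  ultimately have "int D dvd y - (x + int D * k)" by (rule dvd_trans[rotated])
  then have "int D dvd (y - (x + int D * k)) + int D * k" by (rule dvd_add) (rule dvd_triv_left)
  moreover have "(y - (x + u)) + u = y - x" for u :: int by simp
  ultimately have "int D dvd y - x" by (simp only:)
  then show "y \<in> zmod M \<and> int D dvd y - x" using y pos by (simp add: zmod_def)
next
  assume y: "y \<in> zmod M \<and> int D dvd y - x"
  then obtain k where k: "y - x = int D * k" by (blast elim: dvdE)
  have "y = (x + int D * k) mod int M" using y unfolding k[symmetric] by (simp add: zmod_def)
  then show "y \<in> grid M D x" unfolding grid_def by blast
qed

lemma card_grid: "card (grid M D x) = p * q * r"
proof -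
  have "grid M D x = {w \<in> {0..<int D * int (p * q * r)}. int D dvd w - x}"
    using in_grid by (auto simp: zmod_def M_eq_D)
  moreover have "int D > 0" "int (p * q * r) > 0" using pos by simp_all
  ultimately show ?thesis using card_residues[of "int D" "int (p * q * r)" x] by (simp only: nat_int)
qed

text \<open>If \<open>q\<^sup>2\<close> divides \<open>s\<close>, both sums vanish: fibers have
  period \<open>M div q\<close>, which \<open>s\<close> does not divide. If \<open>q\<close> does
  not divide \<open>s\<close>, then \<open>s\<close> divides \<open>P * R\<close> and hence the
  translation \<open>x' - x\<close>.\<close>

lemma fiber_sum_q:
  assumes x: "P dvd x' - x" "R dvd x' - x" and s: "s dvd M" "q\<^sup>2 dvd s \<or> \<not> q dvd s"
    and z: "primitive_root s z"
  shows "(\<Sum>y\<in>fiber_at M q x'. z ^ nat y) = (\<Sum>y\<in>fiber_at M q x. z ^ nat y)"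
  using s(2)
proof
  assume q2: "q\<^sup>2 dvd s"
  have zero: "(\<Sum>y\<in>fiber_at M q x. z ^ nat y) = 0" for x
  proof (rule periodic_sum_eq_0[OF _ _ _ z s(1)])
    show "fiber_at M q x \<subseteq> zmod M" by (auto simp: in_fiber_at)
    then show "finite (fiber_at M q x)" by (rule finite_subset) (simp add: zmod_def)
    show "(y + int (M div q)) mod int M \<in> fiber_at M q x" if y: "y \<in> fiber_at M q x" for y
    proof -
      have "int M dvd (y + int (M div q)) mod int M - (y + int (M div q))" by (metis mod_eq_dvd_iff mod_mod_trivial)
      moreover have "k dvd (y + int (M div q)) - x" if "k dvd y - x" "k dvd int (M div q)" for k
        using dvd_add[OF that] by (simp add: algebra_simps)
      moreover have "P dvd int (M div q)" "int q dvd int (M div q)" "R dvd int (M div q)" unfolding M_div by simp_all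
      ultimately have "P dvd (y + int (M div q)) mod int M - x" "int q dvd (y + int (M div q)) mod int M - x"
        "R dvd (y + int (M div q)) mod int M - x"
        using y unfolding M_dvd_iff in_fiber_at by (metis dvd_tr dvd_mult_left)+
      then show ?thesis using pos by (simp add: in_fiber_at zmod_def)
    qed
    show "\<not> s dvd M div q"
    proof
      assume "s dvd M div q"
      then have "q\<^sup>2 dvd M div q" using q2 by (rule dvd_trans[rotated])
      then have "int (q\<^sup>2) dvd int (M div q)" by (simp only: int_dvd_int_iff)
      then have "int q * int q dvd int q * (P * R)" unfolding M_div by (simp add: power2_eq_square mult.assoc mult.left_commute)
      then have "int q dvd P * R" using pos by (simp del: of_nat_power)
      moreover have "coprime (int q) (P * R)" using coprimes by (simp add: coprime_commute)
      ultimately have "int q dvd 1" by (metis coprime_common_divisor dvd_refl)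
      then show False using primes(2) by (simp add: prime_nat_iff)
    qed
  qed
  show ?thesis unfolding zero ..
next
  assume q: "\<not> q dvd s"
  then have "coprime q s" using primes(2) by (intro prime_imp_coprime) auto
  then have "coprime s (q\<^sup>2)" by (simp add: coprime_commute)
  moreover have "M = q\<^sup>2 * (p ^ Suc m * r\<^sup>2)" unfolding M_eq by simp
  ultimately have "s dvd p ^ Suc m * r\<^sup>2" using s(1) coprime_dvd_mult_right_iff by metis
  then have "int s dvd int (p ^ Suc m * r\<^sup>2)" by (simp only: int_dvd_int_iff)
  moreover have "int (p ^ Suc m * r\<^sup>2) = P * R" by (simp add: power2_eq_square)
  moreover have "P * R dvd x' - x" by (rule divides_mult[OF x coprime_PQR(3)])
  ultimately have sd: "int s dvd x' - x" by (metis dvd_trans)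
  have "(\<Sum>y\<in>fiber_at M q x'. z ^ nat y) = (\<Sum>y\<in>fiber_at M q x. z ^ nat ((y + (x' - x)) mod int M))"
    by (rule sum.reindex_bij_betw[OF fiber_translate, symmetric])
  also have "\<dots> = (\<Sum>y\<in>fiber_at M q x. z ^ nat y)"
  proof (rule sum.cong[OF refl], rule primitive_root_power_eq[OF z])
    fix y assume y: "y \<in> fiber_at M q x"
    have "int M dvd (y + (x' - x)) mod int M - (y + (x' - x))" by (metis mod_eq_dvd_iff mod_mod_trivial)
    then have "int s dvd (y + (x' - x)) mod int M - (y + (x' - x))" using s(1) by (meson dvd_trans int_dvd_int_iff)
    then have "int s dvd ((y + (x' - x)) mod int M - (y + (x' - x))) + (x' - x)" using sd by (rule dvd_add)
    moreover have "((y + (x' - x)) mod int M - (y + (x' - x))) + (x' - x) = (y + (x' - x)) mod int M - y" by linarith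
    ultimately show "int s dvd (y + (x' - x)) mod int M - y" by metis
    show "0 \<le> (y + (x' - x)) mod int M" using pos by simp
    show "0 \<le> y" using y by (simp add: in_fiber_at zmod_def)
  qed
  finally show ?thesis .
qed

lemma shift_sum_q:
  assumes t: "tiling M S B" "tiling M S' B" and sub: "fiber_at M q x \<subseteq> S"
    and g: "gcd (x - x') (int M) = int (M div q\<^sup>2)"
    and S': "S' = (S - fiber_at M q x) \<union> fiber_at M q x'"
    and s: "s dvd M" "q\<^sup>2 dvd s \<or> \<not> q dvd s" and z: "primitive_root s z"
  shows "(\<Sum>y\<in>S'. z ^ nat y) = (\<Sum>y\<in>S. z ^ nat y)"
proof -
  let ?F = "fiber_at M q x" and ?F' = "fiber_at M q x'"
  have "int (M div q\<^sup>2) dvd x - x'" using g by (metis gcd_dvd1)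
  then have d: "P dvd x' - x" "R dvd x' - x" unfolding M_div by (meson dvd_mult_left dvd_mult_right dvd_sym)+
  have tt: "S \<subseteq> zmod M" "S' \<subseteq> zmod M" "card S * card B = M" "card S' * card B = M"
    using t unfolding tiling_iff_cover[OF pos(4)] by auto
  have fin: "finite S" "finite S'" "finite ?F" "finite ?F'"
    using tt finite_subset[of _ "zmod M"] sub S' by (auto simp: zmod_def intro: finite_subset)
  have "card B \<noteq> 0" using tt(3) pos by auto
  then have cS: "card S' = card S" using tt(3,4) by (metis mult_right_cancel)
  have cF: "card ?F' = card ?F" using bij_betw_same_card[OF fiber_translate] by metis
  \<comment> \<open>Both sets tile with \<open>B\<close> and so have equal size, which makes the new
    fiber disjoint from the rest of \<open>S\<close>.\<close>
  have "card (S - ?F) + card ?F = card S" using fin sub by (metis card_Diff_subset card_mono le_add_diff_inverse2)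
  moreover have "card (S - ?F) + card ?F' = card S' + card ((S - ?F) \<inter> ?F')"
    unfolding S' using fin by (intro card_Un_Int) auto
  ultimately have "card ((S - ?F) \<inter> ?F') = 0" using cS cF by linarith
  then have disj: "(S - ?F) \<inter> ?F' = {}" using fin by simp
  have "(\<Sum>y\<in>S'. z ^ nat y) = (\<Sum>y\<in>S - ?F. z ^ nat y) + (\<Sum>y\<in>?F'. z ^ nat y)"
    unfolding S' using fin disj by (intro sum.union_disjoint) auto
  also have "(\<Sum>y\<in>?F'. z ^ nat y) = (\<Sum>y\<in>?F. z ^ nat y)" by (rule fiber_sum_q[OF d s z])
  also have "(\<Sum>y\<in>S - ?F. z ^ nat y) + (\<Sum>y\<in>?F. z ^ nat y) = (\<Sum>y\<in>S. z ^ nat y)"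
    by (rule sum.subset_diff[OF sub fin(1), symmetric])
  finally show ?thesis .
qed

lemma shifts_sum:
  assumes "(fiber_shift M {q, r} B)\<^sup>*\<^sup>* S S'" and t: "tiling M S B"
    and s: "s dvd M" "q\<^sup>2 dvd s \<or> \<not> q dvd s" "r\<^sup>2 dvd s \<or> \<not> r dvd s" and z: "primitive_root s z"
  shows "tiling M S' B \<and> (\<Sum>y\<in>S'. z ^ nat y) = (\<Sum>y\<in>S. z ^ nat y)"
  using assms(1)
proof (induction rule: rtranclp_induct)
  case base
  then show ?case using t by simp
next
  case (step S1 S2)
  interpret sw: three_primes p r q m M by (rule swapped)
  obtain k x x' where k: "k \<in> {q, r}" and h: "fiber_at M k x \<subseteq> S1" "gcd (x - x') (int M) = int (M div k\<^sup>2)"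
    "S2 = (S1 - fiber_at M k x) \<union> fiber_at M k x'" "tiling M S2 B"
    using step.hyps(2) unfolding fiber_shift_def by blast
  have t1: "tiling M S1 B" using step.IH by blast
  have "(\<Sum>y\<in>S2. z ^ nat y) = (\<Sum>y\<in>S1. z ^ nat y)"
  proof (cases "k = q")
    case True
    show ?thesis by (rule shift_sum_q[OF t1 h(4) h(1-3)[unfolded True] s(1,2) z])
  next
    case False
    then have k: "k = r" using k by blast
    show ?thesis by (rule sw.shift_sum_q[OF t1 h(4) h(1-3)[unfolded k] s(1,3) z])
  qed
  then show ?case using step.IH h(4) by simp
qed

lemma grid_sum_eq_0:
  assumes s: "s dvd M" "\<not> s dvd D" and z: "primitive_root s z"
  shows "(\<Sum>y\<in>grid M D x. z ^ nat y) = 0"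
proof (rule periodic_sum_eq_0[OF _ _ _ z s])
  show sub: "grid M D x \<subseteq> zmod M" using in_grid by blast
  then show "finite (grid M D x)" by (rule finite_subset) (simp add: zmod_def)
  fix y assume y: "y \<in> grid M D x"
  have "int M dvd (y + int D) mod int M - (y + int D)" by (metis mod_eq_dvd_iff mod_mod_trivial)
  moreover have "int D dvd int M" unfolding M_eq_D by (simp only: of_nat_mult dvd_triv_left)
  ultimately have "int D dvd (y + int D) mod int M - (y + int D)" by (rule dvd_trans[rotated])
  moreover have "int D dvd (y - x) + int D" by (rule dvd_add) (use y in_grid in auto)
  then have "int D dvd (y + int D) - x" by (simp only: diff_add_eq add.commute)
  ultimately have "int D dvd (y + int D) mod int M - x" by (rule dvd_tr)
  then show "(y + int D) mod int M \<in> grid M D x" using pos by (simp only: in_grid) (simp add: zmod_def)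
qed

text \<open>The exact exponents of the primes in \<open>M\<close>. Each is one more than the
  exponent in \<open>D\<close>, as \<open>M\<close> is \<open>D\<close> times the squarefree number
  \<open>p * q * r\<close>.\<close>

definition top_exponents :: "(nat \<times> nat) set" where
  "top_exponents = {(p, Suc m), (q, 2), (r, 2)}"

lemma prime_power_dvd:
  assumes "(l, n) \<in> top_exponents"
  shows "prime l" "l ^ k dvd M \<longleftrightarrow> k \<le> n" "l ^ k dvd D \<longleftrightarrow> k < n" "\<not> l ^ 2 dvd p * q * r"
proof -
  have cop: "coprime p q" "coprime p r" "coprime q r" using primes distinct by (auto intro: primes_coprime)
  have dvd: "l ^ k dvd l ^ a * c \<longleftrightarrow> k \<le> a" if "prime l" "coprime l c" for l k a c :: nat
  proof -
    have "l ^ k dvd l ^ a * c \<longleftrightarrow> l ^ k dvd l ^ a" using that(2) by (intro coprime_dvd_mult_left_iff) simp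
    also have "\<dots> \<longleftrightarrow> k \<le> a" using dvd_power_iff[of l k a] prime_gt_1_nat[OF that(1)] by simp
    finally show ?thesis .
  qed
  have p: "l ^ k dvd M \<longleftrightarrow> k \<le> n" "l ^ k dvd D \<longleftrightarrow> k < n" "\<not> l ^ 2 dvd p * q * r" "prime l"
    if "l = p" "n = Suc m"
  proof -
    have eq: "M = p ^ Suc m * (q\<^sup>2 * r\<^sup>2)" "D = p ^ m * (q * r)" "p * q * r = p ^ 1 * (q * r)"
      unfolding M_eq by (simp_all add: mult.assoc mult.left_commute mult.commute)
    show "l ^ k dvd M \<longleftrightarrow> k \<le> n" unfolding that eq(1) by (rule dvd[OF primes(1)]) (use cop in \<open>simp add: coprime_commute\<close>)
    have "p ^ k dvd p ^ m * (q * r) \<longleftrightarrow> k \<le> m" by (rule dvd[OF primes(1)]) (use cop in \<open>simp add: coprime_commute\<close>)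
    then show "l ^ k dvd D \<longleftrightarrow> k < n" unfolding that eq(2) by linarith
    have "p ^ 2 dvd p ^ 1 * (q * r) \<longleftrightarrow> 2 \<le> (1::nat)" by (rule dvd[OF primes(1)]) (use cop in \<open>simp add: coprime_commute\<close>)
    then show "\<not> l ^ 2 dvd p * q * r" unfolding that eq(3) by linarith
  qed (use primes that in simp)
  have q: "l ^ k dvd M \<longleftrightarrow> k \<le> n" "l ^ k dvd D \<longleftrightarrow> k < n" "\<not> l ^ 2 dvd p * q * r" "prime l"
    if "l = q" "n = 2"
  proof -
    have eq: "M = q ^ 2 * (p ^ Suc m * r\<^sup>2)" "D = q ^ 1 * (p ^ m * r)" "p * q * r = q ^ 1 * (p * r)"
      unfolding M_eq by (simp_all add: mult.assoc mult.left_commute mult.commute)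
    show "l ^ k dvd M \<longleftrightarrow> k \<le> n" unfolding that eq(1) by (rule dvd[OF primes(2)]) (use cop in \<open>simp add: coprime_commute\<close>)
    have "q ^ k dvd q ^ 1 * (p ^ m * r) \<longleftrightarrow> k \<le> 1" by (rule dvd[OF primes(2)]) (use cop in \<open>simp add: coprime_commute\<close>)
    then show "l ^ k dvd D \<longleftrightarrow> k < n" unfolding that eq(2) by linarith
    have "q ^ 2 dvd q ^ 1 * (p * r) \<longleftrightarrow> 2 \<le> (1::nat)" by (rule dvd[OF primes(2)]) (use cop in \<open>simp add: coprime_commute\<close>)
    then show "\<not> l ^ 2 dvd p * q * r" unfolding that eq(3) by linarith
  qed (use primes that in simp)
  have r: "l ^ k dvd M \<longleftrightarrow> k \<le> n" "l ^ k dvd D \<longleftrightarrow> k < n" "\<not> l ^ 2 dvd p * q * r" "prime l"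
    if "l = r" "n = 2"
  proof -
    have eq: "M = r ^ 2 * (p ^ Suc m * q\<^sup>2)" "D = r ^ 1 * (p ^ m * q)" "p * q * r = r ^ 1 * (p * q)"
      unfolding M_eq by (simp_all add: mult.assoc mult.left_commute mult.commute)
    show "l ^ k dvd M \<longleftrightarrow> k \<le> n" unfolding that eq(1) by (rule dvd[OF primes(3)]) (use cop in \<open>simp add: coprime_commute\<close>)
    have "r ^ k dvd r ^ 1 * (p ^ m * q) \<longleftrightarrow> k \<le> 1" by (rule dvd[OF primes(3)]) (use cop in \<open>simp add: coprime_commute\<close>)
    then show "l ^ k dvd D \<longleftrightarrow> k < n" unfolding that eq(2) by linarith
    have "r ^ 2 dvd r ^ 1 * (p * q) \<longleftrightarrow> 2 \<le> (1::nat)" by (rule dvd[OF primes(3)]) (use cop in \<open>simp add: coprime_commute\<close>)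
    then show "\<not> l ^ 2 dvd p * q * r" unfolding that eq(3) by linarith
  qed (use primes that in simp)
  show "prime l" "l ^ k dvd M \<longleftrightarrow> k \<le> n" "l ^ k dvd D \<longleftrightarrow> k < n" "\<not> l ^ 2 dvd p * q * r"
    using assms p q r unfolding top_exponents_def by blast+
qed

lemma primepow_dvd_M:
  assumes "primepow s" "s dvd M"
  obtains l n k where "(l, n) \<in> top_exponents" "s = l ^ k" "0 < k" "k \<le> n" "s dvd D \<longleftrightarrow> k < n"
proof -
  obtain l k where l: "prime l" "k > 0" "s = l ^ k" using assms(1) by (auto simp: primepow_def)
  have "l dvd M" using assms(2) l by (metis dvd_power dvd_trans)
  then have "l dvd p \<or> l dvd q \<or> l dvd r" unfolding M_eq using l(1)
    by (metis prime_dvd_mult_nat prime_dvd_power)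
  then have "l = p \<or> l = q \<or> l = r" using l(1) primes by (metis primes_dvd_imp_eq)
  then obtain n where n: "(l, n) \<in> top_exponents" unfolding top_exponents_def by blast
  show thesis using that[OF n l(3,2)] prime_power_dvd(2,3)[OF n] assms(2) l(3) by simp
qed

lemma prod_prime_powers_dvd:
  assumes T: "finite T" "inj_on aprimedivisor T" "\<And>s. s \<in> T \<Longrightarrow> primepow s" "\<And>s. s \<in> T \<Longrightarrow> s dvd (K :: nat)"
  shows "\<Prod>T dvd K"
  using T
proof (induction T rule: finite_induct)
  case empty
  then show ?case by simp
next
  case (insert s T)
  have "\<Prod>T dvd K" using insert by (auto simp: inj_on_def)
  moreover have "coprime s t" if t: "t \<in> T" for t
  proof -
    obtain l k where l: "prime l" "k > 0" "s = l ^ k" using insert.prems(2)[of s] by (auto simp: primepow_def)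
    obtain l' k' where l': "prime l'" "k' > 0" "t = l' ^ k'" using insert.prems(2)[of t] t by (auto simp: primepow_def)
    have "aprimedivisor s \<noteq> aprimedivisor t" using insert.prems(1) insert.hyps(2) t by (auto simp: inj_on_def)
    then have "l \<noteq> l'" using l l' by (metis aprimedivisor_prime_power)
    then show ?thesis using l l' by (simp add: primes_coprime)
  qed
  then have "coprime s (\<Prod>T)" by (intro prod_coprime_right)
  ultimately have "s * \<Prod>T dvd K" using insert.prems(3)[of s] by (intro divides_mult) auto
  then show ?case using insert.hyps by simp
qed

text \<open>The sums over \<open>A\<close> equal those over the grid at all orders in which
  \<open>q\<close> and \<open>r\<close> each occur squared or not at all, and the grid sums vanish
  at orders not dividing \<open>D\<close>. Both the full prime powers and their products are of this
  kind.\<close>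

lemma T2_of_shifts:
  assumes sh: "(fiber_shift M {q, r} B)\<^sup>*\<^sup>* A (grid M D x)" and t: "tiling M A B" and card: "card A = p * q * r"
  shows "T2 M A"
proof -
  have A: "A \<subseteq> zmod M" using t by (simp add: tiling_def)
  then have fin: "finite A" "\<And>y. y \<in> A \<Longrightarrow> 0 \<le> y" by (auto simp: zmod_def intro: finite_subset)
  have vanish: "cyclotomic s dvd mask_poly A"
    if s: "s dvd M" "\<not> s dvd D" "q\<^sup>2 dvd s \<or> \<not> q dvd s" "r\<^sup>2 dvd s \<or> \<not> r dvd s" for s
  proof (rule cyclotomic_dvd_maskI)
    show "s > 0" using s(1) pos by (auto intro: dvd_pos_nat)
    fix z assume z: "primitive_root s z"
    show "(\<Sum>y\<in>A. z ^ nat y) = 0" using shifts_sum[OF sh t s(1,3,4) z] grid_sum_eq_0[OF s(1,2) z] by simp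
  qed
  have prime_dvd_power_iff: "l' dvd l ^ k \<longleftrightarrow> l' = l" if "prime l" "prime l'" "0 < k" for l l' k :: nat
    using that by (metis dvd_power prime_dvd_power primes_dvd_imp_eq dvd_refl)
  have top: "cyclotomic (l ^ n) dvd mask_poly A" if l: "(l, n) \<in> top_exponents" for l n
  proof (rule vanish)
    show "l ^ n dvd M" "\<not> l ^ n dvd D" using prime_power_dvd(2,3)[OF l, of n] by simp_all
    have n: "0 < n" "l = q \<or> l = r \<Longrightarrow> n = 2" using l distinct unfolding top_exponents_def by auto
    show "q\<^sup>2 dvd l ^ n \<or> \<not> q dvd l ^ n" "r\<^sup>2 dvd l ^ n \<or> \<not> r dvd l ^ n"
      using prime_dvd_power_iff[OF prime_power_dvd(1)[OF l] _ n(1)] n(2) primes by auto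
  qed
  have only_top: "\<exists>l n. (l, n) \<in> top_exponents \<and> s = l ^ n" if s: "s \<in> prime_power_divs M A" for s
  proof -
    obtain l n k where l: "(l, n) \<in> top_exponents" "s = l ^ k" "0 < k" "k \<le> n" "s dvd D \<longleftrightarrow> k < n"
      using s by (auto simp: prime_power_divs_def elim!: primepow_dvd_M)
    \<comment> \<open>A lower power of \<open>l\<close> besides the full one would make
      \<open>l ^ 2\<close> divide the cardinality \<open>p * q * r\<close>.\<close>
    have "k = n"
    proof (rule ccontr)
      assume "k \<noteq> n"
      have "l ^ card {k, n} dvd card A"
        by (rule prime_power_dvd_card[OF prime_power_dvd(1)[OF l(1)] fin, where n = n])
          (use s l top[OF l(1)] in \<open>auto simp: prime_power_divs_def\<close>)
      then show False using \<open>k \<noteq> n\<close> prime_power_dvd(4)[OF l(1)] card by (simp add: numeral_2_eq_2)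
    qed
    then show ?thesis using l by blast
  qed
  show ?thesis unfolding T2_def
  proof (intro allI impI, elim conjE)
    fix T assume T: "T \<subseteq> prime_power_divs M A" "finite T" "T \<noteq> {}" "inj_on aprimedivisor T"
    have mem: "primepow s" "s dvd M" if "s \<in> T" for s using T(1) that by (auto simp: prime_power_divs_def)
    show "cyclotomic (\<Prod>T) dvd mask_poly A"
    proof (rule vanish)
      show "\<Prod>T dvd M" by (rule prod_prime_powers_dvd[OF T(2,4) mem])
      obtain s where s: "s \<in> T" using T(3) by blast
      then obtain l n where l: "(l, n) \<in> top_exponents" "s = l ^ n" using only_top T(1) by blast
      have "s dvd \<Prod>T" using s T(2) by (rule dvd_prodI[rotated])
      moreover have "\<not> s dvd D" using prime_power_dvd(3)[OF l(1), of n] l(2) by simp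
      ultimately show "\<not> \<Prod>T dvd D" by (metis dvd_trans)
      have sq: "l\<^sup>2 dvd \<Prod>T \<or> \<not> l dvd \<Prod>T" if l2: "(l, 2) \<in> top_exponents" and u: "\<And>n. (l, n) \<in> top_exponents \<Longrightarrow> n = 2" for l
      proof (cases "l dvd \<Prod>T")
        case True
        have pl: "prime l" by (rule prime_power_dvd(1)[OF l2])
        obtain s where s: "s \<in> T" "l dvd s" using True pl T(2) by (auto simp: prime_dvd_prod_iff)
        obtain l' n where l': "(l', n) \<in> top_exponents" "s = l' ^ n" using only_top s T(1) by blast
        have "l dvd l'" using s(2) pl unfolding l'(2) by (rule prime_dvd_power[rotated])
        then have "l = l'" using pl prime_power_dvd(1)[OF l'(1)] by (simp add: primes_dvd_imp_eq)
        then have "s = l\<^sup>2" using l' u by blast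
        then show ?thesis using dvd_prodI[OF T(2) s(1), of "\<lambda>s. s"] by simp
      qed simp
      show "q\<^sup>2 dvd \<Prod>T \<or> \<not> q dvd \<Prod>T" "r\<^sup>2 dvd \<Prod>T \<or> \<not> r dvd \<Prod>T"
        by (rule sq; use distinct in \<open>auto simp: top_exponents_def\<close>)+
    qed
  qed
qed

text \<open>\<open>B\<close> is a complete residue system modulo \<open>D\<close>, so its sums
  vanish at every order \<open>s\<close> with \<open>s dvd D\<close> and
  \<open>s \<noteq> 1\<close>. It remains to see that no other prime powers belong to S_B.\<close>

lemma T2_of_complement:
  assumes B: "B \<subseteq> zmod M" "card B = D"
    and mod_D: "\<And>b b'. b \<in> B \<Longrightarrow> b' \<in> B \<Longrightarrow> int p ^ m dvd b - b' \<Longrightarrow> int q dvd b - b' \<Longrightarrow> int r dvd b - b' \<Longrightarrow> b = b'"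
  shows "T2 M B"
proof -
  have fin: "finite B" "\<And>y. y \<in> B \<Longrightarrow> 0 \<le> y" using B(1) by (auto simp: zmod_def intro: finite_subset)
  have vanish: "cyclotomic s dvd mask_poly B" if s: "s dvd D" "s \<noteq> 1" for s
  proof (rule cyclotomic_dvd_maskI)
    show "s > 0" using s(1) D_pos by (rule dvd_pos_nat[rotated])
    fix z assume z: "primitive_root s z"
    show "(\<Sum>y\<in>B. z ^ nat y) = 0"
    proof (rule complete_residues_sum_eq_0[OF fin B(2) _ z s D_pos])
      show "b = b'" if "b \<in> B" "b' \<in> B" "int D dvd b - b'" for b b'
        using mod_D that unfolding D_dvd_iff by blast
    qed
  qed
  have dvd_D: "s dvd D" if s: "s \<in> prime_power_divs M B" for s
  proof (rule ccontr)
    assume nd: "\<not> s dvd D"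
    obtain l n k where l: "(l, n) \<in> top_exponents" "s = l ^ k" "0 < k" "k \<le> n" "s dvd D \<longleftrightarrow> k < n"
      using s by (auto simp: prime_power_divs_def elim!: primepow_dvd_M)
    then have kn: "k = n" using nd by simp
    have pl: "prime l" by (rule prime_power_dvd(1)[OF l(1)])
    \<comment> \<open>The divisors \<open>l ^ i\<close> of \<open>D\<close> already account for the
      exponents below \<open>n\<close>; one more would make \<open>l ^ n\<close> divide
      \<open>card B\<close>, which is \<open>D\<close>.\<close>
    have "l ^ card {1..n} dvd card B"
    proof (rule prime_power_dvd_card[OF pl fin])
      fix i assume i: "i \<in> {1..n}"
      show "cyclotomic (l ^ i) dvd mask_poly B"
      proof (cases "i = n")
        case True
        then show ?thesis using s l kn by (simp add: prime_power_divs_def)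
      next
        case False
        then have "l ^ i dvd D" using prime_power_dvd(3)[OF l(1)] i by simp
        moreover have "l ^ i \<noteq> 1" using pl i by (simp add: prime_nat_iff)
        ultimately show ?thesis by (rule vanish)
      qed
    qed auto
    then show False using prime_power_dvd(3)[OF l(1), of n] B(2) by simp
  qed
  show ?thesis unfolding T2_def
  proof (intro allI impI, elim conjE)
    fix T assume T: "T \<subseteq> prime_power_divs M B" "finite T" "T \<noteq> {}" "inj_on aprimedivisor T"
    have mem: "primepow s" if "s \<in> T" for s using T(1) that by (auto simp: prime_power_divs_def)
    show "cyclotomic (\<Prod>T) dvd mask_poly B"
    proof (rule vanish)
      show "\<Prod>T dvd D" by (rule prod_prime_powers_dvd[OF T(2,4) mem dvd_D[OF subsetD[OF T(1)]]])
      obtain s where s: "s \<in> T" using T(3) by blast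
      have "s dvd \<Prod>T" using dvd_prodI[OF T(2) s, of "\<lambda>s. s"] by simp
      moreover have "s \<noteq> 1" using mem[OF s] by (auto simp: primepow_def)
      ultimately show "\<Prod>T \<noteq> 1" by (metis nat_dvd_1_iff_1)
    qed
  qed
qed

end

subsection \<open>The shifts that fill the grid\<close>

context three_primes
begin

text \<open>The two planes of the corner are filled before all others, because
  \<open>plane_cover\<close> compares any further plane with both.\<close>

lemma extended_corner_shifts:
  assumes t: "tiling M A B" and card: "card A = p * q * r"
    and ec: "extended_corner M p q r A (grid M D x)"
  shows "(fiber_shift M {q, r} B)\<^sup>*\<^sup>* A (grid M D x)"
    and "\<And>b b'. b \<in> B \<Longrightarrow> b' \<in> B \<Longrightarrow> int p ^ m dvd b - b' \<Longrightarrow> int q dvd b - b' \<Longrightarrow> int r dvd b - b' \<Longrightarrow> b = b'"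
proof -
  interpret sw3: three_primes p r q m M by (rule swapped)
  have A: "A \<subseteq> zmod M" using t by (simp add: tiling_def)
  obtain a a' where a: "a \<in> A" "a \<in> grid M D x" "a' \<in> A" "a' \<in> grid M D x"
    and g: "gcd (a - a') (int M) = int (M div p)"
    and fib: "fibered M q (A \<inter> plane_at M q r a)" "\<not> fibered M r (A \<inter> plane_at M q r a)"
    and fib': "fibered M r (A \<inter> plane_at M q r a')" "\<not> fibered M q (A \<inter> plane_at M q r a')"
    using ec unfolding extended_corner_def by blast
  have ax: "int p ^ m dvd a - x" "int q dvd a - x" "int r dvd a - x"
    and ax': "int p ^ m dvd a' - x" "int q dvd a' - x" "int r dvd a' - x"
    using a(2,4) unfolding in_grid D_dvd_iff by blast+
  have plane: "y \<in> plane_at M q r c \<longleftrightarrow> y \<in> zmod M \<and> P dvd y - c \<and> int q dvd y - x \<and> int r dvd y - x"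
    if "int q dvd c - x" "int r dvd c - x" for y c
    unfolding in_plane_at using that by (meson dvd_sym dvd_tr)
  have pl: "A \<inter> plane_at M q r c \<subseteq> zmod M" for c using A by blast
  have a01: "int p ^ m dvd a - a'" using ax(1) ax'(1) by (metis dvd_sym dvd_tr)
  \<comment> \<open>Otherwise \<open>a - a'\<close> would be divisible by \<open>M\<close>, and the
    gcd would be \<open>M\<close> instead of \<open>M div p\<close>.\<close>
  have a01': "\<not> P dvd a - a'"
  proof
    assume P: "P dvd a - a'"
    have "int p ^ m * Q * R dvd a - a'" using g unfolding M_div by (metis gcd_dvd1)
    then have "Q dvd a - a'" "R dvd a - a'" by (meson dvd_mult_left dvd_mult_right)+
    then have "int M dvd a - a'" using P by (simp add: M_dvd_iff)
    then have "int M dvd int (M div p)" using g by (metis gcd_greatest dvd_refl)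
    then have "M dvd M div p" by (simp only: int_dvd_int_iff)
    moreover have "int (M div p) > 0" unfolding M_div using pos by simp
    moreover have "M div p < M" using pos prime_gt_1_nat[OF primes(1)] by (intro div_less_dividend) auto
    ultimately show False by (simp add: nat_dvd_not_less)
  qed
  have fill_q: "\<exists>z'\<in>A. P dvd z' - a \<and> Q dvd z' - v \<and> R dvd z' - z"
    if z: "z \<in> A" "P dvd z - a" "int q dvd z - x" "int r dvd z - x" and v: "int q dvd v - x" for z v
  proof -
    obtain y where y: "y \<in> zmod M" "P dvd y - a" "Q dvd y - v" "R dvd y - z" using crt by blast
    have "z \<in> A \<inter> plane_at M q r a" using z A plane[OF ax(2,3)] by blast
    then have sub: "fiber_at M q z \<subseteq> A" using fib(1) unfolding fibered_iff[OF pl] by blast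
    have "int q dvd y - z" using dvd_mult_left[OF y(3)] v z(3) by (meson dvd_sym dvd_tr)
    moreover have "P dvd y - z" using y(2) z(2) by (meson dvd_sym dvd_tr)
    ultimately have "y \<in> A" using sub y by (auto simp: in_fiber_at)
    then show ?thesis using y by blast
  qed
  have fill_r: "\<exists>z'\<in>A. P dvd z' - a' \<and> R dvd z' - v \<and> Q dvd z' - z"
    if z: "z \<in> A" "P dvd z - a'" "int q dvd z - x" "int r dvd z - x" and v: "int r dvd v - x" for z v
  proof -
    obtain y where y: "y \<in> zmod M" "P dvd y - a'" "Q dvd y - z" "R dvd y - v" using crt by blast
    have "z \<in> A \<inter> plane_at M q r a'" using z A plane[OF ax'(2,3)] by blast
    then have sub: "fiber_at M r z \<subseteq> A" using fib'(1) unfolding sw3.fibered_iff[OF pl] by blast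
    have "int r dvd y - z" using dvd_mult_left[OF y(4)] v z(4) by (meson dvd_sym dvd_tr)
    moreover have "P dvd y - z" using y(2) z(2) by (meson dvd_sym dvd_tr)
    ultimately have "y \<in> A" using sub y by (auto simp: sw3.in_fiber_at)
    then show ?thesis using y by blast
  qed
  \<comment> \<open>A failing \<open>r\<close>-fiber yields one missing point \<open>y\<close>;
    since the plane is fibered in the \<open>q\<close> direction, the whole \<open>q\<close>-line
    through \<open>y\<close> is missing.\<close>
  have hole_r: "\<exists>k. int r dvd k - x \<and> (\<forall>z\<in>A. P dvd z - a \<longrightarrow> int q dvd z - x \<longrightarrow> \<not> R dvd z - k)"
  proof -
    obtain z y where z: "z \<in> A \<inter> plane_at M q r a" "y \<in> fiber_at M r z" "y \<notin> A \<inter> plane_at M q r a"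
      using fib(2) unfolding sw3.fibered_iff[OF pl] by blast
    have zp: "P dvd z - a" "int q dvd z - x" "int r dvd z - x" using z(1) plane[OF ax(2,3)] by blast+
    have yz: "y \<in> zmod M" "P dvd y - z" "int r dvd y - z" "Q dvd y - z" using z(2) by (auto simp: sw3.in_fiber_at)
    have yp: "P dvd y - a" "int q dvd y - x" "int r dvd y - x"
      using dvd_tr[OF yz(2) zp(1)] dvd_tr[OF dvd_mult_left[OF yz(4)] zp(2)] dvd_tr[OF yz(3) zp(3)] by blast+
    then have "y \<notin> A" using z(3) yz(1) plane[OF ax(2,3)] by blast
    moreover have "y \<in> A" if w: "w \<in> A" "P dvd w - a" "int q dvd w - x" "R dvd w - y" for w
    proof -
      have "int r dvd w - x" using dvd_tr[OF dvd_mult_left[OF w(4)] yp(3)] .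
      from fill_q[OF w(1-3) this yp(2)]
      obtain w' where w': "w' \<in> A" "P dvd w' - a" "Q dvd w' - y" "R dvd w' - w" by blast
      have "P dvd w' - y" using w'(2) yp(1) by (meson dvd_sym dvd_tr)
      moreover have "R dvd w' - y" using dvd_tr[OF w'(4) w(4)] .
      ultimately have "w' = y" using zmod_eqI w'(1,3) A yz(1) by blast
      then show ?thesis using w' by simp
    qed
    ultimately show ?thesis using yp(3) by blast
  qed
  have hole_q: "\<exists>j. int q dvd j - x \<and> (\<forall>z\<in>A. P dvd z - a' \<longrightarrow> int r dvd z - x \<longrightarrow> \<not> Q dvd z - j)"
  proof -
    obtain z y where z: "z \<in> A \<inter> plane_at M q r a'" "y \<in> fiber_at M q z" "y \<notin> A \<inter> plane_at M q r a'"
      using fib'(2) unfolding fibered_iff[OF pl] by blast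
    have zp: "P dvd z - a'" "int q dvd z - x" "int r dvd z - x" using z(1) plane[OF ax'(2,3)] by blast+
    have yz: "y \<in> zmod M" "P dvd y - z" "int q dvd y - z" "R dvd y - z" using z(2) by (auto simp: in_fiber_at)
    have yp: "P dvd y - a'" "int q dvd y - x" "int r dvd y - x"
      using dvd_tr[OF yz(2) zp(1)] dvd_tr[OF yz(3) zp(2)] dvd_tr[OF dvd_mult_left[OF yz(4)] zp(3)] by blast+
    then have "y \<notin> A" using z(3) yz(1) plane[OF ax'(2,3)] by blast
    moreover have "y \<in> A" if w: "w \<in> A" "P dvd w - a'" "int r dvd w - x" "Q dvd w - y" for w
    proof -
      have "int q dvd w - x" using dvd_tr[OF dvd_mult_left[OF w(4)] yp(2)] .
      from fill_r[OF w(1,2) this w(3) yp(3)]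
      obtain w' where w': "w' \<in> A" "P dvd w' - a'" "R dvd w' - y" "Q dvd w' - w" by blast
      have "P dvd w' - y" using w'(2) yp(1) by (meson dvd_sym dvd_tr)
      moreover have "Q dvd w' - y" using dvd_tr[OF w'(4) w(4)] .
      ultimately have "w' = y" using zmod_eqI w'(1,3) A yz(1) by blast
      then show ?thesis using w' by simp
    qed
    ultimately show ?thesis using yp(2) by blast
  qed
  interpret dt: dilation_tiling "int p" "int q" "int r" m A B by (rule dilation_tiling[OF t card])
  \<comment> \<open>The \<open>q\<close>-line passes through \<open>a\<close> and the
    \<open>r\<close>-line through \<open>a'\<close>, hence \<open>j0\<close> is \<open>a'\<close>
    and \<open>k0\<close> is \<open>a\<close>.\<close>
  interpret c: corner "int p" "int q" "int r" m A B x a a' a' a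
  proof
    show "int p ^ m dvd a - a'" "\<not> P dvd a - a'" by (rule a01 a01')+
    show "int q dvd a' - x" "int r dvd a - x" by (rule ax' ax)+
    show "\<exists>z\<in>A. P dvd z - a \<and> Q dvd z - v \<and> R dvd z - a" if "int q dvd v - x" for v
      using fill_q[OF a(1) _ ax(2,3) that] by simp
    show "\<exists>z\<in>A. P dvd z - a' \<and> Q dvd z - a' \<and> R dvd z - w" if "int r dvd w - x" for w
      using fill_r[OF a(3) _ ax'(2,3) that] by auto
  qed (rule hole_r hole_q)+
  interpret sw: corner "int p" "int r" "int q" m A B x a' a a a' by (rule c.swapped_corner)
  interpret s: shift_setting p q r m M B
  proof
    show "\<exists>b'\<in>B. P dvd b' - b \<and> R dvd b' - b \<and> int q dvd b' - w" if "b \<in> B" for b w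
      by (rule c.B_row_q[OF that])
    show "\<exists>b'\<in>B. P dvd b' - b \<and> Q dvd b' - b \<and> int r dvd b' - w" if "b \<in> B" for b w
      by (rule sw.B_row_q[OF that])
  qed
  show mod_D: "b = b'" if "b \<in> B" "b' \<in> B" "int p ^ m dvd b - b'" "int q dvd b - b'" "int r dvd b - b'" for b b'
    by (rule c.B_eq_mod_D[OF that])
  have "\<exists>S. (fiber_shift M {q, r} B)\<^sup>*\<^sup>* A S \<and> tiling M S B \<and> s.full_plane x a S \<and>
    (\<forall>z. \<not> P dvd z - a \<longrightarrow> (z \<in> S \<longleftrightarrow> z \<in> A))"
  proof (rule s.fill_plane_rows[OF t, of x])
    fix w assume w: "int r dvd w - x"
    show "\<exists>u. \<forall>v. int q dvd v - u \<longrightarrow> (\<exists>z\<in>A. P dvd z - a \<and> R dvd z - w \<and> Q dvd z - v)"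
    proof (cases "\<forall>z\<in>A. P dvd z - a \<longrightarrow> int q dvd z - x \<longrightarrow> \<not> R dvd z - w")
      case True
      then show ?thesis using c.shifted_fiber[of w] w by blast
    next
      case False
      then obtain z where z: "z \<in> A" "P dvd z - a" "int q dvd z - x" "R dvd z - w" by blast
      have zr: "int r dvd z - x" using dvd_tr[OF dvd_mult_left[OF z(4)] w] .
      have "\<exists>z'\<in>A. P dvd z' - a \<and> R dvd z' - w \<and> Q dvd z' - v" if v: "int q dvd v - x" for v
        using fill_q[OF z(1-3) zr v] dvd_tr[OF _ z(4)] by blast
      then show ?thesis by blast
    qed
  qed
  then obtain S1 where S1: "(fiber_shift M {q, r} B)\<^sup>*\<^sup>* A S1" "tiling M S1 B" "s.full_plane x a S1"
    "\<forall>z. \<not> P dvd z - a \<longrightarrow> (z \<in> S1 \<longleftrightarrow> z \<in> A)"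
    by (elim exE conjE) (rule that; assumption)
  \<comment> \<open>The shifts made so far left the plane of \<open>a'\<close> untouched, so lines
    found in \<open>A\<close> there are still present in \<open>S1\<close>.\<close>
  have in_S1: "z \<in> S1" if "z \<in> A" "P dvd z - a'" for z
  proof -
    have "\<not> P dvd z - a" using a01' that(2) by (meson dvd_sym dvd_tr)
    then show ?thesis using S1(4) that(1) by blast
  qed
  have "\<exists>S. (fiber_shift M {q, r} B)\<^sup>*\<^sup>* S1 S \<and> tiling M S B \<and> s.full_plane x a' S \<and>
    (\<forall>z. \<not> P dvd z - a' \<longrightarrow> (z \<in> S \<longleftrightarrow> z \<in> S1))"
  proof (rule s.fill_plane_columns[OF S1(2), of x])
    fix w assume w: "int q dvd w - x"
    have "\<exists>u. \<forall>v. int r dvd v - u \<longrightarrow> (\<exists>z\<in>A. P dvd z - a' \<and> Q dvd z - w \<and> R dvd z - v)"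
    proof (cases "\<forall>z\<in>A. P dvd z - a' \<longrightarrow> int r dvd z - x \<longrightarrow> \<not> Q dvd z - w")
      case True
      then show ?thesis using sw.shifted_fiber[of w] w by blast
    next
      case False
      then obtain z where z: "z \<in> A" "P dvd z - a'" "int r dvd z - x" "Q dvd z - w" by blast
      have zq: "int q dvd z - x" using dvd_tr[OF dvd_mult_left[OF z(4)] w] .
      have "\<exists>z'\<in>A. P dvd z' - a' \<and> Q dvd z' - w \<and> R dvd z' - v" if v: "int r dvd v - x" for v
        using fill_r[OF z(1,2) zq z(3) v] dvd_tr[OF _ z(4)] by blast
      then show ?thesis by blast
    qed
    then show "\<exists>u. \<forall>v. int r dvd v - u \<longrightarrow> (\<exists>z\<in>S1. P dvd z - a' \<and> Q dvd z - w \<and> R dvd z - v)"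
      using in_S1 by meson
  qed
  then obtain S2 where S2: "(fiber_shift M {q, r} B)\<^sup>*\<^sup>* S1 S2" "tiling M S2 B" "s.full_plane x a' S2"
    "\<forall>z. \<not> P dvd z - a' \<longrightarrow> (z \<in> S2 \<longleftrightarrow> z \<in> S1)"
    by (elim exE conjE) (rule that; assumption)
  have full_a: "s.full_plane x a S2"
  proof (intro allI impI)
    fix v w assume "int q dvd v - x" "int r dvd w - x"
    then obtain z where z: "z \<in> S1" "P dvd z - a" "Q dvd z - v" "R dvd z - w" using S1(3) by blast
    have "\<not> P dvd z - a'" using a01' z(2) by (meson dvd_sym dvd_tr)
    then show "\<exists>z\<in>S2. P dvd z - a \<and> Q dvd z - v \<and> R dvd z - w" using S2(4) z by blast
  qed
  have B0: "card B \<noteq> 0" using t pos unfolding tiling_iff_cover[OF pos(4)] by auto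
  have card_eq: "card S = p * q * r" if "tiling M S B" for S
    using that t card B0 unfolding tiling_iff_cover[OF pos(4)] by (metis mult_right_cancel)
  \<comment> \<open>One representative for each first coordinate that occurs in the grid.\<close>
  define T where "T = {e \<in> {0..<P}. int p ^ m dvd e - a}"
  have finT: "finite T" unfolding T_def by (rule finite_subset[of _ "{0..<P}"]) auto
  have "\<exists>S. (fiber_shift M {q, r} B)\<^sup>*\<^sup>* S2 S \<and> tiling M S B \<and>
    s.full_plane x a S \<and> s.full_plane x a' S \<and> (\<forall>e\<in>T. s.full_plane x e S)"
    by (rule s.fill_planes[OF finT S2(2) card_eq[OF S2(2)] mod_D a01 a01' full_a S2(3)]) (simp_all add: T_def)
  then obtain S where S: "(fiber_shift M {q, r} B)\<^sup>*\<^sup>* S2 S" "tiling M S B" "\<forall>e\<in>T. s.full_plane x e S"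
    by (elim exE conjE) (rule that; assumption)
  have Sz: "S \<subseteq> zmod M" using S(2) by (simp add: tiling_def)
  have "grid M D x \<subseteq> S"
  proof
    fix y assume "y \<in> grid M D x"
    then have y: "y \<in> zmod M" "int p ^ m dvd y - x" "int q dvd y - x" "int r dvd y - x"
      unfolding in_grid D_dvd_iff by blast+
    define e where "e = y mod P"
    have ey: "P dvd e - y" unfolding e_def by (metis mod_eq_dvd_iff mod_mod_trivial)
    have "int p ^ m dvd e - a" using dvd_mult_left[OF ey] y(2) ax(1) by (meson dvd_sym dvd_tr)
    moreover have "e \<in> {0..<P}" unfolding e_def using pos by simp
    ultimately have "e \<in> T" unfolding T_def by blast
    then obtain z where z: "z \<in> S" "P dvd z - e" "Q dvd z - y" "R dvd z - y" using S(3) y(3,4) by blast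
    have "z = y" using zmod_eqI[of z y] z(1,3,4) Sz y(1) dvd_tr[OF z(2) ey] by blast
    then show "y \<in> S" using z by simp
  qed
  moreover have "finite S" using Sz by (rule finite_subset) (simp add: zmod_def)
  ultimately have "grid M D x = S" using card_grid card_eq[OF S(2)] by (intro card_subset_eq) auto
  then show "(fiber_shift M {q, r} B)\<^sup>*\<^sup>* A (grid M D x)"
    using S1(1) S2(1) S(1) by (meson rtranclp_trans)
qed

end

theorem theorem8p1:
  fixes p\<^sub>i p\<^sub>j p\<^sub>k n\<^sub>i M :: nat and A B \<Lambda> :: "int set" and x :: int
  assumes "prime p\<^sub>i" "prime p\<^sub>j" "prime p\<^sub>k"
    and "p\<^sub>i \<noteq> p\<^sub>j" "p\<^sub>i \<noteq> p\<^sub>k" "p\<^sub>j \<noteq> p\<^sub>k"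
    and "n\<^sub>i \<ge> 1"
    and "M = p\<^sub>i ^ n\<^sub>i * p\<^sub>j ^ 2 * p\<^sub>k ^ 2"
    and "tiling M A B"
    and "card A = p\<^sub>i * p\<^sub>j * p\<^sub>k"
    and "cyclotomic M dvd mask_poly A"
    and "\<Lambda> = grid M (p\<^sub>i ^ (n\<^sub>i - 1) * p\<^sub>j * p\<^sub>k) x"
    and "extended_corner M p\<^sub>i p\<^sub>j p\<^sub>k A \<Lambda>"
  shows "T2_equivalent_via_shifts M {p\<^sub>j, p\<^sub>k} A \<Lambda> B \<and> T2 M A \<and> T2 M B"
proof -
  interpret three_primes p\<^sub>i p\<^sub>j p\<^sub>k "n\<^sub>i - 1" M
    by unfold_locales (use assms(1-8) in auto)
  note t = assms(9) and card = assms(10) and L = assms(12)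
  have shifts: "(fiber_shift M {p\<^sub>j, p\<^sub>k} B)\<^sup>*\<^sup>* A \<Lambda>"
    using extended_corner_shifts(1)[OF t card assms(13)[unfolded L]] L by simp
  have "tiling M \<Lambda> B"
    using shifts t by (induction rule: rtranclp_induct) (auto simp: fiber_shift_def)
  moreover have T2A: "T2 M A" by (rule T2_of_shifts[OF shifts[unfolded L] t card])
  \<comment> \<open>The grid is reached from itself by the empty sequence of shifts.\<close>
  moreover have "T2 M \<Lambda>" unfolding L
    by (rule T2_of_shifts[OF rtranclp.rtrancl_refl]) (use calculation(1) L card_grid in auto)
  ultimately have eqv: "T2_equivalent_via_shifts M {p\<^sub>j, p\<^sub>k} A \<Lambda> B"
    using shifts t by (simp add: T2_equivalent_via_shifts_def T2_equivalent_def)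
  have "card A * card B = M" "B \<subseteq> zmod M" using t unfolding tiling_iff_cover[OF pos(4)] by blast+
  then have "(p\<^sub>i * p\<^sub>j * p\<^sub>k) * card B = (p\<^sub>i * p\<^sub>j * p\<^sub>k) * D" unfolding card using M_eq_D by (simp only: mult.commute)
  moreover have "p\<^sub>i * p\<^sub>j * p\<^sub>k \<noteq> 0" using pos by simp
  ultimately have "card B = D" using mult_left_cancel by blast
  then have "T2 M B"
    using \<open>B \<subseteq> zmod M\<close> extended_corner_shifts(2)[OF t card assms(13)[unfolded L]] by (intro T2_of_complement)
  then show ?thesis using eqv T2A by blast
qed



end
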